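(* Let $n\ge2$, let $D\subset\mathbb{R}^n$ be a regular domain, let $\mu>0$ and $x\in D$. Let $\tilde W$ be a one-dimensional standard Brownian motion independent of $W$. Then the $\mu$-panharmonic measure admits the representations $$H^x_\mu(D;\mathrm{d}y)=\mathbb{E}^{x,0}\left[\cos\left(\mu\tilde W(\tau_D)\right);\,W(\tau_D)\in\mathrm{d}y,\ \sup_{t\le\tau_D}|\tilde W(t)|<\frac{\pi}{2\mu}\right]$$ $$=\int_{\tilde y=-\frac{\pi}{2\mu}}^{\frac{\pi}{2\mu}}\cos(\mu\tilde y)\,H^{x,0}\left(D\times\left(-\frac{\pi}{2\mu},\frac{\pi}{2\mu}\right);\,\mathrm{d}y\otimes\mathrm{d}\tilde y\right).$$ Consequently, all bounded solutions $u$ of the Yukawa--Dirichlet problem $\Delta u=\mu^2u$ on $D$, $u=f$ on $\partial D$, with $f:\partial D\to\mathbb{R}$ continuous and bounded, are given by the panharmonic measure: $u(x)=\int_{\partial D}f(y)\,H^x_\mu(D;\mathrm{d}y)$ for all $x\in D$.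
   Context: $W$ is standard $n$-dimensional Brownian motion (generator $\frac12\Delta$); under $\mathbb{P}^{x,0}$ (expectation $\mathbb{E}^{x,0}$) the $(n+1)$-dimensional Brownian motion $(W,\tilde W)$ starts from $(x,0)$. $\mathbb{E}[X;A]=\mathbb{E}[X\mathbf{1}_A]$. For a domain $D\subset\mathbb{R}^n$, $\tau_D=\inf\{t>0: W(t)\in D^c\}$, with $\inf\emptyset=\infty$ (the event in the first representation is contained in $\{\tau_D<\infty\}$). $D$ is regular if $\mathbb{P}^x[\tau_D=0]=1$ for all $x\in\partial D$. For a regular domain $G\subset\mathbb{R}^{n+1}$, the harmonic measure $H^{x,0}(G;\cdot)$ with pole $(x,0)\in G$ is the distribution on $\partial G$ of the position of $(W,\tilde W)$, started at $(x,0)$, at its first exit time from $G$ (on the event that this time is finite). In the second representation this measure, for $G=D\times(-\frac{\pi}{2\mu},\frac{\pi}{2\mu})$, is restricted to the lateral boundary $\partial D\times(-\frac{\pi}{2\mu},\frac{\pi}{2\mu})$. A function is $\mu$-panharmonic on $D$ if it is $C^2$ on $D$ and satisfies $\Delta u=\mu^2u$ there. A solution of the Yukawa--Dirichlet problem with data $f$ is a continuous function on $\overline D$, $\mu$-panharmonic on $D$, equal to $f$ on $\partial D$. The $\mu$-panharmonic measure on $\partial D$ with pole $x\in D$ is the Borel measure $H^x_\mu(D;\cdot)$ on $\partial D$ such that $u(x)=\int_{\partial D}u(y)\,H^x_\mu(D;\mathrm{d}y)$ for every bounded continuous $u:\overline D\to\mathbb{R}$ that is $\mu$-panharmonic on $D$.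 *)

theory Defs
  imports "HOL-Probability.Probability"
begin

section \<open>Brownian motion\<close>

text \<open>
  Standard Brownian motion started at \<open>z\<close>: the increment over \<open>[s, t]\<close> is centred Gaussian with
  covariance \<open>(t - s) * Id\<close>, so the generator is one half of the Laplacian. Only times \<open>t \<ge> 0\<close>
  matter. All paths are continuous, whereas the starting point is prescribed only almost surely:
  this lets one process carry a whole family of laws, one for each starting point.
\<close>

locale brownian_motion = prob_space M
  for M :: "'w measure" and W :: "real \<Rightarrow> 'w \<Rightarrow> 'a::euclidean_space" and z :: 'a +
  assumes measurable: "\<And>t. 0 \<le> t \<Longrightarrow> random_variable borel (W t)"
    and start: "AE \<omega> in M. W 0 \<omega> = z"
    and continuous_paths: "\<And>\<omega>. \<omega> \<in> space M \<Longrightarrow> continuous_on {0..} (\<lambda>t. W t \<omega>)"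
    and gaussian_increments: "\<And>s t. 0 \<le> s \<Longrightarrow> s < t \<Longrightarrow>
      distributed M lborel (\<lambda>\<omega>. W t \<omega> - W s \<omega>)
        (\<lambda>v. ennreal (\<Prod>b\<in>Basis. normal_density 0 (sqrt (t - s)) (v \<bullet> b)))"
    and independent_increments: "\<And>(k::nat) (t::nat \<Rightarrow> real). 0 \<le> t 0 \<Longrightarrow> (\<And>i. i < k \<Longrightarrow> t i < t (Suc i)) \<Longrightarrow>
      indep_vars (\<lambda>_. borel) (\<lambda>i \<omega>. W (t (Suc i)) \<omega> - W (t i) \<omega>) {..<k}"

definition generated_events ::
    "'w measure \<Rightarrow> (real \<Rightarrow> 'w \<Rightarrow> 'a::topological_space) \<Rightarrow> 'w set set" where
  "generated_events M X =
     sigma_sets (space M) (\<Union>t\<in>{0..}. {X t -` A \<inter> space M | A. A \<in> sets borel})"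

definition independent_processes ::
    "'w measure \<Rightarrow> (real \<Rightarrow> 'w \<Rightarrow> 'a::topological_space) \<Rightarrow> (real \<Rightarrow> 'w \<Rightarrow> 'b::topological_space) \<Rightarrow> bool"
  where "independent_processes M X Y \<longleftrightarrow>
     prob_space.indep_set M (generated_events M X) (generated_events M Y)"


section \<open>Exit times, regular domains and harmonic measure\<close>

text \<open>The infimum is taken in the extended reals, where \<open>Inf {} = \<infinity>\<close>.\<close>

definition exit_time :: "(real \<Rightarrow> 'w \<Rightarrow> 'a) \<Rightarrow> 'a set \<Rightarrow> 'w \<Rightarrow> ereal" where
  "exit_time Z D \<omega> = (INF t\<in>{t. 0 < t \<and> Z t \<omega> \<notin> D}. ereal t)"

text \<open>The position at the exit time is meaningful only where the exit time is finite.\<close>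

definition stopped :: "(real \<Rightarrow> 'w \<Rightarrow> 'b) \<Rightarrow> ('w \<Rightarrow> ereal) \<Rightarrow> 'w \<Rightarrow> 'b" where
  "stopped Z T \<omega> = Z (real_of_ereal (T \<omega>)) \<omega>"

text \<open>\<open>P y\<close> is the law under which \<open>W\<close> starts at \<open>y\<close>.\<close>

definition regular_domain ::
    "('a::euclidean_space \<Rightarrow> 'w measure) \<Rightarrow> (real \<Rightarrow> 'w \<Rightarrow> 'a) \<Rightarrow> 'a set \<Rightarrow> bool" where
  "regular_domain P W D \<longleftrightarrow> open D \<and> connected D \<and> D \<noteq> {} \<and>
     (\<forall>y\<in>frontier D. AE \<omega> in P y. exit_time W D \<omega> = 0)"

text \<open>The pole is the starting point of \<open>Z\<close> under \<open>M\<close>.\<close>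

definition harmonic_measure ::
    "'w measure \<Rightarrow> (real \<Rightarrow> 'w \<Rightarrow> 'a::euclidean_space) \<Rightarrow> 'a set \<Rightarrow> 'a measure" where
  "harmonic_measure M Z G =
     restrict_space
       (distr (restrict_space M {\<omega> \<in> space M. exit_time Z G \<omega> < \<infinity>}) borel
          (stopped Z (exit_time Z G)))
       (frontier G)"


section \<open>Panharmonic functions and panharmonic measure\<close>

definition partial_deriv :: "'a::euclidean_space \<Rightarrow> ('a \<Rightarrow> real) \<Rightarrow> 'a \<Rightarrow> real" where
  "partial_deriv b u x = frechet_derivative u (at x) b"

definition C2_on :: "'a::euclidean_space set \<Rightarrow> ('a \<Rightarrow> real) \<Rightarrow> bool" where
  "C2_on D u \<longleftrightarrow>
     (\<forall>x\<in>D. u differentiable (at x)) \<and>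
     (\<forall>b\<in>Basis. \<forall>x\<in>D. partial_deriv b u differentiable (at x)) \<and>
     (\<forall>b\<in>Basis. \<forall>c\<in>Basis. continuous_on D (partial_deriv c (partial_deriv b u)))"

definition laplacian :: "('a::euclidean_space \<Rightarrow> real) \<Rightarrow> 'a \<Rightarrow> real" where
  "laplacian u x = (\<Sum>b\<in>Basis. partial_deriv b (partial_deriv b u) x)"

definition panharmonic_on :: "real \<Rightarrow> 'a::euclidean_space set \<Rightarrow> ('a \<Rightarrow> real) \<Rightarrow> bool" where
  "panharmonic_on \<mu> D u \<longleftrightarrow> C2_on D u \<and> (\<forall>x\<in>D. laplacian u x = \<mu>\<^sup>2 * u x)"

text \<open>Functions on the closure or on the boundary are total functions; values elsewhere are ignored.\<close>

definition yukawa_dirichlet_solution ::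
    "real \<Rightarrow> 'a::euclidean_space set \<Rightarrow> ('a \<Rightarrow> real) \<Rightarrow> ('a \<Rightarrow> real) \<Rightarrow> bool" where
  "yukawa_dirichlet_solution \<mu> D f u \<longleftrightarrow>
     continuous_on (closure D) u \<and> panharmonic_on \<mu> D u \<and> (\<forall>y\<in>frontier D. u y = f y)"

definition is_panharmonic_measure ::
    "real \<Rightarrow> 'a::euclidean_space set \<Rightarrow> 'a \<Rightarrow> 'a measure \<Rightarrow> bool" where
  "is_panharmonic_measure \<mu> D x H \<longleftrightarrow>
     sets H = sets (restrict_space borel (frontier D)) \<and>
     (\<forall>u. continuous_on (closure D) u \<and> bounded (u ` closure D) \<and> panharmonic_on \<mu> D u \<longrightarrow>
        has_bochner_integral H u (u x))"

definition panharmonic_measure ::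
    "real \<Rightarrow> 'a::euclidean_space set \<Rightarrow> 'a \<Rightarrow> 'a measure" where
  "panharmonic_measure \<mu> D x = (THE H. is_panharmonic_measure \<mu> D x H)"

end

theory Submission
  imports Defs
begin

text \<open>The panharmonic measure is \<open>H(A) = E\<^sup>x[exp (- \<mu>\<^sup>2 \<tau> / 2); W(\<tau>) \<in> A]\<close>, where \<open>\<tau>\<close> is the exit time of \<open>D\<close>.
  For \<open>f\<close> bounded and continuous let \<open>U(z) = E\<^sup>z[exp (- \<mu>\<^sup>2 \<tau> / 2) f(W(\<tau>))]\<close>. By the Markov property at the fixed
  time \<open>t\<close> and a maximal inequality, \<open>U\<close> differs from \<open>exp (- \<mu>\<^sup>2 t / 2)\<close> times its image under the heat
  semigroup by \<open>O(t\<^sup>2)\<close>, locally uniformly in \<open>D\<close>. The heat semigroup smooths at a known rate, so these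
  images converge along \<open>t = 2\<^sup>-\<^sup>j\<close> together with their first two derivatives: \<open>U\<close> is \<open>C\<^sup>2\<close>, and Taylor's formula
  turns the \<open>O(t\<^sup>2)\<close> estimate into \<open>\<Delta>U = \<mu>\<^sup>2 U\<close>. Regularity of the boundary gives \<open>U = f\<close> on \<open>\<partial>D\<close>, and by the
  maximum principle \<open>U\<close> is the only bounded solution; this determines \<open>H\<close>.
  Finally, one-dimensional Brownian motion killed at \<open>\<plusminus>\<pi>/(2\<mu>)\<close> satisfies
  \<open>E[cos (\<mu> W(t)); not killed before t] = exp (- \<mu>\<^sup>2 t / 2)\<close>, and by independence \<open>\<tau>\<close> may be put in the place of \<open>t\<close>.\<close>

section \<open>Gaussian measures and the heat semigroup\<close>

text \<open>The Markov property is used at deterministic times only. A mean value property over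
  spheres would need it at the exit time of a ball; this is why smoothness and the equation come
  from a comparison with the heat semigroup. The exponent in \<open>O(t\<^sup>2)\<close> is
  decisive. Second moments would bound the probability of leaving a ball before \<open>t\<close> by
  \<open>O(t)\<close> at best, and two derivatives of the heat semigroup cost a factor
  \<open>1 / t\<close>, which leaves no decay. Fourth moments give \<open>O(t\<^sup>2)\<close>, so
  that a positive power of \<open>t\<close> survives and sums along the dyadic times. The rate
  \<open>\<mu>\<^sup>2 / 2\<close> belongs to the generator: one half of the Laplacian of
  \<open>U\<close> is \<open>(\<mu>\<^sup>2 / 2) * U\<close>. The level
  \<open>pi / (2 * \<mu>)\<close> is the first zero of \<open>cos (\<mu> * _)\<close>, so that the
  martingale behind the killed cosine vanishes where it is stopped. The laws \<open>P y\<close> are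
  given without any relation between them; they are compared through path functionals of countably
  many sampled values, whose law is determined by finite-dimensional boxes.\<close>

definition gauss :: "real \<Rightarrow> 'a::euclidean_space measure" where
  "gauss t = density lborel (\<lambda>v. ennreal (\<Prod>b\<in>Basis. normal_density 0 (sqrt t) (v \<bullet> b)))"

lemma sets_gauss [simp, measurable_cong]: "sets (gauss t) = sets borel"
  by (simp add: gauss_def)

lemma space_gauss [simp]: "space (gauss t) = UNIV"
  by (simp add: gauss_def)

text \<open>The density and the integrand both factor over the coordinates. With factors 1 and
  indicators this yields the total mass, the marginals and the independence of coordinates.\<close>

lemma nn_integral_gauss_prod:
  fixes f :: "'a::euclidean_space \<Rightarrow> real \<Rightarrow> ennreal"
  assumes [measurable]: "\<And>b. b \<in> Basis \<Longrightarrow> f b \<in> borel_measurable borel"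
  shows "(\<integral>\<^sup>+v. (\<Prod>b\<in>Basis. f b (v \<bullet> b)) \<partial>gauss t)
    = (\<Prod>b\<in>Basis. \<integral>\<^sup>+x. f b x \<partial>density lborel (normal_density 0 (sqrt t)))"
proof -
  have "(\<integral>\<^sup>+v. (\<Prod>b\<in>Basis. f b (v \<bullet> b)) \<partial>gauss t)
    = (\<integral>\<^sup>+v. (\<Prod>b\<in>Basis. ennreal (normal_density 0 (sqrt t) (v \<bullet> b)) * f b (v \<bullet> b)) \<partial>lborel)"
    unfolding gauss_def
    by (subst nn_integral_density) (auto simp: prod.distrib prod_ennreal intro!: borel_measurable_prod_ennreal)
  also have "\<dots> = (\<Prod>b\<in>Basis. \<integral>\<^sup>+x. ennreal (normal_density 0 (sqrt t) x) * f b x \<partial>lborel)"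
    by (rule nn_integral_lborel_prod) auto
  also have "\<dots> = (\<Prod>b\<in>Basis. \<integral>\<^sup>+x. f b x \<partial>density lborel (normal_density 0 (sqrt t)))"
    by (intro prod.cong refl) (auto simp: nn_integral_density)
  finally show ?thesis .
qed

lemma prob_space_gauss:
  assumes "0 < t"
  shows "prob_space (gauss t :: 'a::euclidean_space measure)"
proof
  interpret N: prob_space "density lborel (normal_density 0 (sqrt t))"
    using assms by (intro prob_space_normal_density) auto
  show "emeasure (gauss t :: 'a measure) (space (gauss t)) = 1"
    using nn_integral_gauss_prod[of "\<lambda>_ _. 1" t] N.emeasure_space_1 by simp
qed

text \<open>The last hypothesis lets one computation serve twice: \<open>B = UNIV\<close> with
  \<open>c = b\<close> gives the marginal law, and \<open>b \<noteq> c\<close> gives the joint law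
  of two coordinates.\<close>

lemma emeasure_gauss_pair:
  fixes b c :: "'a::euclidean_space"
  assumes t: "0 < t" and b: "b \<in> Basis" and c: "c \<in> Basis" and [measurable]: "A \<in> sets borel" "B \<in> sets borel"
    and "b \<noteq> c \<or> B = UNIV"
  shows "emeasure (gauss t) {v. v \<bullet> b \<in> A \<and> v \<bullet> c \<in> B} =
    emeasure (density lborel (normal_density 0 (sqrt t))) A * emeasure (density lborel (normal_density 0 (sqrt t))) B"
proof -
  let ?N = "density lborel (normal_density 0 (sqrt t))"
  interpret N: prob_space ?N
    using t by (intro prob_space_normal_density) auto
  have N1: "emeasure ?N UNIV = 1"
    using N.emeasure_space_1 by simp
  define f :: "'a \<Rightarrow> real \<Rightarrow> ennreal" where
    "f i x = (if i = b then indicator A x else 1) * (if i = c then indicator B x else 1)" for i x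
  have [measurable]: "f i \<in> borel_measurable borel" for i
    unfolding f_def by measurable
  have eq: "indicator {v. v \<bullet> b \<in> A \<and> v \<bullet> c \<in> B} v = (\<Prod>i\<in>Basis. f i (v \<bullet> i))" for v
    unfolding f_def prod.distrib using b c by (auto simp: prod.delta split: split_indicator)
  have "emeasure (gauss t) {v. v \<bullet> b \<in> A \<and> v \<bullet> c \<in> B}
      = (\<integral>\<^sup>+v. indicator {v. v \<bullet> b \<in> A \<and> v \<bullet> c \<in> B} v \<partial>gauss t)"
    by (subst nn_integral_indicator) auto
  also have "\<dots> = (\<Prod>i\<in>Basis. \<integral>\<^sup>+x. f i x \<partial>?N)"
    unfolding eq by (rule nn_integral_gauss_prod) auto
  also have "\<dots> = (\<Prod>i\<in>Basis. (if i = b then emeasure ?N A else 1) * (if i = c then emeasure ?N B else 1))"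
  proof (intro prod.cong refl)
    fix i :: 'a
    show "(\<integral>\<^sup>+x. f i x \<partial>?N) = (if i = b then emeasure ?N A else 1) * (if i = c then emeasure ?N B else 1)"
      using assms(6) N1 unfolding f_def by (auto simp: nn_integral_indicator)
  qed
  also have "\<dots> = emeasure ?N A * emeasure ?N B"
    unfolding prod.distrib using b c by (simp add: prod.delta)
  finally show ?thesis .
qed

lemma distr_gauss_inner:
  fixes b :: "'a::euclidean_space"
  assumes "0 < t" "b \<in> Basis"
  shows "distr (gauss t) borel (\<lambda>v. v \<bullet> b) = density lborel (normal_density 0 (sqrt t))"
proof (rule measure_eqI)
  interpret N: prob_space "density lborel (normal_density 0 (sqrt t))"
    using assms by (intro prob_space_normal_density) auto
  fix A assume "A \<in> sets (distr (gauss t) borel (\<lambda>v. v \<bullet> b))"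
  then have [measurable]: "A \<in> sets borel" by simp
  show "emeasure (distr (gauss t) borel (\<lambda>v. v \<bullet> b)) A = emeasure (density lborel (normal_density 0 (sqrt t))) A"
    using emeasure_gauss_pair[OF assms assms(2), of A UNIV] N.emeasure_space_1
    by (subst emeasure_distr) (auto simp: vimage_def)
qed simp

lemma indep_var_gauss_inner:
  fixes b c :: "'a::euclidean_space"
  assumes t: "0 < t" and b: "b \<in> Basis" and c: "c \<in> Basis" and "b \<noteq> c"
  shows "prob_space.indep_var (gauss t) borel (\<lambda>v. v \<bullet> b) borel (\<lambda>v. v \<bullet> c)"
proof -
  interpret G: prob_space "gauss t :: 'a measure" using t by (rule prob_space_gauss)
  let ?N = "density lborel (normal_density 0 (sqrt t))"
  interpret N: prob_space ?N
    using t by (intro prob_space_normal_density) auto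
  have "?N \<Otimes>\<^sub>M ?N = distr (gauss t) (borel \<Otimes>\<^sub>M borel) (\<lambda>v. (v \<bullet> b, v \<bullet> c))"
  proof (rule pair_measure_eqI)
    fix A B assume "A \<in> sets ?N" "B \<in> sets ?N"
    then have [measurable]: "A \<in> sets borel" "B \<in> sets borel" by auto
    show "emeasure ?N A * emeasure ?N B = emeasure (distr (gauss t) (borel \<Otimes>\<^sub>M borel) (\<lambda>v. (v \<bullet> b, v \<bullet> c))) (A \<times> B)"
      using emeasure_gauss_pair[OF t b c, of A B] \<open>b \<noteq> c\<close>
      by (subst emeasure_distr) (auto simp: vimage_def)
  qed (auto intro: N.sigma_finite_measure_axioms simp: sets_pair_measure_cong[of ?N borel ?N borel])
  then show ?thesis
    unfolding G.indep_var_distribution_eq distr_gauss_inner[OF t b] distr_gauss_inner[OF t c]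
    by simp
qed

lemma gauss_inner_moment:
  fixes b :: "'a::euclidean_space"
  assumes t: "0 < t" and b: "b \<in> Basis"
  shows "has_bochner_integral (gauss t) (\<lambda>v. v \<bullet> b) 0"
    and "has_bochner_integral (gauss t) (\<lambda>v. (v \<bullet> b)\<^sup>2) t"
    and "has_bochner_integral (gauss t) (\<lambda>v. (v \<bullet> b)^4) (3 * t\<^sup>2)"
proof -
  have s: "0 < sqrt t" using t by simp
  have *: "has_bochner_integral (gauss t) (\<lambda>v. f (v \<bullet> b)) m"
    if [measurable]: "f \<in> borel_measurable borel" and "has_bochner_integral lborel (\<lambda>x. normal_density 0 (sqrt t) x * f x) m" for f m
  proof -
    have "has_bochner_integral (density lborel (normal_density 0 (sqrt t))) f m"
      using that by (intro has_bochner_integral_density) auto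
    then show ?thesis
      unfolding distr_gauss_inner[OF t b, symmetric] by (simp add: has_bochner_integral_iff integrable_distr_eq integral_distr)
  qed
  show "has_bochner_integral (gauss t) (\<lambda>v. v \<bullet> b) 0"
    using normal_moment_odd[OF s, of 0 0] by (intro *) auto
  show "has_bochner_integral (gauss t) (\<lambda>v. (v \<bullet> b)\<^sup>2) t"
    using normal_moment_even[OF s, of 0 1] t by (intro *) auto
  show "has_bochner_integral (gauss t) (\<lambda>v. (v \<bullet> b)^4) (3 * t\<^sup>2)"
    using normal_moment_even[OF s, of 0 2] t
    by (intro *[of "\<lambda>x. x^4"]) (auto simp: field_simps fact_numeral power2_eq_square)
qed

lemma gauss_inner_cross_moment:
  fixes b c :: "'a::euclidean_space"
  assumes t: "0 < t" and b: "b \<in> Basis" and c: "c \<in> Basis"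
  shows "has_bochner_integral (gauss t) (\<lambda>v. (v \<bullet> b) * (v \<bullet> c)) (if b = c then t else 0)"
proof (cases "b = c")
  case True
  then show ?thesis using gauss_inner_moment(2)[OF t b] by (simp add: power2_eq_square)
next
  case False
  interpret G: prob_space "gauss t :: 'a measure" using t by (rule prob_space_gauss)
  note ind = indep_var_gauss_inner[OF t b c False]
  note m = gauss_inner_moment(1)[OF t b] gauss_inner_moment(1)[OF t c]
  have "integrable (gauss t) (\<lambda>v. (v \<bullet> b) * (v \<bullet> c))"
    using m by (intro G.indep_var_integrable[OF ind]) (auto simp: has_bochner_integral_iff)
  moreover have "(\<integral>v. (v \<bullet> b) * (v \<bullet> c) \<partial>gauss t) = 0"
    using m by (subst G.indep_var_lebesgue_integral[OF ind]) (auto simp: has_bochner_integral_iff)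
  ultimately show ?thesis using False by (simp add: has_bochner_integral_iff)
qed

lemma gauss_inner:
  fixes u :: "'a::euclidean_space"
  assumes t: "0 < t"
  shows "has_bochner_integral (gauss t) (\<lambda>v. v \<bullet> u) 0"
    and "has_bochner_integral (gauss t) (\<lambda>v. (v \<bullet> u)\<^sup>2) (t * (norm u)\<^sup>2)"
proof -
  have "has_bochner_integral (gauss t) (\<lambda>v. \<Sum>b\<in>Basis. (v \<bullet> b) * (u \<bullet> b)) (\<Sum>b\<in>(Basis::'a set). 0 * (u \<bullet> b))"
    by (intro has_bochner_integral_sum has_bochner_integral_mult_left gauss_inner_moment t) auto
  then show "has_bochner_integral (gauss t) (\<lambda>v. v \<bullet> u) 0"
    by (simp add: euclidean_inner[of _ u])
  have "has_bochner_integral (gauss t) (\<lambda>v. \<Sum>b\<in>Basis. \<Sum>c\<in>Basis. ((v \<bullet> b) * (v \<bullet> c)) * ((u \<bullet> b) * (u \<bullet> c)))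
     (\<Sum>b\<in>Basis. \<Sum>c\<in>Basis. (if b = c then t else 0) * ((u \<bullet> b) * (u \<bullet> c)))"
    by (intro has_bochner_integral_sum has_bochner_integral_mult_left gauss_inner_cross_moment t) auto
  also have "(\<lambda>v. \<Sum>b\<in>Basis. \<Sum>c\<in>Basis. ((v \<bullet> b) * (v \<bullet> c)) * ((u \<bullet> b) * (u \<bullet> c))) = (\<lambda>v. (v \<bullet> u)\<^sup>2)"
    by (simp add: euclidean_inner[of _ u] power2_eq_square sum_product mult_ac)
  also have "(\<Sum>b\<in>Basis. \<Sum>c\<in>Basis. (if b = c then t else 0) * ((u \<bullet> b) * (u \<bullet> c))) = t * (norm u)\<^sup>2"
    by (simp add: if_distrib[of "\<lambda>x. x * _"] sum.delta power2_norm_eq_inner euclidean_inner[of u u] sum_distrib_left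
        cong: if_cong)
  finally show "has_bochner_integral (gauss t) (\<lambda>v. (v \<bullet> u)\<^sup>2) (t * (norm u)\<^sup>2)" .
qed

lemma norm_power2_eq_sum: "(norm v)\<^sup>2 = (\<Sum>b\<in>Basis. (v \<bullet> b)\<^sup>2)"
  by (subst power2_norm_eq_inner, subst euclidean_inner) (simp add: power2_eq_square)

lemma norm_power4_le_sum:
  fixes v :: "'a::euclidean_space"
  shows "norm v ^ 4 \<le> DIM('a) * (\<Sum>b\<in>Basis. (v \<bullet> b)^4)"
proof -
  have "norm v ^ 4 = ((norm v)\<^sup>2)\<^sup>2" by simp
  also have "\<dots> = (\<Sum>b\<in>Basis. 1 * (v \<bullet> b)\<^sup>2)\<^sup>2"
    by (simp add: norm_power2_eq_sum)
  also have "\<dots> \<le> (\<Sum>b\<in>(Basis::'a set). 1\<^sup>2) * (\<Sum>b\<in>Basis. ((v \<bullet> b)\<^sup>2)\<^sup>2)"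
    by (rule Cauchy_Schwarz_ineq_sum)
  finally show ?thesis by simp
qed

text \<open>One factor \<open>DIM('a)\<close> comes from Cauchy-Schwarz, the other from the number
  of coordinates, each with fourth moment \<open>3 * t\<^sup>2\<close>. Only the order in
  \<open>t\<close> matters later.\<close>

lemma gauss_norm_power4:
  fixes t :: real
  assumes t: "0 < t"
  shows "integrable (gauss t) (\<lambda>v::'a::euclidean_space. norm v ^ 4)"
    and "(\<integral>v. norm v ^ 4 \<partial>(gauss t :: 'a measure)) \<le> 3 * (DIM('a))\<^sup>2 * t\<^sup>2"
proof -
  have b: "has_bochner_integral (gauss t) (\<lambda>v::'a. DIM('a) * (\<Sum>b\<in>Basis. (v \<bullet> b)^4)) (DIM('a) * (\<Sum>b\<in>(Basis::'a set). 3 * t\<^sup>2))"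
    by (rule has_bochner_integral_mult_right, rule has_bochner_integral_sum, rule gauss_inner_moment(3)[OF t])
  show i: "integrable (gauss t) (\<lambda>v::'a. norm v ^ 4)"
    by (rule Bochner_Integration.integrable_bound[OF integrable.intros[OF b]]) (auto simp: norm_power4_le_sum intro!: AE_I2 order.trans[OF norm_power4_le_sum abs_ge_self])
  show "(\<integral>v. norm v ^ 4 \<partial>(gauss t :: 'a measure)) \<le> 3 * (DIM('a))\<^sup>2 * t\<^sup>2"
    using integral_mono[OF i integrable.intros[OF b] norm_power4_le_sum] has_bochner_integral_integral_eq[OF b]
    by (simp add: power2_eq_square mult_ac)
qed

text \<open>Markov's inequality for the fourth power of the norm. The square would only give order
  \<open>t\<close>, for which the union bound of \<open>maximal_inequality\<close> diverges.\<close>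

lemma gauss_tail:
  fixes t r :: real
  assumes t: "0 < t" and r: "0 < r"
  shows "measure (gauss t :: 'a::euclidean_space measure) {v. r \<le> norm v} \<le> 3 * (DIM('a))\<^sup>2 * t\<^sup>2 / r^4"
proof -
  interpret G: prob_space "gauss t :: 'a measure" using t by (rule prob_space_gauss)
  have "{v::'a. r \<le> norm v} = {v\<in>space (gauss t). r^4 \<le> norm v ^ 4}"
    using r by (auto simp: power_mono_iff)
  then have "measure (gauss t :: 'a::euclidean_space measure) {v. r \<le> norm v} \<le> (\<integral>v. norm v ^ 4 \<partial>(gauss t :: 'a measure)) / r^4"
    using r integral_Markov_inequality_measure[OF gauss_norm_power4(1)[OF t], of "{}" "r^4"] by auto
  also have "\<dots> \<le> 3 * (DIM('a))\<^sup>2 * t\<^sup>2 / r^4"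
    using r by (intro divide_right_mono gauss_norm_power4 t) auto
  finally show ?thesis .
qed

section \<open>The Cameron-Martin formula\<close>

lemma gauss_density_eq:
  fixes v :: "'a::euclidean_space"
  assumes "0 < t"
  shows "(\<Prod>b\<in>Basis. normal_density 0 (sqrt t) (v \<bullet> b)) = (1 / sqrt (2 * pi * t)) ^ DIM('a) * exp (- (norm v)\<^sup>2 / (2 * t))"
proof -
  have "(\<Prod>b\<in>Basis. normal_density 0 (sqrt t) (v \<bullet> b)) = (\<Prod>b\<in>(Basis::'a set). 1 / sqrt (2 * pi * t)) * (\<Prod>b\<in>Basis. exp (- (v \<bullet> b)\<^sup>2 / (2 * t)))"
    unfolding prod.distrib[symmetric] using assms by (intro prod.cong) (auto simp: normal_density_def)
  also have "(\<Prod>b\<in>Basis. exp (- (v \<bullet> b)\<^sup>2 / (2 * t))) = exp (\<Sum>b\<in>Basis. - (v \<bullet> b)\<^sup>2 / (2 * t))"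
    by (simp add: exp_sum)
  also have "(\<Sum>b\<in>Basis. - (v \<bullet> b)\<^sup>2 / (2 * t)) = - (norm v)\<^sup>2 / (2 * t)"
    by (simp add: norm_power2_eq_sum sum_divide_distrib sum_negf)
  finally show ?thesis by simp
qed

text \<open>Completing the square turns a translation of the Gaussian into an exponential weight. In
  \<open>heat t h\<close> the base point thereby moves from \<open>h\<close>, which is only
  measurable, to a smooth weight that can be expanded.\<close>

theorem cameron_martin:
  fixes u :: "'a::euclidean_space"
  assumes t: "0 < t"
  shows "distr (gauss t) borel (\<lambda>v. u + v) = density (gauss t) (\<lambda>v. ennreal (exp ((v \<bullet> u) / t - (norm u)\<^sup>2 / (2 * t))))"
proof (rule measure_eqI)
  fix A :: "'a set" assume "A \<in> sets (distr (gauss t) borel (\<lambda>v. u + v))"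
  then have [measurable]: "A \<in> sets borel" by simp
  let ?K = "\<lambda>v::'a. (1 / sqrt (2 * pi * t)) ^ DIM('a) * exp (- (norm v)\<^sup>2 / (2 * t))"
  let ?E = "\<lambda>v. exp ((v \<bullet> u) / t - (norm u)\<^sup>2 / (2 * t))"
  have g: "gauss t = density lborel (\<lambda>v. ennreal (?K v))"
    unfolding gauss_def gauss_density_eq[OF t] ..
  have K: "?K (v - u) = ?K v * ?E v" for v
  proof -
    have "- (norm (v - u))\<^sup>2 / (2 * t) = - (norm v)\<^sup>2 / (2 * t) + ((v \<bullet> u) / t - (norm u)\<^sup>2 / (2 * t))"
      using t by (simp add: power2_norm_eq_inner inner_diff inner_commute field_simps)
    then show ?thesis by (simp only: exp_add mult.assoc)
  qed
  have "emeasure (distr (gauss t) borel (\<lambda>v. u + v)) A = (\<integral>\<^sup>+v. indicator A v \<partial>distr (gauss t) borel (\<lambda>v. u + v))"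
    by (subst nn_integral_indicator) auto
  also have "\<dots> = (\<integral>\<^sup>+v. indicator A (u + v) \<partial>gauss t)"
    by (subst nn_integral_distr) auto
  also have "\<dots> = (\<integral>\<^sup>+v. ennreal (?K v) * indicator A (u + v) \<partial>lborel)"
    unfolding g by (subst nn_integral_density) auto
  also have "\<dots> = (\<integral>\<^sup>+v. ennreal (?K ((u + v) - u)) * indicator A (u + v) \<partial>lborel)" by simp
  also have "\<dots> = (\<integral>\<^sup>+v. ennreal (?K (v - u)) * indicator A v \<partial>distr lborel borel ((+) u))"
    by (subst nn_integral_distr) auto
  also have "\<dots> = (\<integral>\<^sup>+v. ennreal (?K v) * (ennreal (?E v) * indicator A v) \<partial>lborel)"
    unfolding lborel_distr_plus K by (intro nn_integral_cong, subst ennreal_mult) (use t in \<open>auto simp: mult.assoc\<close>)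
  also have "\<dots> = emeasure (density (gauss t) (\<lambda>v. ennreal (?E v))) A"
    unfolding g by (subst emeasure_density, simp, simp, subst nn_integral_density) auto
  finally show "emeasure (distr (gauss t) borel (\<lambda>v. u + v)) A = emeasure (density (gauss t) (\<lambda>v. ennreal (?E v))) A" .
qed simp

text \<open>Cauchy-Schwarz against the constant 1, read off from the variance of \<bar>Y\<bar> being
  nonnegative.\<close>

lemma (in prob_space) abs_expectation_le_L2:
  fixes Y :: "'a \<Rightarrow> real"
  assumes [measurable]: "random_variable borel Y" and Y2: "has_bochner_integral M (\<lambda>x. (Y x)\<^sup>2) m"
  shows "integrable M Y" and "(\<integral>x. \<bar>Y x\<bar> \<partial>M) \<le> sqrt m"
proof -
  have i2: "integrable M (\<lambda>x. (Y x)\<^sup>2)" "(\<integral>x. (Y x)\<^sup>2 \<partial>M) = m"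
    using Y2 by (auto simp: has_bochner_integral_iff)
  show i: "integrable M Y"
    by (rule square_integrable_imp_integrable[OF assms(1) i2(1)])
  have "0 \<le> variance (\<lambda>x. \<bar>Y x\<bar>)" by (rule variance_positive)
  then have "(\<integral>x. \<bar>Y x\<bar> \<partial>M)\<^sup>2 \<le> m"
    using i i2 variance_eq[of "\<lambda>x. \<bar>Y x\<bar>"] by simp
  then show "(\<integral>x. \<bar>Y x\<bar> \<partial>M) \<le> sqrt m"
    by (rule real_le_rsqrt)
qed

lemma gauss_abs_inner:
  fixes b :: "'a::euclidean_space"
  assumes t: "0 < t"
  shows "integrable (gauss t) (\<lambda>v. v \<bullet> b)" and "(\<integral>v. \<bar>v \<bullet> b\<bar> \<partial>gauss t) \<le> sqrt t * norm b"
proof -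
  interpret G: prob_space "gauss t :: 'a measure" using t by (rule prob_space_gauss)
  show "integrable (gauss t) (\<lambda>v. v \<bullet> b)" using gauss_inner(1)[OF t] by (rule integrable.intros)
  show "(\<integral>v. \<bar>v \<bullet> b\<bar> \<partial>gauss t) \<le> sqrt t * norm b"
    using G.abs_expectation_le_L2(2)[OF _ gauss_inner(2)[OF t, of b]] by (simp add: real_sqrt_mult)
qed

lemma cameron_martin_integral:
  fixes u :: "'a::euclidean_space" and g :: "'a \<Rightarrow> real"
  assumes t: "0 < t" and [measurable]: "g \<in> borel_measurable borel"
    and "has_bochner_integral (gauss t) (\<lambda>v. g (u + v)) m"
  shows "has_bochner_integral (gauss t) (\<lambda>v. exp ((v \<bullet> u) / t - (norm u)\<^sup>2 / (2 * t)) * g v) m"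
proof -
  have "has_bochner_integral (distr (gauss t) borel (\<lambda>v. u + v)) g m"
    using assms by (simp add: has_bochner_integral_iff integrable_distr_eq integral_distr)
  then show ?thesis
    unfolding cameron_martin[OF t]
    by (simp add: has_bochner_integral_iff integrable_density integral_density)
qed

text \<open>\<open>1 + (v \<bullet> u) / t\<close> is the first order expansion of the weight
  \<open>E\<close> in \<open>u\<close>. With \<open>s = (norm u)\<^sup>2 / t\<close> the second
  moment of the remainder is of order \<open>s\<^sup>2\<close>, so its mean absolute value is of
  order \<open>s\<close>, quadratic in \<open>u\<close>: this is differentiability with a
  rate.\<close>

lemma cameron_martin_remainder:
  fixes u :: "'a::euclidean_space"
  assumes t: "0 < t"
  defines "E \<equiv> \<lambda>v. exp ((v \<bullet> u) / t - (norm u)\<^sup>2 / (2 * t))"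
  shows "has_bochner_integral (gauss t) (\<lambda>v. (E v - 1 - (v \<bullet> u) / t)\<^sup>2)
    (exp ((norm u)\<^sup>2 / t) - 1 - (norm u)\<^sup>2 / t)"
proof -
  interpret G: prob_space "gauss t :: 'a measure" using t by (rule prob_space_gauss)
  define s where "s = (norm u)\<^sup>2 / t"
  define X where "X v = (v \<bullet> u) / t" for v
  have [measurable]: "E \<in> borel_measurable borel" "X \<in> borel_measurable borel"
    unfolding E_def X_def by auto
  have one: "has_bochner_integral (gauss t) (\<lambda>v::'a. 1::real) 1"
    by (simp add: has_bochner_integral_iff G.prob_space[unfolded space_gauss])
  have X1: "has_bochner_integral (gauss t) X 0"
    unfolding X_def using has_bochner_integral_divide_zero[OF gauss_inner(1)[OF t, of u], of t] by simp
  have X2: "has_bochner_integral (gauss t) (\<lambda>v. (X v)\<^sup>2) s"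
    using has_bochner_integral_divide_zero[OF gauss_inner(2)[OF t, of u], of "t\<^sup>2"] t
    by (simp add: X_def s_def power_divide power2_eq_square)
  \<comment> \<open>Expectations weighted by \<open>E\<close> are expectations at a point shifted by
    \<open>u\<close>. Under this shift \<open>X\<close> gains the constant \<open>s\<close> and
    \<open>E\<close> the factor \<open>exp s\<close>; all mixed moments follow.\<close>
  have E1: "has_bochner_integral (gauss t) E 1"
    using cameron_martin_integral[OF t, of "\<lambda>_. 1" u 1] one by (simp add: E_def)
  have XE: "has_bochner_integral (gauss t) (\<lambda>v. E v * X v) s"
  proof -
    have "X (u + v) = s + X v" for v
      using t by (simp add: X_def s_def inner_add_left add_divide_distrib power2_norm_eq_inner)
    moreover have "has_bochner_integral (gauss t) (\<lambda>v. s * 1 + X v) (s * 1 + 0)"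
      by (intro has_bochner_integral_add has_bochner_integral_mult_right one X1)
    ultimately show ?thesis
      using cameron_martin_integral[OF t, of X u s] by (simp add: E_def)
  qed
  have EE: "has_bochner_integral (gauss t) (\<lambda>v. E v * E v) (exp s)"
  proof -
    have "E (u + v) = exp s * E v" for v
      using t by (simp add: E_def s_def exp_add[symmetric] inner_add_left power2_norm_eq_inner field_simps)
    moreover have "has_bochner_integral (gauss t) (\<lambda>v. exp s * E v) (exp s * 1)"
      by (intro has_bochner_integral_mult_right E1)
    ultimately show ?thesis
      using cameron_martin_integral[OF t, of E u "exp s"] by (simp add: E_def)
  qed
  have "has_bochner_integral (gauss t)
      (\<lambda>v. E v * E v + 1 + (X v)\<^sup>2 + (-2) * E v + (-2) * (E v * X v) + 2 * X v)
      (exp s + 1 + s + (-2) * 1 + (-2) * s + 2 * 0)"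
    by (intro has_bochner_integral_add has_bochner_integral_mult_right one X1 X2 E1 XE EE)
  moreover have "(\<lambda>v. E v * E v + 1 + (X v)\<^sup>2 + (-2) * E v + (-2) * (E v * X v) + 2 * X v) = (\<lambda>v. (E v - 1 - X v)\<^sup>2)"
    by (auto simp: power2_eq_square algebra_simps)
  ultimately show ?thesis
    by (simp add: X_def s_def)
qed

section \<open>The heat semigroup and its gradient\<close>

definition heat :: "real \<Rightarrow> ('a::euclidean_space \<Rightarrow> real) \<Rightarrow> 'a \<Rightarrow> real" where
  "heat t h z = (\<integral>v. h (z + v) \<partial>gauss t)"

text \<open>The derivative of \<open>heat t h\<close> in direction \<open>b\<close>, with the
  derivative carried by the Gaussian density instead of \<open>h\<close>; it makes sense for bounded
  measurable \<open>h\<close>.\<close>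

definition heatd :: "real \<Rightarrow> 'a::euclidean_space \<Rightarrow> ('a \<Rightarrow> real) \<Rightarrow> 'a \<Rightarrow> real" where
  "heatd t b h z = (\<integral>v. h (z + v) * ((v \<bullet> b) / t) \<partial>gauss t)"

context
  fixes t :: real and h :: "'a::euclidean_space \<Rightarrow> real" and m :: real
  assumes t: "0 < t" and h_meas [measurable]: "h \<in> borel_measurable borel" and h_bound: "\<And>y. \<bar>h y\<bar> \<le> m"
begin

interpretation G: prob_space "gauss t :: 'a measure" using t by (rule prob_space_gauss)

lemma heat_bound_nonneg: "0 \<le> m"
  using h_bound[of undefined] by linarith

lemma integrable_heat: "integrable (gauss t) (\<lambda>v. h (z + v))"
  by (rule G.integrable_const_bound[where B=m]) (auto simp: h_bound)

lemma integrable_heatd: "integrable (gauss t) (\<lambda>v. h (z + v) * ((v \<bullet> b) / t))"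
proof (rule Bochner_Integration.integrable_bound)
  show "integrable (gauss t) (\<lambda>v. m * ((v \<bullet> b) / t))"
    using gauss_abs_inner(1)[OF t, of b] by auto
  show "AE v in gauss t. norm (h (z + v) * ((v \<bullet> b) / t)) \<le> norm (m * ((v \<bullet> b) / t))"
    using heat_bound_nonneg h_bound by (auto simp: abs_mult intro!: mult_right_mono divide_right_mono)
qed simp

lemma borel_measurable_heat [measurable]: "heat t h \<in> borel_measurable borel"
  unfolding heat_def[abs_def] by (rule G.borel_measurable_lebesgue_integral) measurable

lemma borel_measurable_heatd [measurable]: "heatd t b h \<in> borel_measurable borel"
  unfolding heatd_def[abs_def] by (rule G.borel_measurable_lebesgue_integral) measurable

lemma abs_heat_le: "\<bar>heat t h z\<bar> \<le> m"
proof -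
  have "\<bar>heat t h z\<bar> \<le> (\<integral>v. m \<partial>(gauss t :: 'a measure))"
    unfolding heat_def using integrable_heat[of z] h_bound
    by (intro integral_abs_bound_integral) auto
  then show ?thesis using G.prob_space by simp
qed

text \<open>The smoothing rate: one derivative costs \<open>1 / sqrt t\<close>, because the weight
  \<open>(v \<bullet> b) / t\<close> has mean absolute value at most
  \<open>norm b / sqrt t\<close>.\<close>

lemma abs_heatd_le: "\<bar>heatd t b h z\<bar> \<le> m * norm b / sqrt t"
proof -
  have "\<bar>heatd t b h z\<bar> \<le> (\<integral>v. m * (\<bar>v \<bullet> b\<bar> / t) \<partial>gauss t)"
    unfolding heatd_def using integrable_heatd[of z b] h_bound gauss_abs_inner(1)[OF t, of b] t
    by (intro integral_abs_bound_integral) (auto simp: abs_mult intro!: mult_right_mono divide_right_mono)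
  also have "\<dots> = m * ((\<integral>v. \<bar>v \<bullet> b\<bar> \<partial>gauss t) / t)"
    by simp
  also have "\<dots> \<le> m * (sqrt t * norm b / t)"
    using gauss_abs_inner(2)[OF t, of b] t heat_bound_nonneg by (intro mult_left_mono divide_right_mono) auto
  also have "sqrt t * norm b / t = norm b / sqrt t"
    using t by (simp add: field_simps flip: power2_eq_square)
  finally show ?thesis by simp
qed

context
  fixes \<epsilon> r :: real and z :: 'a
  assumes \<epsilon>: "0 \<le> \<epsilon>" and r: "0 < r" and near: "\<And>y. y \<in> ball z r \<Longrightarrow> \<bar>h y\<bar> \<le> \<epsilon>"
begin

text \<open>Outside the ball \<open>norm v / r\<close> is at least 1, so its fourth power dominates
  the indicator of the outside. A single polynomial bound, integrable with order
  \<open>t\<^sup>2\<close>, replaces a splitting of the integral.\<close>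

lemma abs_le_local_power4: "\<bar>h (z + v)\<bar> \<le> \<epsilon> + m * (norm v / r) ^ 4"
proof (cases "norm v < r")
  case True
  then have "\<bar>h (z + v)\<bar> \<le> \<epsilon>" by (intro near) (simp add: dist_norm)
  then show ?thesis using heat_bound_nonneg r by (simp add: add_increasing2)
next
  case False
  then have "1 \<le> (norm v / r) ^ 4" using r by (intro one_le_power) simp
  then have "m * 1 \<le> m * (norm v / r) ^ 4" using heat_bound_nonneg by (rule mult_left_mono)
  then show ?thesis using h_bound[of "z + v"] \<epsilon> by linarith
qed

lemma abs_heat_le_local: "\<bar>heat t h z\<bar> \<le> \<epsilon> + m * (3 * (DIM('a))\<^sup>2 * t\<^sup>2 / r ^ 4)"
proof -
  note i = gauss_norm_power4(1)[OF t, where 'a='a]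
  have "\<bar>heat t h z\<bar> \<le> (\<integral>v. \<epsilon> + m * (norm v ^ 4 / r ^ 4) \<partial>(gauss t :: 'a measure))"
    unfolding heat_def using integrable_heat[of z] abs_le_local_power4 i
    by (intro integral_abs_bound_integral) (auto simp: power_divide)
  also have "\<dots> = \<epsilon> + m * ((\<integral>v. norm v ^ 4 \<partial>(gauss t :: 'a measure)) / r ^ 4)"
    using i G.prob_space by simp
  also have "\<dots> \<le> \<epsilon> + m * (3 * (DIM('a))\<^sup>2 * t\<^sup>2 / r ^ 4)"
    using heat_bound_nonneg r gauss_norm_power4(2)[OF t, where 'a='a] by (intro add_left_mono mult_left_mono divide_right_mono) auto
  finally show ?thesis .
qed

text \<open>Outside the ball \<bar>v \<bullet> b\<bar> is at most \<open>norm v ^ 4 / r ^ 3\<close>,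
  so the fourth moment also absorbs the factor \<open>1 / t\<close> of the gradient and leaves order
  \<open>t\<close> for the far part.\<close>

lemma abs_heatd_le_local:
  assumes b: "norm b = 1"
  shows "\<bar>heatd t b h z\<bar> \<le> \<epsilon> / sqrt t + m * (3 * (DIM('a))\<^sup>2 * t / r ^ 3)"
proof -
  note i = gauss_norm_power4(1)[OF t, where 'a='a]
  have pw: "\<bar>h (z + v) * ((v \<bullet> b) / t)\<bar> \<le> \<epsilon> * (\<bar>v \<bullet> b\<bar> / t) + m * (norm v ^ 4 / (r ^ 3 * t))" for v
  proof (cases "norm v < r")
    case True
    then have "\<bar>h (z + v)\<bar> \<le> \<epsilon>" by (intro near) (simp add: dist_norm)
    then have "\<bar>h (z + v) * ((v \<bullet> b) / t)\<bar> \<le> \<epsilon> * (\<bar>v \<bullet> b\<bar> / t)"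
      using t by (auto simp: abs_mult intro!: mult_right_mono divide_right_mono)
    moreover have "0 \<le> m * (norm v ^ 4 / (r ^ 3 * t))" using t r heat_bound_nonneg by simp
    ultimately show ?thesis by linarith
  next
    case False
    have "\<bar>v \<bullet> b\<bar> \<le> norm v" using Cauchy_Schwarz_ineq2[of v b] b by simp
    also have "\<dots> * 1 \<le> norm v * (norm v / r) ^ 3"
      using False r by (intro mult_left_mono one_le_power) auto
    finally have "\<bar>v \<bullet> b\<bar> / t \<le> (norm v ^ 4 / r ^ 3) / t"
      using t by (intro divide_right_mono) (auto simp: power_divide power_numeral_reduce)
    then have "\<bar>h (z + v)\<bar> * (\<bar>v \<bullet> b\<bar> / t) \<le> m * ((norm v ^ 4 / r ^ 3) / t)"
      using t h_bound[of "z + v"] heat_bound_nonneg by (intro mult_mono) auto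
    then have "\<bar>h (z + v) * ((v \<bullet> b) / t)\<bar> \<le> m * (norm v ^ 4 / (r ^ 3 * t))"
      using t by (simp add: abs_mult)
    moreover have "0 \<le> \<epsilon> * (\<bar>v \<bullet> b\<bar> / t)" using \<epsilon> t by simp
    ultimately show ?thesis by linarith
  qed
  have "\<bar>heatd t b h z\<bar> \<le> (\<integral>v. \<epsilon> * (\<bar>v \<bullet> b\<bar> / t) + m * (norm v ^ 4 / (r ^ 3 * t)) \<partial>(gauss t :: 'a measure))"
    unfolding heatd_def using integrable_heatd[of z b] pw i gauss_abs_inner(1)[OF t, of b]
    by (intro integral_abs_bound_integral) auto
  also have "\<dots> = \<epsilon> * ((\<integral>v. \<bar>v \<bullet> b\<bar> \<partial>gauss t) / t) + m * ((\<integral>v. norm v ^ 4 \<partial>(gauss t :: 'a measure)) / (r ^ 3 * t))"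
    using i gauss_abs_inner(1)[OF t, of b] by simp
  also have "\<dots> \<le> \<epsilon> * (sqrt t / t) + m * (3 * (DIM('a))\<^sup>2 * t\<^sup>2 / (r ^ 3 * t))"
    using heat_bound_nonneg r t \<epsilon> b gauss_norm_power4(2)[OF t, where 'a='a] gauss_abs_inner(2)[OF t, of b]
    by (intro add_mono mult_left_mono divide_right_mono) auto
  also have "\<dots> = \<epsilon> / sqrt t + m * (3 * (DIM('a))\<^sup>2 * t / r ^ 3)"
    using t by (simp add: real_div_sqrt power2_eq_square field_simps)
  finally show ?thesis .
qed

end

lemma linear_heatd: "linear (\<lambda>u. heatd t u h z)"
proof
  fix a b :: 'a and c :: real
  show "heatd t (a + b) h z = heatd t a h z + heatd t b h z"
    unfolding heatd_def using integrable_heatd[of z a] integrable_heatd[of z b]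
    by (subst Bochner_Integration.integral_add[symmetric]) (auto simp: inner_add_right add_divide_distrib distrib_left)
  show "heatd t (c *\<^sub>R b) h z = c *\<^sub>R heatd t b h z"
    unfolding heatd_def by (subst integral_scaleR_right[symmetric]) (simp add: mult_ac)
qed

text \<open>By Cameron-Martin the error of the linear approximation is the integral of
  \<open>h (z + v)\<close> against the remainder \<open>Y\<close>, whose mean absolute value is at
  most \<open>(norm u)\<^sup>2 / t\<close> for \<open>u = y - z\<close>.\<close>

lemma heat_has_derivative: "(heat t h has_derivative (\<lambda>u. heatd t u h z)) (at z)"
proof (rule has_derivativeI_sandwich[where e = "sqrt t" and H = "\<lambda>y. m * norm (y - z) / t"])
  \<comment> \<open>Within distance \<open>sqrt t\<close> the parameter
    \<open>s = (norm u)\<^sup>2 / t\<close> is at most 1, where \<open>exp s - 1 - s\<close> is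
    bounded by \<open>s\<^sup>2\<close>.\<close>
  show "0 < sqrt t" using t by simp
  show "bounded_linear (\<lambda>u. heatd t u h z)"
    using linear_heatd by (simp add: linear_conv_bounded_linear)
  have "((\<lambda>y. m * norm (y - z) / t) \<longlongrightarrow> m * norm (z - z) / t) (at z)"
    by (intro tendsto_intros) (use t in auto)
  then show "((\<lambda>y. m * norm (y - z) / t) \<longlongrightarrow> 0) (at z)" by simp
  fix y assume y: "y \<noteq> z" "dist y z < sqrt t"
  define u where "u = y - z"
  define s where "s = (norm u)\<^sup>2 / t"
  define Y where "Y v = exp ((v \<bullet> u) / t - (norm u)\<^sup>2 / (2 * t)) - 1 - (v \<bullet> u) / t" for v
  have [measurable]: "Y \<in> borel_measurable borel" unfolding Y_def by auto
  have "norm u < sqrt t" using y by (simp add: u_def dist_norm)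
  then have "(norm u)\<^sup>2 \<le> t" using t
    by (metis less_eq_real_def norm_ge_zero power_mono real_sqrt_pow2)
  then have s: "0 \<le> s" "s \<le> 1" using t by (auto simp: s_def)
  note rem = cameron_martin_remainder[OF t, of u, folded Y_def s_def]
  have iY: "integrable (gauss t) Y" and YL: "(\<integral>v. \<bar>Y v\<bar> \<partial>gauss t) \<le> sqrt (exp s - 1 - s)"
    using G.abs_expectation_le_L2[OF _ rem] by auto
  have "exp s - 1 - s \<le> s\<^sup>2" using exp_bound[OF s] by simp
  then have "sqrt (exp s - 1 - s) \<le> s" using s by (intro real_le_lsqrt) auto
  with YL have YL: "(\<integral>v. \<bar>Y v\<bar> \<partial>gauss t) \<le> s" by simp
  have hb: "has_bochner_integral (gauss t) (\<lambda>v. exp ((v \<bullet> u) / t - (norm u)\<^sup>2 / (2 * t)) * h (z + v)) (heat t h y)"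
    using integrable_heat[of y] t unfolding heat_def u_def
    by (intro cameron_martin_integral) (auto simp: has_bochner_integral_iff)
  have "has_bochner_integral (gauss t) (\<lambda>v. exp ((v \<bullet> u) / t - (norm u)\<^sup>2 / (2 * t)) * h (z + v) - h (z + v) - h (z + v) * ((v \<bullet> u) / t))
      (heat t h y - heat t h z - heatd t u h z)"
    unfolding heatd_def heat_def[of t h z]
    by (intro has_bochner_integral_diff hb has_bochner_integral_integrable integrable_heat integrable_heatd)
  also have "(\<lambda>v. exp ((v \<bullet> u) / t - (norm u)\<^sup>2 / (2 * t)) * h (z + v) - h (z + v) - h (z + v) * ((v \<bullet> u) / t)) = (\<lambda>v. h (z + v) * Y v)"
    by (auto simp: Y_def algebra_simps)
  finally have R: "has_bochner_integral (gauss t) (\<lambda>v. h (z + v) * Y v) (heat t h y - heat t h z - heatd t u h z)" .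
  have "\<bar>heat t h y - heat t h z - heatd t u h z\<bar> \<le> (\<integral>v. m * \<bar>Y v\<bar> \<partial>gauss t)"
    unfolding has_bochner_integral_integral_eq[OF R, symmetric] using integrable.intros[OF R] iY h_bound
    by (intro integral_abs_bound_integral) (auto simp: abs_mult intro!: mult_right_mono)
  also have "\<dots> \<le> m * s" using YL heat_bound_nonneg by (simp add: mult_left_mono)
  finally have "\<bar>heat t h y - heat t h z - heatd t u h z\<bar> \<le> m * s" .
  then have "\<bar>heat t h y - heat t h z - heatd t u h z\<bar> / norm u \<le> m * s / norm u"
    by (rule divide_right_mono) simp
  also have "\<dots> = m * norm u / t" by (simp add: s_def power2_eq_square)
  finally show "norm (heat t h y - heat t h z - heatd t (y - z) h z) / norm (y - z) \<le> m * norm (y - z) / t"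
    by (simp add: u_def)
qed

text \<open>Fubini: the weight involves only one of two independent Gaussian displacements, and they
  may be made in either order.\<close>

lemma heatd_heat: "heatd t b (heat t h) z = heat t (heatd t b h) z"
proof -
  interpret P: pair_sigma_finite "gauss t :: 'a measure" "gauss t :: 'a measure"
    by (intro pair_sigma_finite.intro) (rule G.sigma_finite_measure_axioms)+
  have "integrable (gauss t \<Otimes>\<^sub>M gauss t) (\<lambda>(v, w). h (z + w + v) * ((v \<bullet> b) / t))"
  proof (rule Bochner_Integration.integrable_bound)
    have "integrable (gauss t \<Otimes>\<^sub>M gauss t) (\<lambda>(v, w::'a). m * ((v \<bullet> b) / t) :: real)"
      using gauss_abs_inner(1)[OF t, of b]
      by (intro P.Fubini_integrable) (auto simp: abs_mult G.emeasure_space_1 simp flip: abs_divide)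
    then show "integrable (gauss t \<Otimes>\<^sub>M gauss t) (\<lambda>x::'a \<times> 'a. m * ((fst x \<bullet> b) / t))"
      by (simp add: case_prod_beta')
    show "AE x in gauss t \<Otimes>\<^sub>M gauss t. norm (case x of (v, w) \<Rightarrow> h (z + w + v) * ((v \<bullet> b) / t)) \<le> norm (m * ((fst x \<bullet> b) / t))"
      using heat_bound_nonneg h_bound by (intro AE_I2) (auto simp: abs_mult intro!: mult_right_mono divide_right_mono)
  qed measurable
  note F = P.Fubini_integral[OF this]
  have sw: "z + v + w = z + w + v" for v w by (simp add: add_ac)
  have "heatd t b (heat t h) z = (\<integral>v. \<integral>w. h (z + w + v) * ((v \<bullet> b) / t) \<partial>gauss t \<partial>gauss t)"
    unfolding heatd_def heat_def
  proof (intro Bochner_Integration.integral_cong refl)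
    fix v
    show "(\<integral>w. h (z + v + w) \<partial>gauss t) * ((v \<bullet> b) / t) = (\<integral>w. h (z + w + v) * ((v \<bullet> b) / t) \<partial>gauss t)"
      by (simp only: integral_mult_left_zero sw[of v])
  qed
  also have "\<dots> = heat t (heatd t b h) z"
    unfolding F[symmetric] heatd_def heat_def ..
  finally show ?thesis .
qed

end

section \<open>The semigroup property\<close>

lemma distr_gauss_add:
  assumes s: "0 < s" and t: "0 < t"
  shows "distr (gauss s \<Otimes>\<^sub>M gauss t) borel (\<lambda>(v, w). v + w) = (gauss (s + t) :: 'a::euclidean_space measure)"
proof (rule measure_eqI)
  fix A :: "'a set" assume "A \<in> sets (distr (gauss s \<Otimes>\<^sub>M gauss t) borel (\<lambda>(v, w). v + w))"
  then have [measurable]: "A \<in> sets borel" by simp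
  let ?K = "\<lambda>t v. ennreal (\<Prod>b\<in>Basis. normal_density 0 (sqrt t) (v \<bullet> b :: real))"
  interpret Gt: prob_space "gauss t :: 'a measure" using t by (rule prob_space_gauss)
  have conv: "(\<integral>\<^sup>+v. ?K s v * ?K t (x - v) \<partial>lborel) = ?K (s + t) x" for x :: 'a
  proof -
    have "(\<integral>\<^sup>+v. ?K s v * ?K t (x - v) \<partial>lborel)
      = (\<integral>\<^sup>+v. (\<Prod>b\<in>Basis. ennreal (normal_density 0 (sqrt t) (x \<bullet> b - v \<bullet> b) * normal_density 0 (sqrt s) (v \<bullet> b))) \<partial>lborel)"
      by (intro nn_integral_cong)
        (simp add: prod_ennreal prod_nonneg ennreal_mult[symmetric] prod.distrib[symmetric] inner_diff_left mult_ac)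
    also have "\<dots> = (\<Prod>b\<in>Basis. \<integral>\<^sup>+y. ennreal (normal_density 0 (sqrt t) (x \<bullet> b - y) * normal_density 0 (sqrt s) y) \<partial>lborel)"
      by (rule nn_integral_lborel_prod) auto
    also have "\<dots> = (\<Prod>b\<in>Basis. ennreal (normal_density 0 (sqrt (s + t)) (x \<bullet> b)))"
      using fun_cong[OF conv_normal_density_zero_mean[of "sqrt t" "sqrt s"]] s t
      by (intro prod.cong refl) (simp add: add.commute)
    finally show ?thesis by (simp add: prod_ennreal)
  qed
  have "emeasure (distr (gauss s \<Otimes>\<^sub>M gauss t) borel (\<lambda>(v, w). v + w)) A
      = (\<integral>\<^sup>+x. indicator A x \<partial>distr (gauss s \<Otimes>\<^sub>M gauss t) borel (\<lambda>(v, w). v + w))"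
    by (subst nn_integral_indicator) auto
  also have "\<dots> = (\<integral>\<^sup>+x. indicator A (fst x + snd x) \<partial>(gauss s \<Otimes>\<^sub>M gauss t))"
    by (subst nn_integral_distr) (auto simp: case_prod_beta')
  also have "\<dots> = (\<integral>\<^sup>+v. \<integral>\<^sup>+w. indicator A (v + w) \<partial>gauss t \<partial>gauss s)"
    by (subst Gt.nn_integral_fst[symmetric]) auto
  also have "\<dots> = (\<integral>\<^sup>+v. ?K s v * (\<integral>\<^sup>+w. ?K t w * indicator A (v + w) \<partial>lborel) \<partial>lborel)"
    unfolding gauss_def by (subst nn_integral_density, simp, simp, subst nn_integral_density) auto
  also have "\<dots> = (\<integral>\<^sup>+v. \<integral>\<^sup>+x. ?K s v * (?K t (x - v) * indicator A x) \<partial>lborel \<partial>lborel)"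
  proof (intro nn_integral_cong)
    fix v :: 'a
    have "(\<integral>\<^sup>+w. ?K t w * indicator A (v + w) \<partial>lborel) = (\<integral>\<^sup>+w. ?K t ((v + w) - v) * indicator A (v + w) \<partial>lborel)" by simp
    also have "\<dots> = (\<integral>\<^sup>+x. ?K t (x - v) * indicator A x \<partial>distr lborel borel ((+) v))"
      by (subst nn_integral_distr) auto
    finally show "?K s v * (\<integral>\<^sup>+w. ?K t w * indicator A (v + w) \<partial>lborel) = (\<integral>\<^sup>+x. ?K s v * (?K t (x - v) * indicator A x) \<partial>lborel)"
      unfolding lborel_distr_plus by (subst nn_integral_cmult) auto
  qed
  also have "\<dots> = (\<integral>\<^sup>+x. \<integral>\<^sup>+v. ?K s v * (?K t (x - v) * indicator A x) \<partial>lborel \<partial>lborel)"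
    by (rule lborel_pair.Fubini'[symmetric]) measurable
  also have "\<dots> = (\<integral>\<^sup>+x. ?K (s + t) x * indicator A x \<partial>lborel)"
    unfolding conv[symmetric] by (subst nn_integral_multc[symmetric]) (auto simp: mult.assoc)
  also have "\<dots> = emeasure (gauss (s + t)) A"
    unfolding gauss_def by (subst emeasure_density) auto
  finally show "emeasure (distr (gauss s \<Otimes>\<^sub>M gauss t) borel (\<lambda>(v, w). v + w)) A = emeasure (gauss (s + t)) A" .
qed simp

lemma heat_heat:
  fixes h :: "'a::euclidean_space \<Rightarrow> real"
  assumes s: "0 < s" and t: "0 < t" and [measurable]: "h \<in> borel_measurable borel" and b: "\<And>y. \<bar>h y\<bar> \<le> m"
  shows "heat s (heat t h) = heat (s + t) h"
proof
  fix z :: 'a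
  interpret Gs: prob_space "gauss s :: 'a measure" using s by (rule prob_space_gauss)
  interpret Gt: prob_space "gauss t :: 'a measure" using t by (rule prob_space_gauss)
  interpret P: pair_prob_space "gauss s :: 'a measure" "gauss t :: 'a measure" ..
  have "heat (s + t) h z = (\<integral>x. h (z + (fst x + snd x)) \<partial>(gauss s \<Otimes>\<^sub>M gauss t))"
    unfolding heat_def distr_gauss_add[OF s t, symmetric] by (subst integral_distr) (auto simp: case_prod_beta')
  also have "\<dots> = heat s (heat t h) z"
    unfolding heat_def by (subst P.integral_fst'[symmetric])
      (auto intro!: P.integrable_const_bound[where B=m] simp: b add.assoc)
  finally show "heat s (heat t h) z = heat (s + t) h z" by simp
qed

lemma continuous_on_heat:
  assumes "0 < t" and "h \<in> borel_measurable borel" and "\<And>y. \<bar>h y\<bar> \<le> m"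
  shows "continuous_on S (heat t h)"
  using heat_has_derivative[OF assms] by (metis continuous_at_imp_continuous_on has_derivative_continuous)

text \<open>Both sides are the derivative of \<open>heat t h\<close>, once directly and once through
  two half steps. The outer \<open>heat\<close> on the right makes the gradient continuous.\<close>

lemma heatd_eq_heat_half:
  fixes h :: "'a::euclidean_space \<Rightarrow> real"
  assumes t: "0 < t" and [measurable]: "h \<in> borel_measurable borel" and b: "\<And>y. \<bar>h y\<bar> \<le> m"
  shows "heatd t c h z = heat (t / 2) (heatd (t / 2) c h) z"
proof -
  have t2: "0 < t / 2" using t by simp
  have "(heat t h has_derivative (\<lambda>u. heatd t u h z)) (at z)"
    by (rule heat_has_derivative[OF t]) (use b in auto)
  moreover have "(heat (t / 2) (heat (t / 2) h) has_derivative (\<lambda>u. heatd (t / 2) u (heat (t / 2) h) z)) (at z)"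
    by (rule heat_has_derivative[OF t2 borel_measurable_heat[OF t2] abs_heat_le[OF t2]]) (use b in auto)
  moreover have "heat (t / 2) (heat (t / 2) h) = heat t h"
    using heat_heat[OF t2 t2, of h m] b by simp
  ultimately have "(\<lambda>u. heatd t u h z) = (\<lambda>u. heatd (t / 2) u (heat (t / 2) h) z)"
    by (metis has_derivative_unique)
  then have "heatd t c h z = heatd (t / 2) c (heat (t / 2) h) z" by metis
  also have "\<dots> = heat (t / 2) (heatd (t / 2) c h) z"
    by (rule heatd_heat[OF t2]) (use b in auto)
  finally show ?thesis .
qed

lemma continuous_on_heatd:
  fixes h :: "'a::euclidean_space \<Rightarrow> real"
  assumes t: "0 < t" and m: "h \<in> borel_measurable borel" and b: "\<And>y. \<bar>h y\<bar> \<le> m"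
  shows "continuous_on S (heatd t c h)"
proof -
  have t2: "0 < t / 2" using t by simp
  have "heatd t c h = heat (t / 2) (heatd (t / 2) c h)"
    using heatd_eq_heat_half[OF t m b] by auto
  then show ?thesis
    using continuous_on_heat[OF t2 borel_measurable_heatd[OF t2 m b] abs_heatd_le[OF t2 m b]] by simp
qed

section \<open>Second order Taylor expansion\<close>

text \<open>Maclaurin's formula along the segment from \<open>z\<close> to \<open>z + v\<close>.
  Gradient \<open>G\<close> and Hessian \<open>H\<close> are explicit functions here, so that limits
  of derivatives can be put in their place.\<close>

lemma taylor2:
  fixes u :: "'a::euclidean_space \<Rightarrow> real"
  assumes u: "\<And>y. y \<in> ball z r \<Longrightarrow> (u has_derivative (\<lambda>h. \<Sum>b\<in>Basis. (h \<bullet> b) * G b y)) (at y)"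
    and G: "\<And>b y. b \<in> Basis \<Longrightarrow> y \<in> ball z r \<Longrightarrow> (G b has_derivative (\<lambda>h. \<Sum>c\<in>Basis. (h \<bullet> c) * H b c y)) (at y)"
    and v: "norm v < r"
  shows "\<exists>s. 0 < s \<and> s < 1 \<and> u (z + v) = u z + (\<Sum>b\<in>Basis. (v \<bullet> b) * G b z)
    + (\<Sum>b\<in>Basis. \<Sum>c\<in>Basis. (v \<bullet> b) * (v \<bullet> c) * H b c (z + s *\<^sub>R v)) / 2"
proof -
  define d where "d n s = (if n = 0 then u (z + s *\<^sub>R v) else if n = 1 then (\<Sum>b\<in>Basis. (v \<bullet> b) * G b (z + s *\<^sub>R v))
    else (\<Sum>b\<in>Basis. \<Sum>c\<in>Basis. (v \<bullet> b) * (v \<bullet> c) * H b c (z + s *\<^sub>R v)))" for n :: nat and s :: real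
  have inb: "z + s *\<^sub>R v \<in> ball z r" if "0 \<le> s" "s \<le> 1" for s
  proof -
    have "norm (s *\<^sub>R v) \<le> norm v" using that by (simp add: mult_left_le_one_le)
    then show ?thesis using v by (simp add: dist_norm)
  qed
  have line: "((\<lambda>s. z + s *\<^sub>R v) has_derivative (\<lambda>h. h *\<^sub>R v)) (at s)" for s :: real
    by (auto intro!: derivative_eq_intros)
  have "(d 0 has_real_derivative d 1 s) (at s)" if "0 \<le> s" "s \<le> 1" for s
  proof -
    have "((\<lambda>s. u (z + s *\<^sub>R v)) has_derivative (\<lambda>h. \<Sum>b\<in>Basis. ((h *\<^sub>R v) \<bullet> b) * G b (z + s *\<^sub>R v))) (at s)"
      using has_derivative_compose[OF line u[OF inb[OF that]]] .
    then show ?thesis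
      unfolding d_def has_field_derivative_def
      by (auto elim!: has_derivative_eq_rhs simp: sum_distrib_left fun_eq_iff mult_ac)
  qed
  moreover have "(d 1 has_real_derivative d 2 s) (at s)" if "0 \<le> s" "s \<le> 1" for s
  proof -
    have "((\<lambda>s. \<Sum>b\<in>Basis. (v \<bullet> b) * G b (z + s *\<^sub>R v)) has_derivative
        (\<lambda>h. \<Sum>b\<in>Basis. (v \<bullet> b) * (\<Sum>c\<in>Basis. ((h *\<^sub>R v) \<bullet> c) * H b c (z + s *\<^sub>R v)))) (at s)"
      by (intro has_derivative_sum has_derivative_mult_right has_derivative_compose[OF line G[OF _ inb[OF that]]])
    then show ?thesis
      unfolding d_def has_field_derivative_def
      by (auto elim!: has_derivative_eq_rhs simp: sum_distrib_left fun_eq_iff mult_ac)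
  qed
  ultimately have "\<forall>m t. m < 2 \<and> 0 \<le> t \<and> t \<le> 1 \<longrightarrow> DERIV (d m) t :> d (Suc m) t"
    by (auto simp: numeral_2_eq_2 less_Suc_eq)
  from Maclaurin[of 1 2 d "d 0", OF _ _ refl this] obtain s where "0 < s" "s < 1"
    "d 0 1 = (\<Sum>m<2. d m 0 / fact m * 1 ^ m) + d 2 s / fact 2 * 1\<^sup>2" by auto
  then show ?thesis
    by (intro exI[of _ s]) (auto simp: d_def numeral_2_eq_2)
qed

text \<open>At a maximum the gradient vanishes. If \<open>H e e\<close> were positive at
  \<open>z\<close>, it would be positive nearby by continuity, and Taylor's formula along
  \<open>e\<close> would produce a larger value.\<close>

lemma second_derivative_test:
  fixes u :: "'a::euclidean_space \<Rightarrow> real"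
  assumes r: "0 < r" and u: "\<And>y. y \<in> ball z r \<Longrightarrow> (u has_derivative (\<lambda>h. \<Sum>b\<in>Basis. (h \<bullet> b) * G b y)) (at y)"
    and G: "\<And>b y. b \<in> Basis \<Longrightarrow> y \<in> ball z r \<Longrightarrow> (G b has_derivative (\<lambda>h. \<Sum>c\<in>Basis. (h \<bullet> c) * H b c y)) (at y)"
    and H: "\<And>b c. b \<in> Basis \<Longrightarrow> c \<in> Basis \<Longrightarrow> continuous_on (ball z r) (H b c)"
    and max: "\<And>y. y \<in> ball z r \<Longrightarrow> u y \<le> u z" and e: "e \<in> Basis"
  shows "H e e z \<le> 0"
proof (rule ccontr)
  assume "\<not> ?thesis"
  then have pos: "0 < H e e z" by simp
  have "(\<lambda>h. \<Sum>b\<in>Basis. (h \<bullet> b) * G b z) = (\<lambda>_. 0)"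
  proof (rule has_derivative_local_max)
    show "(u has_derivative (\<lambda>h. \<Sum>b\<in>Basis. (h \<bullet> b) * G b z)) (at z)"
      using r by (intro u) simp
    show "\<forall>\<^sub>F y in at z. u y \<le> u z"
      unfolding eventually_at using r max by (intro exI[of _ r]) (auto simp: dist_commute)
  qed
  then have "(\<Sum>b\<in>Basis. (e \<bullet> b) * G b z) = 0" by metis
  then have G0: "G e z = 0" using e by (simp add: inner_Basis if_distrib[of "\<lambda>x. x * _"] sum.delta cong: if_cong)
  have "isCont (H e e) z"
    using H[OF e e] r by (auto simp: continuous_on_eq_continuous_at)
  then have "\<forall>\<^sub>F y in at z. 0 < H e e y"
    using pos by (intro order_tendstoD) (auto simp: isCont_def)
  then obtain d where d: "0 < d" "\<And>y. y \<noteq> z \<Longrightarrow> dist y z < d \<Longrightarrow> 0 < H e e y"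
    by (auto simp: eventually_at)
  define a where "a = min d r / 2"
  have a: "0 < a" "a < d" "a < r" using d r by (auto simp: a_def min_def)
  have ne: "norm (a *\<^sub>R e) = a" using a e by simp
  then obtain s where s: "0 < s" "s < 1" and eq: "u (z + a *\<^sub>R e) = u z + (\<Sum>b\<in>Basis. ((a *\<^sub>R e) \<bullet> b) * G b z)
    + (\<Sum>b\<in>Basis. \<Sum>c\<in>Basis. ((a *\<^sub>R e) \<bullet> b) * ((a *\<^sub>R e) \<bullet> c) * H b c (z + s *\<^sub>R (a *\<^sub>R e))) / 2"
    using taylor2[of z r u G H "a *\<^sub>R e", OF u G] a by auto
  have "(\<Sum>b\<in>Basis. \<Sum>c\<in>Basis. ((a *\<^sub>R e) \<bullet> b) * ((a *\<^sub>R e) \<bullet> c) * H b c (z + s *\<^sub>R (a *\<^sub>R e)))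
     = a * a * H e e (z + s *\<^sub>R (a *\<^sub>R e))"
    using e by (simp add: inner_Basis if_distrib[of "\<lambda>x. x * _"] if_distrib[of "\<lambda>x. _ * x"] sum.delta cong: if_cong)
  moreover have "(\<Sum>b\<in>Basis. ((a *\<^sub>R e) \<bullet> b) * G b z) = 0"
    using e G0 by (simp add: inner_Basis if_distrib[of "\<lambda>x. x * _"] if_distrib[of "\<lambda>x. _ * x"] sum.delta cong: if_cong)
  moreover have "0 < H e e (z + s *\<^sub>R (a *\<^sub>R e))"
  proof (rule d)
    have "s * a \<noteq> 0" using s a by simp
    then show "z + s *\<^sub>R (a *\<^sub>R e) \<noteq> z" using e by auto
    have "s * a < 1 * d" using s a by (intro mult_strict_mono) auto
    then show "dist (z + s *\<^sub>R (a *\<^sub>R e)) z < d" using s a e by (simp add: dist_norm)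
  qed
  ultimately have "u z < u (z + a *\<^sub>R e)" using eq a by simp
  moreover have "u (z + a *\<^sub>R e) \<le> u z" using ne a e by (intro max) (simp add: dist_norm)
  ultimately show False by simp
qed

section \<open>Approximate eigenfunctions of the heat semigroup\<close>

text \<open>Telescoping against a geometric series. The limit is named by \<open>lim\<close>, so
  that for sequences depending on a point the limit function needs no choice.\<close>

lemma geometric_Cauchy:
  fixes a :: "nat \<Rightarrow> real"
  assumes q: "0 \<le> q" "q < 1" and a: "\<And>j. \<bar>a (Suc j) - a j\<bar> \<le> A * q ^ j"
  shows "a \<longlonglongrightarrow> lim a" and "\<bar>a j - lim a\<bar> \<le> A * q ^ j / (1 - q)"
proof -
  have *: "\<bar>a (j + k) - a j\<bar> \<le> A * q ^ j * (\<Sum>i<k. q ^ i)" for j k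
  proof (induction k)
    case (Suc k)
    have "\<bar>a (j + Suc k) - a j\<bar> \<le> \<bar>a (Suc (j + k)) - a (j + k)\<bar> + \<bar>a (j + k) - a j\<bar>" by simp
    also have "\<dots> \<le> A * q ^ (j + k) + A * q ^ j * (\<Sum>i<k. q ^ i)"
      using a[of "j + k"] Suc by simp
    finally show ?case by (simp add: power_add algebra_simps)
  qed simp
  have A: "0 \<le> A * q ^ j" for j using a[of j] by linarith
  have le: "\<bar>a (j + k) - a j\<bar> \<le> A * q ^ j / (1 - q)" for j k
  proof -
    have "(\<Sum>i<k. q ^ i) \<le> 1 / (1 - q)"
      using sum_le_suminf[of "\<lambda>i. q ^ i" "{..<k}"] q by (simp add: suminf_geometric summable_geometric)
    from mult_left_mono[OF this A[of j]] * [of j k] show ?thesis by simp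
  qed
  have "(\<lambda>j. A * q ^ j / (1 - q)) \<longlonglongrightarrow> A * 0 / (1 - q)"
    using q by (intro tendsto_intros LIMSEQ_realpow_zero) auto
  then have lim0: "(\<lambda>j. A * q ^ j / (1 - q)) \<longlonglongrightarrow> 0" by simp
  have "Cauchy a"
  proof (rule CauchyI')
    fix e :: real assume "0 < e"
    from order_tendstoD(2)[OF lim0 this] obtain N where N: "A * q ^ j / (1 - q) < e" if "j \<ge> N" for j
      by (auto simp: eventually_sequentially)
    show "\<exists>M. \<forall>m\<ge>M. \<forall>n>m. dist (a m) (a n) < e"
    proof (intro exI allI impI)
      fix m n assume "N \<le> m" "m < n"
      then show "dist (a m) (a n) < e"
        using le[of m "n - m"] N[of m] by (simp add: dist_real_def abs_minus_commute)
    qed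
  qed
  then show l: "a \<longlonglongrightarrow> lim a"
    by (simp add: Cauchy_convergent_iff convergent_LIMSEQ_iff)
  have "(\<lambda>k. \<bar>a (k + j) - a j\<bar>) \<longlonglongrightarrow> \<bar>lim a - a j\<bar>"
    by (intro tendsto_intros LIMSEQ_ignore_initial_segment l)
  then have "\<bar>lim a - a j\<bar> \<le> A * q ^ j / (1 - q)"
    by (rule LIMSEQ_le_const2) (use le[of j] in \<open>auto simp: add.commute\<close>)
  then show "\<bar>a j - lim a\<bar> \<le> A * q ^ j / (1 - q)" by (simp add: abs_minus_commute)
qed

text \<open>The steps of the gradients decay geometrically, uniformly on the ball, so the gradients
  converge uniformly and the limit may be differentiated term by term. For the functions themselves
  pointwise convergence suffices.\<close>

lemma has_derivative_geometric_limit: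
  fixes V :: "nat \<Rightarrow> 'a::euclidean_space \<Rightarrow> real"
  assumes q: "0 \<le> q" "q < 1"
    and V: "\<And>n y. y \<in> ball z r \<Longrightarrow> (V n has_derivative (\<lambda>h. \<Sum>b\<in>Basis. (h \<bullet> b) * DV b n y)) (at y)"
    and D: "\<And>b n y. b \<in> Basis \<Longrightarrow> y \<in> ball z r \<Longrightarrow> \<bar>DV b (Suc n) y - DV b n y\<bar> \<le> A * q ^ n"
    and L: "\<And>y. y \<in> ball z r \<Longrightarrow> (\<lambda>n. V n y) \<longlonglongrightarrow> U y"
    and y: "y \<in> ball z r"
  shows "(U has_derivative (\<lambda>h. \<Sum>b\<in>Basis. (h \<bullet> b) * lim (\<lambda>n. DV b n y))) (at y)"
proof -
  have "\<exists>g. \<forall>x\<in>ball z r. (\<lambda>n. V n x) \<longlonglongrightarrow> g x \<and>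
      (g has_derivative (\<lambda>h. \<Sum>b\<in>Basis. (h \<bullet> b) * lim (\<lambda>n. DV b n x))) (at x within ball z r)"
  proof (rule has_derivative_sequence)
    show "(V n has_derivative (\<lambda>h. \<Sum>b\<in>Basis. (h \<bullet> b) * DV b n x)) (at x within ball z r)" if "x \<in> ball z r" for n x
      using V[OF that] by (rule has_derivative_at_withinI)
    show "(\<lambda>n. V n y) \<longlonglongrightarrow> U y" by (rule L[OF y])
    fix e :: real assume e: "0 < e"
    have "(\<lambda>n. DIM('a) * (A * q ^ n / (1 - q))) \<longlonglongrightarrow> DIM('a) * (A * 0 / (1 - q))"
      using q by (intro tendsto_intros LIMSEQ_realpow_zero) auto
    then have "\<forall>\<^sub>F n in sequentially. DIM('a) * (A * q ^ n / (1 - q)) < e"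
      using e by (intro order_tendstoD(2)) auto
    then show "\<forall>\<^sub>F n in sequentially. \<forall>x\<in>ball z r. \<forall>h. norm ((\<Sum>b\<in>Basis. (h \<bullet> b) * DV b n x) - (\<Sum>b\<in>Basis. (h \<bullet> b) * lim (\<lambda>n. DV b n x))) \<le> e * norm h"
    proof (eventually_elim, intro ballI allI)
      fix n x h assume n: "DIM('a) * (A * q ^ n / (1 - q)) < e" and x: "x \<in> ball z r"
      have "norm ((\<Sum>b\<in>Basis. (h \<bullet> b) * DV b n x) - (\<Sum>b\<in>Basis. (h \<bullet> b) * lim (\<lambda>n. DV b n x)))
        = \<bar>\<Sum>b\<in>Basis. (h \<bullet> b) * (DV b n x - lim (\<lambda>n. DV b n x))\<bar>"
        by (simp add: sum_subtractf[symmetric] right_diff_distrib)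
      also have "\<dots> \<le> (\<Sum>b\<in>(Basis::'a set). norm h * (A * q ^ n / (1 - q)))"
      proof (rule order.trans[OF sum_abs], rule sum_mono)
        fix b :: 'a assume b: "b \<in> Basis"
        show "\<bar>(h \<bullet> b) * (DV b n x - lim (\<lambda>n. DV b n x))\<bar> \<le> norm h * (A * q ^ n / (1 - q))"
          unfolding abs_mult using Basis_le_norm[OF b, of h] geometric_Cauchy(2)[OF q D[OF b x]]
          by (intro mult_mono) auto
      qed
      also have "\<dots> = norm h * (DIM('a) * (A * q ^ n / (1 - q)))" by simp
      also have "\<dots> \<le> norm h * e" using n by (intro mult_left_mono) auto
      finally show "norm ((\<Sum>b\<in>Basis. (h \<bullet> b) * DV b n x) - (\<Sum>b\<in>Basis. (h \<bullet> b) * lim (\<lambda>n. DV b n x))) \<le> e * norm h"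
        by (simp add: mult.commute)
    qed
  qed (use y in auto)
  then obtain g where g': "\<forall>x\<in>ball z r. (\<lambda>n. V n x) \<longlonglongrightarrow> g x \<and>
      (g has_derivative (\<lambda>h. \<Sum>b\<in>Basis. (h \<bullet> b) * lim (\<lambda>n. DV b n x))) (at x within ball z r)" ..
  note g = g'[THEN bspec, THEN conjunct1] g'[THEN bspec, THEN conjunct2]
  have "(g has_derivative (\<lambda>h. \<Sum>b\<in>Basis. (h \<bullet> b) * lim (\<lambda>n. DV b n y))) (at y)"
    using g(2)[OF y] unfolding at_within_open[OF y open_ball] .
  then show ?thesis
  proof (rule has_derivative_transform_within_open)
    show "open (ball z r)" "y \<in> ball z r" using y by simp_all
    show "g x = U x" if "x \<in> ball z r" for x
      by (rule LIMSEQ_unique[OF g(1)[OF that] L[OF that]])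
  qed
qed

lemma heat_diff:
  assumes t: "0 < t" and "f \<in> borel_measurable borel" "\<And>y. \<bar>f y\<bar> \<le> m" "g \<in> borel_measurable borel" "\<And>y. \<bar>g y\<bar> \<le> m'"
  shows "heat t (\<lambda>y. \<alpha> * f y - \<beta> * g y) z = \<alpha> * heat t f z - \<beta> * heat t g z"
  using integrable_heat[OF assms(1-3), of z] integrable_heat[OF t assms(4-5), of z]
  unfolding heat_def by simp

lemma linear_eq_sum_Basis:
  fixes f :: "'a::euclidean_space \<Rightarrow> real"
  assumes "linear f"
  shows "f = (\<lambda>h. \<Sum>b\<in>Basis. (h \<bullet> b) * f b)"
proof
  fix h
  have "f h = f (\<Sum>b\<in>Basis. (h \<bullet> b) *\<^sub>R b)" by (simp add: euclidean_representation)
  also have "\<dots> = (\<Sum>b\<in>Basis. (h \<bullet> b) * f b)"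
    by (simp add: linear_sum[OF assms] linear_cmul[OF assms])
  finally show "f h = (\<Sum>b\<in>Basis. (h \<bullet> b) * f b)" .
qed

text \<open>The defect estimate is required only near \<open>z\<close>, since for a mean exit value
  it is available only away from the boundary; elsewhere \<open>U\<close> is just bounded and
  measurable. Everything below therefore has to separate a near part from Gaussian tails.\<close>

locale approx_eigenfunction =
  fixes U :: "'a::euclidean_space \<Rightarrow> real" and m \<kappa> C r :: real and z :: 'a
  assumes meas [measurable]: "U \<in> borel_measurable borel" and bound: "\<And>y. \<bar>U y\<bar> \<le> m"
    and \<kappa>: "0 \<le> \<kappa>" and r: "0 < r" and C: "0 \<le> C"
    and near: "\<And>y j. y \<in> ball z r \<Longrightarrow> \<bar>U y - exp (- \<kappa> * (1 / 2) ^ j) * heat ((1 / 2) ^ j) U y\<bar> \<le> C * ((1 / 2) ^ j)\<^sup>2"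
begin

definition V :: "nat \<Rightarrow> 'a \<Rightarrow> real" where
  "V j = (\<lambda>y. exp (- 2 * \<kappa> * (1 / 2) ^ j) * heat ((1 / 2) ^ j) (heat ((1 / 2) ^ j) U) y)"

definition DV :: "'a \<Rightarrow> nat \<Rightarrow> 'a \<Rightarrow> real" where
  "DV b j = (\<lambda>y. exp (- 2 * \<kappa> * (1 / 2) ^ j) * heat ((1 / 2) ^ j) (heatd ((1 / 2) ^ j) b U) y)"

definition DDV :: "'a \<Rightarrow> 'a \<Rightarrow> nat \<Rightarrow> 'a \<Rightarrow> real" where
  "DDV b c j = (\<lambda>y. exp (- 2 * \<kappa> * (1 / 2) ^ j) * heatd ((1 / 2) ^ j) c (heatd ((1 / 2) ^ j) b U) y)"

lemma heat_heat_has_derivative: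
  assumes t: "0 < t" and h: "h \<in> borel_measurable borel" "\<And>y. \<bar>h y\<bar> \<le> k"
  shows "(heat t (heat t h) has_derivative (\<lambda>u. \<Sum>b\<in>Basis. (u \<bullet> b) * heat t (heatd t b h) (y::'a))) (at y)"
    and "(heat t (heatd t b h) has_derivative (\<lambda>u. \<Sum>c\<in>Basis. (u \<bullet> c) * heatd t c (heatd t b h) y)) (at y)"
proof -
  note h' = borel_measurable_heat[OF t h] abs_heat_le[OF t h]
  show "(heat t (heat t h) has_derivative (\<lambda>u. \<Sum>b\<in>Basis. (u \<bullet> b) * heat t (heatd t b h) y)) (at y)"
    using heat_has_derivative[OF t h', of y] linear_eq_sum_Basis[OF linear_heatd[OF t h', of y]]
    by (simp add: heatd_heat[OF t h])
  note h'' = borel_measurable_heatd[OF t h, of b] abs_heatd_le[OF t h, of b]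
  show "(heat t (heatd t b h) has_derivative (\<lambda>u. \<Sum>c\<in>Basis. (u \<bullet> c) * heatd t c (heatd t b h) y)) (at y)"
    using heat_has_derivative[OF t h'', of y] linear_eq_sum_Basis[OF linear_heatd[OF t h'', of y]]
    by simp
qed

lemma V_has_derivative: "(V j has_derivative (\<lambda>h. \<Sum>b\<in>Basis. (h \<bullet> b) * DV b j y)) (at y)"
proof -
  have "(V j has_derivative (\<lambda>h. exp (- 2 * \<kappa> * (1 / 2) ^ j) * (\<Sum>b\<in>Basis. (h \<bullet> b) * heat ((1 / 2) ^ j) (heatd ((1 / 2) ^ j) b U) y))) (at y)"
    unfolding V_def by (intro has_derivative_mult_right heat_heat_has_derivative[OF _ meas bound]) simp
  then show ?thesis by (simp add: DV_def sum_distrib_left mult_ac)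
qed

lemma DV_has_derivative: "(DV b j has_derivative (\<lambda>h. \<Sum>c\<in>Basis. (h \<bullet> c) * DDV b c j y)) (at y)"
proof -
  have "(DV b j has_derivative (\<lambda>h. exp (- 2 * \<kappa> * (1 / 2) ^ j) * (\<Sum>c\<in>Basis. (h \<bullet> c) * heatd ((1 / 2) ^ j) c (heatd ((1 / 2) ^ j) b U) y))) (at y)"
    unfolding DV_def by (intro has_derivative_mult_right heat_heat_has_derivative[OF _ meas bound]) simp
  then show ?thesis by (simp add: DDV_def sum_distrib_left mult_ac)
qed

lemma has_derivative_Basis_unique:
  fixes f :: "'a \<Rightarrow> real"
  assumes "(f has_derivative (\<lambda>h. \<Sum>b\<in>Basis. (h \<bullet> b) * F b)) (at y)"
    and "(f has_derivative (\<lambda>h. \<Sum>b\<in>Basis. (h \<bullet> b) * G b)) (at y)" and b: "b \<in> Basis"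
  shows "F b = G b"
proof -
  have "(\<Sum>c\<in>Basis. (b \<bullet> c) * F c) = (\<Sum>c\<in>Basis. (b \<bullet> c) * G c)"
    using has_derivative_unique[OF assms(1,2)] by metis
  then show ?thesis
    using b by (simp add: inner_Basis if_distrib[of "\<lambda>x. x * _"] sum.delta cong: if_cong)
qed

text \<open>The discounts are those for which \<open>V_diff\<close> holds; \<open>err_eq\<close>
  recognises the result as the defect bounded in \<open>near\<close>, up to sign and a discount
  factor.\<close>

definition err :: "nat \<Rightarrow> 'a \<Rightarrow> real" where
  "err j y = exp (- 4 * \<kappa> * (1 / 2) ^ Suc j) * heat ((1 / 2) ^ j) U y - exp (- 2 * \<kappa> * (1 / 2) ^ Suc j) * U y"

lemma err_measurable [measurable]: "err j \<in> borel_measurable borel"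
proof -
  have [measurable]: "heat ((1 / 2) ^ j) U \<in> borel_measurable borel"
    by (rule borel_measurable_heat[OF _ meas bound]) simp
  show ?thesis unfolding err_def[abs_def] by measurable
qed

lemma err_eq: "err j y = exp (- \<kappa> * (1 / 2) ^ j) * (exp (- \<kappa> * (1 / 2) ^ j) * heat ((1 / 2) ^ j) U y - U y)"
  by (simp add: err_def right_diff_distrib mult.assoc[symmetric] exp_add[symmetric])

lemma err_le:
  shows "\<bar>err j y\<bar> \<le> 2 * m" and "y \<in> ball z r \<Longrightarrow> \<bar>err j y\<bar> \<le> C * ((1 / 2) ^ j)\<^sup>2"
proof -
  let ?e = "exp (- \<kappa> * (1 / 2) ^ j)"
  have e: "0 \<le> ?e" "?e \<le> 1" using \<kappa> by auto
  have h: "\<bar>heat ((1 / 2) ^ j) U y\<bar> \<le> m" by (rule abs_heat_le[OF _ meas bound]) simp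
  have 1: "\<bar>err j y\<bar> \<le> \<bar>?e * heat ((1 / 2) ^ j) U y - U y\<bar>"
    unfolding err_eq abs_mult using e by (intro mult_left_le_one_le) auto
  have "\<bar>?e * heat ((1 / 2) ^ j) U y\<bar> \<le> \<bar>heat ((1 / 2) ^ j) U y\<bar>"
    unfolding abs_mult using e by (intro mult_left_le_one_le) auto
  then show "\<bar>err j y\<bar> \<le> 2 * m" using 1 h bound[of y] by linarith
  show "\<bar>err j y\<bar> \<le> C * ((1 / 2) ^ j)\<^sup>2" if "y \<in> ball z r"
    using 1 near[OF that, of j] by (simp add: abs_minus_commute)
qed

text \<open>Both levels are brought to the form \<open>heat s\<close> after \<open>heat s\<close>:
  in \<open>V j\<close> one of the two steps of length \<open>2 * s\<close> is split in halves. The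
  other step stays on \<open>U\<close>, and the difference falls on the integrand.\<close>

lemma V_diff:
  defines "s j \<equiv> (1 / 2) ^ Suc j"
  shows "V j = (\<lambda>y. heat (s j) (heat (s j) (err j)) y + V (Suc j) y)"
proof
  fix y
  have s: "0 < s j" "s j + s j = (1 / 2) ^ j" "0 < (1/2::real) ^ j" by (auto simp: s_def)
  note HU = borel_measurable_heat[OF s(3) meas bound] abs_heat_le[OF s(3) meas bound]
  note U = meas bound
  have hh: "heat ((1 / 2) ^ j) f = heat (s j) (heat (s j) f)" if "f \<in> borel_measurable borel" "\<And>y. \<bar>f y\<bar> \<le> k" for f :: "'a \<Rightarrow> real" and k
    using heat_heat[OF s(1) s(1) that] unfolding s(2) by simp
  have 1: "heat (s j) (err j) = (\<lambda>x. exp (- 4 * \<kappa> * s j) * heat (s j) (heat ((1 / 2) ^ j) U) x - exp (- 2 * \<kappa> * s j) * heat (s j) U x)"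
    unfolding err_def[abs_def] s_def[symmetric] using heat_diff[OF s(1) HU U] by (intro ext)
  have "heat (s j) (heat (s j) (err j)) y = exp (- 4 * \<kappa> * s j) * heat (s j) (heat (s j) (heat ((1 / 2) ^ j) U)) y - exp (- 2 * \<kappa> * s j) * heat (s j) (heat (s j) U) y"
    unfolding 1 by (rule heat_diff[OF s(1) borel_measurable_heat[OF s(1) HU] abs_heat_le[OF s(1) HU] borel_measurable_heat[OF s(1) U] abs_heat_le[OF s(1) U]])
  also have "heat (s j) (heat (s j) (heat ((1 / 2) ^ j) U)) = heat ((1 / 2) ^ j) (heat ((1 / 2) ^ j) U)"
    by (rule hh[OF HU, symmetric])
  also have "exp (- 4 * \<kappa> * s j) * heat ((1 / 2) ^ j) (heat ((1 / 2) ^ j) U) y = V j y"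
    by (simp add: V_def s_def)
  also have "exp (- 2 * \<kappa> * s j) * heat (s j) (heat (s j) U) y = V (Suc j) y"
    by (simp add: V_def s_def)
  finally show "V j y = heat (s j) (heat (s j) (err j)) y + V (Suc j) y" by simp
qed

text \<open>Differentiating \<open>V_diff\<close> and comparing coefficients avoids a new kernel
  computation; \<open>DDV_diff\<close> repeats this one order higher.\<close>

lemma DV_diff:
  assumes b: "b \<in> Basis"
  defines "s j \<equiv> (1 / 2) ^ Suc j"
  shows "DV b j = (\<lambda>y. heat (s j) (heatd (s j) b (err j)) y + DV b (Suc j) y)"
proof
  fix y
  have s: "0 < s j" by (simp add: s_def)
  have "((\<lambda>y. heat (s j) (heat (s j) (err j)) y + V (Suc j) y) has_derivative
     (\<lambda>h. (\<Sum>b\<in>Basis. (h \<bullet> b) * heat (s j) (heatd (s j) b (err j)) y) + (\<Sum>b\<in>Basis. (h \<bullet> b) * DV b (Suc j) y))) (at y)"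
    by (intro has_derivative_add heat_heat_has_derivative(1)[OF s err_measurable err_le(1)] V_has_derivative)
  then have "(V j has_derivative
     (\<lambda>h. \<Sum>b\<in>Basis. (h \<bullet> b) * (heat (s j) (heatd (s j) b (err j)) y + DV b (Suc j) y))) (at y)"
    unfolding V_diff[of j, folded s_def] by (simp add: sum.distrib distrib_left)
  from has_derivative_Basis_unique[OF V_has_derivative this b]
  show "DV b j y = heat (s j) (heatd (s j) b (err j)) y + DV b (Suc j) y" .
qed

lemma DDV_diff:
  assumes b: "b \<in> Basis" and c: "c \<in> Basis"
  defines "s j \<equiv> (1 / 2) ^ Suc j"
  shows "DDV b c j = (\<lambda>y. heatd (s j) c (heatd (s j) b (err j)) y + DDV b c (Suc j) y)"
proof
  fix y
  have s: "0 < s j" by (simp add: s_def)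
  have "((\<lambda>y. heat (s j) (heatd (s j) b (err j)) y + DV b (Suc j) y) has_derivative
     (\<lambda>h. (\<Sum>c\<in>Basis. (h \<bullet> c) * heatd (s j) c (heatd (s j) b (err j)) y) + (\<Sum>c\<in>Basis. (h \<bullet> c) * DDV b c (Suc j) y))) (at y)"
    by (intro has_derivative_add heat_heat_has_derivative(2)[OF s err_measurable err_le(1)] DV_has_derivative)
  then have "(DV b j has_derivative
     (\<lambda>h. \<Sum>c\<in>Basis. (h \<bullet> c) * (heatd (s j) c (heatd (s j) b (err j)) y + DDV b c (Suc j) y))) (at y)"
    unfolding DV_diff[OF b, of j, folded s_def] by (simp add: sum.distrib distrib_left)
  from has_derivative_Basis_unique[OF DV_has_derivative this c]
  show "DDV b c j y = heatd (s j) c (heatd (s j) b (err j)) y + DDV b c (Suc j) y" .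
qed

end

section \<open>Convergence of the first two derivatives\<close>

context approx_eigenfunction
begin

text \<open>A common constant for both orders in \<open>err_derivative_le\<close>: it dominates the
  sums of the coefficients of \<open>sqrt s\<close> that appear there.\<close>

definition A :: real where
  "A = 4 * C + 4 * m * (3 * (DIM('a))\<^sup>2) / (r / 4) ^ 3 + 2 * m * (3 * (DIM('a))\<^sup>2) / (r / 4) ^ 4"

text \<open>With two derivatives the Gaussian tails contribute order \<open>sqrt s\<close>, hence
  the rate \<open>sqrt (1 / 2)\<close> per halving of the time.\<close>

definition q :: real where "q = sqrt (1 / 2)"

lemma q: "0 \<le> q" "q < 1"
  by (auto simp: q_def)

lemma bound_nonneg: "0 \<le> m"
  using bound[of z] by linarith

text \<open>The local estimates are applied twice. The inner derivative is at most \<open>e1\<close>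
  near \<open>y\<close>, because \<open>err j\<close> is of order \<open>s\<^sup>2\<close> there;
  this is the near bound for the outer operator, and \<open>abs_heatd_le\<close> its global bound.
  Each derivative costs \<open>1 / sqrt s\<close>, and a positive power of \<open>s\<close>
  remains.\<close>

lemma err_derivative_le:
  assumes b: "b \<in> Basis" and c: "c \<in> Basis" and y: "y \<in> ball z (r / 2)"
  shows "\<bar>heat ((1 / 2) ^ Suc j) (heatd ((1 / 2) ^ Suc j) b (err j)) y\<bar> \<le> A * q ^ j"
    and "\<bar>heatd ((1 / 2) ^ Suc j) c (heatd ((1 / 2) ^ Suc j) b (err j)) y\<bar> \<le> A * q ^ j"
proof -
  define s where "s = (1 / 2 :: real) ^ Suc j"
  define w where "w = sqrt s"
  define K where "K = 3 * (real DIM('a))\<^sup>2"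
  \<comment> \<open>From \<open>z\<close> to \<open>y\<close>, on to the inner base point and on to
    the argument of \<open>err\<close>: the radii add up to
    \<open>r / 2 + r / 4 + r / 4 = r\<close>.\<close>
  define \<rho> where "\<rho> = r / 4"
  have s: "0 < s" "s \<le> 1" by (auto simp: s_def simp del: power_Suc intro!: power_le_one)
  have w: "0 < w" "w \<le> 1" "s = w * w" using s by (auto simp: w_def)
  have wq: "w = q * q ^ j" by (simp add: w_def s_def q_def real_sqrt_power real_sqrt_mult real_sqrt_divide)
  have wqj: "w \<le> q ^ j" unfolding wq using q by (intro mult_left_le_one_le) auto
  have t: "(1 / 2) ^ j = 2 * (w * w)" using w(3) by (simp add: s_def)
  have \<rho>: "0 < \<rho>" using r by (simp add: \<rho>_def)
  have K: "0 \<le> K" by (simp add: K_def)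
  define e1 where "e1 = C * (2 * (w * w))\<^sup>2 / w + 2 * m * (K * (w * w) / \<rho> ^ 3)"
  have nb: "norm b = 1" "norm c = 1" using b c by auto
  note em = err_measurable[of j] and eb = err_le(1)[of j]
  have near1: "\<bar>heatd s b (err j) x\<bar> \<le> e1" if x: "x \<in> ball y \<rho>" for x
  proof -
    have "ball x \<rho> \<subseteq> ball z r"
    proof
      fix v assume "v \<in> ball x \<rho>"
      then show "v \<in> ball z r"
        using x y dist_triangle[of z v y] dist_triangle[of y v x] r by (auto simp: \<rho>_def)
    qed
    then have "\<bar>heatd s b (err j) x\<bar> \<le> C * ((1 / 2) ^ j)\<^sup>2 / sqrt s + 2 * m * (3 * (DIM('a))\<^sup>2 * s / \<rho> ^ 3)"
      using C by (intro abs_heatd_le_local[OF s(1) em eb _ \<rho> _ nb(1)] err_le(2)) auto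
    then show ?thesis by (simp add: e1_def K_def t w_def[symmetric] w(3)[symmetric])
  qed
  have e1: "e1 = 4 * C * w ^ 3 + 2 * m * K / \<rho> ^ 3 * w ^ 2"
    using w by (simp add: e1_def power2_eq_square power3_eq_cube field_simps)
  have e1_nonneg: "0 \<le> e1" using C K w \<rho> bound_nonneg by (simp add: e1)
  note hm = borel_measurable_heatd[OF s(1) em eb, of b] and hb = abs_heatd_le[OF s(1) em eb, of b]
  have w2: "w ^ 2 \<le> w" "w ^ 3 \<le> w"
    using w power_decreasing[of 1 2 w] power_decreasing[of 1 3 w] by auto
  have pos: "0 \<le> 4 * C" "0 \<le> 2 * m * K / \<rho> ^ 3" "0 \<le> 2 * m * K / \<rho> ^ 4"
    using C K \<rho> bound_nonneg by auto
  have gen: "x * w + y * w + u * w \<le> (x + 2 * y + u) * w" "x * w + y * w + y * w \<le> (x + 2 * y + u) * w"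
    if "0 \<le> y" "0 \<le> u" for x y u
    using that mult_nonneg_nonneg[OF that(1), of w] mult_nonneg_nonneg[OF that(2), of w] w by (auto simp: algebra_simps)
  have A: "A = 4 * C + 2 * (2 * m * K / \<rho> ^ 3) + 2 * m * K / \<rho> ^ 4"
    by (simp add: A_def K_def \<rho>_def)
  have "\<bar>heat s (heatd s b (err j)) y\<bar> \<le> e1 + 2 * m * norm b / sqrt s * (3 * (DIM('a))\<^sup>2 * s\<^sup>2 / \<rho> ^ 4)"
    by (intro abs_heat_le_local[OF s(1) hm hb e1_nonneg \<rho> near1])
  also have "\<dots> = 4 * C * w ^ 3 + 2 * m * K / \<rho> ^ 3 * w ^ 2 + 2 * m * K / \<rho> ^ 4 * w ^ 3"
    unfolding e1 w_def[symmetric] nb using w(1)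
    by (simp add: K_def w(3) power2_eq_square power3_eq_cube field_simps)
  also have "\<dots> \<le> 4 * C * w + 2 * m * K / \<rho> ^ 3 * w + 2 * m * K / \<rho> ^ 4 * w"
    using w2 pos by (intro add_mono mult_left_mono) auto
  also have "\<dots> \<le> A * w"
    unfolding A by (rule gen(1)[OF pos(2,3)])
  also have "\<dots> \<le> A * q ^ j"
    using wqj pos unfolding A by (intro mult_left_mono) auto
  finally show "\<bar>heat ((1 / 2) ^ Suc j) (heatd ((1 / 2) ^ Suc j) b (err j)) y\<bar> \<le> A * q ^ j"
    by (simp only: s_def)
  have "\<bar>heatd s c (heatd s b (err j)) y\<bar> \<le> e1 / sqrt s + 2 * m * norm b / sqrt s * (3 * (DIM('a))\<^sup>2 * s / \<rho> ^ 3)"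
    by (intro abs_heatd_le_local[OF s(1) hm hb e1_nonneg \<rho> near1 nb(2)])
  also have "\<dots> = 4 * C * w ^ 2 + 2 * m * K / \<rho> ^ 3 * w + 2 * m * K / \<rho> ^ 3 * w"
    unfolding e1 w_def[symmetric] nb using w(1)
    by (simp add: K_def w(3) power2_eq_square power3_eq_cube field_simps)
  also have "\<dots> \<le> 4 * C * w + 2 * m * K / \<rho> ^ 3 * w + 2 * m * K / \<rho> ^ 3 * w"
    using w2 pos by (intro add_mono mult_left_mono) auto
  also have "\<dots> \<le> A * w"
    unfolding A by (rule gen(2)[OF pos(2,3)])
  also have "\<dots> \<le> A * q ^ j"
    using wqj pos unfolding A by (intro mult_left_mono) auto
  finally show "\<bar>heatd ((1 / 2) ^ Suc j) c (heatd ((1 / 2) ^ Suc j) b (err j)) y\<bar> \<le> A * q ^ j"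
    by (simp only: s_def)
qed

lemma DV_step:
  assumes "b \<in> Basis" and "y \<in> ball z (r / 2)"
  shows "\<bar>DV b (Suc n) y - DV b n y\<bar> \<le> A * q ^ n"
  using err_derivative_le(1)[OF assms(1) assms(1) assms(2), of n] fun_cong[OF DV_diff[OF assms(1), of n], of y]
  by simp

lemma DDV_step:
  assumes "b \<in> Basis" and "c \<in> Basis" and "y \<in> ball z (r / 2)"
  shows "\<bar>DDV b c (Suc n) y - DDV b c n y\<bar> \<le> A * q ^ n"
  using err_derivative_le(2)[OF assms, of n] fun_cong[OF DDV_diff[OF assms(1,2), of n], of y]
  by simp

section \<open>The limit derivatives and the Laplacian\<close>

definition G :: "'a \<Rightarrow> 'a \<Rightarrow> real" where "G b y = lim (\<lambda>n. DV b n y)"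

definition H :: "'a \<Rightarrow> 'a \<Rightarrow> 'a \<Rightarrow> real" where "H b c y = lim (\<lambda>n. DDV b c n y)"

lemma V_tendsto:
  assumes y: "y \<in> ball z r"
  shows "(\<lambda>n. V n y) \<longlonglongrightarrow> U y"
proof -
  \<comment> \<open>Two steps of length \<open>(1 / 2) ^ Suc j\<close> make one of length
    \<open>(1 / 2) ^ j\<close>, so the shifted sequence is the discounted heat image of
    \<open>near\<close>.\<close>
  have "V (Suc j) y = exp (- \<kappa> * (1 / 2) ^ j) * heat ((1 / 2) ^ j) U y" for j
    using heat_heat[of "(1 / 2) ^ Suc j" "(1 / 2) ^ Suc j" U m] meas bound by (simp add: V_def)
  then have le: "norm (V (Suc j) y - U y) \<le> C * ((1 / 2) ^ j)\<^sup>2" for j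
    using near[OF y, of j] by (simp add: abs_minus_commute)
  have "(\<lambda>j. C * ((1 / 2) ^ j)\<^sup>2) \<longlonglongrightarrow> C * 0\<^sup>2"
    by (intro tendsto_intros LIMSEQ_realpow_zero) auto
  then have "(\<lambda>j. C * ((1 / 2) ^ j)\<^sup>2) \<longlonglongrightarrow> 0" by simp
  then have "(\<lambda>j. V (Suc j) y - U y) \<longlonglongrightarrow> 0"
    by (rule Lim_null_comparison[rotated]) (use le in auto)
  then have "(\<lambda>j. V (Suc j) y) \<longlonglongrightarrow> U y" by (simp add: LIM_zero_iff)
  then show ?thesis by (rule LIMSEQ_imp_Suc)
qed

lemma U_has_derivative:
  assumes "y \<in> ball z (r / 2)"
  shows "(U has_derivative (\<lambda>h. \<Sum>b\<in>Basis. (h \<bullet> b) * G b y)) (at y)"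
  unfolding G_def
proof (rule has_derivative_geometric_limit[OF q V_has_derivative DV_step _ assms])
  fix x assume "x \<in> ball z (r / 2)"
  then show "(\<lambda>n. V n x) \<longlonglongrightarrow> U x" using r by (intro V_tendsto) auto
qed

lemma G_has_derivative:
  assumes "b \<in> Basis" and "y \<in> ball z (r / 2)"
  shows "(G b has_derivative (\<lambda>h. \<Sum>c\<in>Basis. (h \<bullet> c) * H b c y)) (at y)"
  unfolding H_def
proof (rule has_derivative_geometric_limit[OF q DV_has_derivative DDV_step _ assms(2)])
  fix y assume "y \<in> ball z (r / 2)"
  then show "(\<lambda>n. DV b n y) \<longlonglongrightarrow> G b y"
    unfolding G_def by (intro geometric_Cauchy(1)[OF q DV_step[OF assms(1)]])
qed (use assms in auto)

lemma H_continuous: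
  assumes "b \<in> Basis" and "c \<in> Basis"
  shows "continuous_on (ball z (r / 2)) (H b c)"
proof (rule uniform_limit_theorem)
  show "\<forall>\<^sub>F n in sequentially. continuous_on (ball z (r / 2)) (DDV b c n)"
    unfolding DDV_def
    by (intro always_eventually allI continuous_intros continuous_on_heatd[OF _ borel_measurable_heatd[OF _ meas bound] abs_heatd_le[OF _ meas bound]]) auto
  show "uniform_limit (ball z (r / 2)) (DDV b c) (H b c) sequentially"
  proof (rule uniform_limitI)
    fix e :: real assume "0 < e"
    have "(\<lambda>n. A * q ^ n / (1 - q)) \<longlonglongrightarrow> A * 0 / (1 - q)"
      using q by (intro tendsto_intros LIMSEQ_realpow_zero) auto
    then have "\<forall>\<^sub>F n in sequentially. A * q ^ n / (1 - q) < e"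
      using \<open>0 < e\<close> by (intro order_tendstoD(2)) auto
    then show "\<forall>\<^sub>F n in sequentially. \<forall>x\<in>ball z (r / 2). dist (DDV b c n x) (H b c x) < e"
    proof eventually_elim
      case (elim n)
      show ?case
      proof
        fix x assume x: "x \<in> ball z (r / 2)"
        from geometric_Cauchy(2)[where a = "\<lambda>n. DDV b c n x" and j = n, OF q DDV_step[OF assms x]] elim
        show "dist (DDV b c n x) (H b c x) < e" by (simp add: dist_real_def H_def)
      qed
    qed
  qed
qed simp

text \<open>The bound must hold for all \<open>v\<close>, since it will be integrated against a
  Gaussian. Near \<open>z\<close> it is Taylor's formula with continuity of the Hessian; far away it
  is boundedness, and the term in \<open>Q\<close> is negligible at order \<open>t\<close>.\<close>

lemma taylor_remainder:
  fixes \<omega> :: real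
  assumes \<omega>: "0 < \<omega>"
  shows "\<exists>Q. \<forall>v. \<bar>U (z + v) - U z - (\<Sum>b\<in>Basis. (v \<bullet> b) * G b z) - (\<Sum>b\<in>Basis. \<Sum>c\<in>Basis. (v \<bullet> b) * (v \<bullet> c) * H b c z) / 2\<bar>
    \<le> (DIM('a))\<^sup>2 * \<omega> * (norm v)\<^sup>2 + Q * norm v ^ 4"
proof -
  let ?P = "\<lambda>b c d. 0 < d \<and> (\<forall>y. dist y z < d \<longrightarrow> \<bar>H b c y - H b c z\<bar> \<le> \<omega>)"
  have ex: "\<exists>d. ?P b c d" if "b \<in> Basis" "c \<in> Basis" for b c
  proof -
    have "isCont (H b c) z"
      using H_continuous[OF that] r by (auto simp: continuous_on_eq_continuous_at)
    then obtain d where "0 < d" "\<And>y. dist y z < d \<Longrightarrow> dist (H b c y) (H b c z) < \<omega>"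
      using \<omega> unfolding continuous_at_eps_delta by blast
    then show ?thesis by (intro exI[of _ d]) (auto simp: dist_real_def intro: less_imp_le)
  qed
  define d where "d b c = (SOME d. ?P b c d)" for b c
  then have d: "?P b c (d b c)" if "b \<in> Basis" "c \<in> Basis" for b c
    using someI_ex[OF ex[OF that]] by simp
  define \<delta> where "\<delta> = Min (insert (r / 2) ((\<lambda>(b, c). d b c) ` (Basis \<times> Basis)))"
  have \<delta>3: "\<delta> \<le> d b c" if "b \<in> Basis" "c \<in> Basis" for b c
  proof -
    show ?thesis unfolding \<delta>_def using that by (intro Min_le) (auto intro!: rev_image_eqI[of "(b, c)"])
  qed
  have \<delta>: "0 < \<delta>" "\<delta> \<le> r / 2"
    unfolding \<delta>_def using r d by auto
  define g where "g = (\<Sum>b\<in>Basis. \<bar>G b z\<bar>)"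
  define k where "k = (\<Sum>b\<in>Basis. \<Sum>c\<in>Basis. \<bar>H b c z\<bar>)"
  have gk: "0 \<le> g" "0 \<le> k" by (auto simp: g_def k_def intro!: sum_nonneg)
  \<comment> \<open>For \<open>norm v \<ge> \<delta>\<close> the terms of degree 0, 1 and 2 are
    raised to degree 4 by powers of \<open>norm v / \<delta>\<close>; the three summands belong to
    \<open>U\<close>, the gradient and the Hessian.\<close>
  define Q where "Q = 2 * m / \<delta> ^ 4 + g / \<delta> ^ 3 + k / \<delta> ^ 2"
  have Q: "0 \<le> Q" using gk \<delta> bound_nonneg by (simp add: Q_def)
  have bb: "\<bar>(v \<bullet> b) * (v \<bullet> c)\<bar> \<le> (norm v)\<^sup>2" if "b \<in> Basis" "c \<in> Basis" for v b c :: 'a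
    unfolding abs_mult power2_eq_square using Basis_le_norm that by (intro mult_mono) auto
  show ?thesis
  proof (rule exI[of _ Q], rule allI)
    fix v :: 'a
    let ?R = "U (z + v) - U z - (\<Sum>b\<in>Basis. (v \<bullet> b) * G b z) - (\<Sum>b\<in>Basis. \<Sum>c\<in>Basis. (v \<bullet> b) * (v \<bullet> c) * H b c z) / 2"
    show "\<bar>?R\<bar> \<le> (DIM('a))\<^sup>2 * \<omega> * (norm v)\<^sup>2 + Q * norm v ^ 4"
    proof (cases "norm v < \<delta>")
      case True
      then obtain s where s: "0 < s" "s < 1" and eq: "U (z + v) = U z + (\<Sum>b\<in>Basis. (v \<bullet> b) * G b z)
          + (\<Sum>b\<in>Basis. \<Sum>c\<in>Basis. (v \<bullet> b) * (v \<bullet> c) * H b c (z + s *\<^sub>R v)) / 2"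
        using taylor2[where z = z and r = "r / 2" and v = v, OF U_has_derivative G_has_derivative] \<delta> by auto
      have "norm (s *\<^sub>R v) \<le> norm v" using s by (simp add: mult_left_le_one_le)
      then have near: "\<bar>H b c (z + s *\<^sub>R v) - H b c z\<bar> \<le> \<omega>" if "b \<in> Basis" "c \<in> Basis" for b c
        using d[OF that] \<delta>3[OF that] True by (auto simp: dist_norm)
      have "?R = (\<Sum>b\<in>Basis. \<Sum>c\<in>Basis. (v \<bullet> b) * (v \<bullet> c) * (H b c (z + s *\<^sub>R v) - H b c z)) / 2"
        unfolding eq by (simp add: right_diff_distrib sum_subtractf diff_divide_distrib)
      also have "\<bar>\<dots>\<bar> \<le> (\<Sum>b\<in>(Basis::'a set). \<Sum>c\<in>(Basis::'a set). (norm v)\<^sup>2 * \<omega>) / 2"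
        unfolding abs_divide abs_numeral
      proof (intro divide_right_mono order.trans[OF sum_abs] sum_mono)
        fix b c :: 'a assume bc: "b \<in> Basis" "c \<in> Basis"
        show "\<bar>(v \<bullet> b) * (v \<bullet> c) * (H b c (z + s *\<^sub>R v) - H b c z)\<bar> \<le> (norm v)\<^sup>2 * \<omega>"
          unfolding abs_mult[of "(v \<bullet> b) * (v \<bullet> c)"] using bb[OF bc, of v] near[OF bc] by (intro mult_mono) auto
      qed auto
      also have "\<dots> \<le> (DIM('a))\<^sup>2 * \<omega> * (norm v)\<^sup>2"
        using \<omega> by (simp add: power2_eq_square mult_ac)
      finally show ?thesis using Q by (simp add: add_increasing2)
    next
      case False
      then have v: "1 \<le> norm v / \<delta>" using \<delta> by simp
      have "\<bar>U (z + v) - U z\<bar> \<le> 2 * m" using bound[of "z + v"] bound[of z] by linarith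
      also have "2 * m * 1 \<le> 2 * m * (norm v / \<delta>) ^ 4"
        using bound_nonneg v by (intro mult_left_mono one_le_power) auto
      finally have 1: "\<bar>U (z + v) - U z\<bar> \<le> 2 * m / \<delta> ^ 4 * norm v ^ 4" by (simp add: power_divide)
      have "\<bar>\<Sum>b\<in>Basis. (v \<bullet> b) * G b z\<bar> \<le> (\<Sum>b\<in>Basis. norm v * \<bar>G b z\<bar>)"
        using Basis_le_norm by (intro order.trans[OF sum_abs] sum_mono) (auto simp: abs_mult intro!: mult_right_mono)
      also have "\<dots> = g * norm v * 1" by (simp add: g_def sum_distrib_left mult.commute)
      also have "\<dots> \<le> g * norm v * (norm v / \<delta>) ^ 3"
        using gk v by (intro mult_left_mono one_le_power) auto
      finally have 2: "\<bar>\<Sum>b\<in>Basis. (v \<bullet> b) * G b z\<bar> \<le> g / \<delta> ^ 3 * norm v ^ 4"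
        by (simp add: power_divide power_numeral_reduce mult_ac)
      have "\<bar>\<Sum>b\<in>Basis. \<Sum>c\<in>Basis. (v \<bullet> b) * (v \<bullet> c) * H b c z\<bar> \<le> (\<Sum>b\<in>Basis. \<Sum>c\<in>Basis. (norm v)\<^sup>2 * \<bar>H b c z\<bar>)"
      proof (intro order.trans[OF sum_abs] sum_mono)
        fix b c :: 'a assume bc: "b \<in> Basis" "c \<in> Basis"
        show "\<bar>(v \<bullet> b) * (v \<bullet> c) * H b c z\<bar> \<le> (norm v)\<^sup>2 * \<bar>H b c z\<bar>"
          unfolding abs_mult[of "(v \<bullet> b) * (v \<bullet> c)"] using bb[OF bc, of v] by (intro mult_right_mono) auto
      qed
      also have "\<dots> = k * (norm v)\<^sup>2 * 1" by (simp add: k_def sum_distrib_left mult.commute)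
      also have "\<dots> \<le> k * (norm v)\<^sup>2 * (norm v / \<delta>) ^ 2"
        using gk v by (intro mult_left_mono one_le_power) auto
      finally have 3: "\<bar>\<Sum>b\<in>Basis. \<Sum>c\<in>Basis. (v \<bullet> b) * (v \<bullet> c) * H b c z\<bar> \<le> k / \<delta> ^ 2 * norm v ^ 4"
        by (simp add: power_divide power_numeral_reduce mult_ac)
      have "\<bar>?R\<bar> \<le> Q * norm v ^ 4"
        using 1 2 3 unfolding Q_def distrib_right by linarith
      then show ?thesis using \<omega> by (simp add: add_increasing)
    qed
  qed
qed

text \<open>Integrating the Taylor expansion against \<open>gauss t\<close> kills the linear and
  mixed terms, so \<open>heat t U z - U z\<close> is \<open>t * L / 2\<close> up to a small multiple
  of \<open>t\<close> and \<open>O(t\<^sup>2)\<close>. By \<open>near\<close> it is also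
  \<open>(exp (\<kappa> * t) - 1) * U z\<close> up to \<open>O(t\<^sup>2)\<close>. Divide by
  \<open>t\<close>, let \<open>t\<close> and then \<omega> tend to 0.\<close>

lemma laplacian_eq: "(\<Sum>b\<in>Basis. H b b z) = 2 * \<kappa> * U z"
proof -
  define L where "L = (\<Sum>b\<in>Basis. H b b z)"
  define n where "n = real DIM('a)"
  have *: "\<bar>\<kappa> * U z - L / 2\<bar> \<le> n\<^sup>2 * n * \<omega>" if \<omega>: "0 < \<omega>" for \<omega>
  proof -
    obtain Q where Q: "\<And>v. \<bar>U (z + v) - U z - (\<Sum>b\<in>Basis. (v \<bullet> b) * G b z) - (\<Sum>b\<in>Basis. \<Sum>c\<in>Basis. (v \<bullet> b) * (v \<bullet> c) * H b c z) / 2\<bar>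
      \<le> (DIM('a))\<^sup>2 * \<omega> * (norm v)\<^sup>2 + Q * norm v ^ 4"
      using taylor_remainder[OF \<omega>] by blast
    have Q0: "0 \<le> Q + n\<^sup>2 * \<omega>"
    proof -
      obtain e :: 'a where "e \<in> Basis" using nonempty_Basis by blast
      with Q[of e] show ?thesis by (simp add: n_def) 
    qed
    \<comment> \<open>\<open>taylor_remainder\<close> asserts no sign for \<open>Q\<close>, but the
      fourth moment is only bounded from above, so its coefficient has to be nonnegative.\<close>
    define Q' where "Q' = max Q 0"
    have main: "\<bar>(exp (\<kappa> * t) - 1) / t * U z - L / 2\<bar> \<le> n\<^sup>2 * n * \<omega> + (Q' * (3 * n\<^sup>2) + C * exp \<kappa>) * t"
      if t: "t = (1 / 2) ^ j" for t j
    proof -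
      have t0: "0 < t" "t \<le> 1" by (auto simp: t power_le_one)
      interpret Gt: prob_space "gauss t :: 'a measure" using t0(1) by (rule prob_space_gauss)
      let ?R = "\<lambda>v. U (z + v) - U z - (\<Sum>b\<in>Basis. (v \<bullet> b) * G b z) - (\<Sum>b\<in>Basis. \<Sum>c\<in>Basis. (v \<bullet> b) * (v \<bullet> c) * H b c z) / 2"
      have "has_bochner_integral (gauss t) ?R
          (heat t U z - U z - (\<Sum>b\<in>(Basis::'a set). 0 * G b z) - (\<Sum>b\<in>Basis. \<Sum>c\<in>Basis. (if b = c then t else 0) * H b c z) / 2)"
      proof (intro has_bochner_integral_diff has_bochner_integral_divide_zero has_bochner_integral_sum has_bochner_integral_mult_left)
        show "has_bochner_integral (gauss t) (\<lambda>v. U (z + v)) (heat t U z)"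
          unfolding heat_def by (intro has_bochner_integral_integrable integrable_heat[OF t0(1) meas bound])
        show "has_bochner_integral (gauss t) (\<lambda>v::'a. U z) (U z)"
          using Gt.prob_space by (simp add: has_bochner_integral_iff)
      qed (rule gauss_inner_moment(1)[OF t0(1)] gauss_inner_cross_moment[OF t0(1)]; assumption)+
      also have "(\<Sum>b\<in>Basis. \<Sum>c\<in>Basis. (if b = c then t else 0) * H b c z) = t * L"
        by (simp add: L_def if_distrib[of "\<lambda>x. x * _"] sum.delta sum_distrib_left cong: if_cong)
      finally have R: "has_bochner_integral (gauss t) ?R (heat t U z - U z - t * L / 2)" by simp
      have N2: "has_bochner_integral (gauss t) (\<lambda>v::'a. (norm v)\<^sup>2) (n * t)"
      proof -
        have "has_bochner_integral (gauss t) (\<lambda>v::'a. \<Sum>b\<in>Basis. (v \<bullet> b)\<^sup>2) (\<Sum>b\<in>(Basis::'a set). t)"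
          by (rule has_bochner_integral_sum) (rule gauss_inner_moment(2)[OF t0(1)])
        then show ?thesis by (simp add: norm_power2_eq_sum n_def)
      qed
      note N4 = gauss_norm_power4[OF t0(1), where 'a='a]
      have "\<bar>heat t U z - U z - t * L / 2\<bar> \<le> (\<integral>v. n\<^sup>2 * \<omega> * (norm v)\<^sup>2 + Q' * norm v ^ 4 \<partial>(gauss t :: 'a measure))"
        unfolding has_bochner_integral_integral_eq[OF R, symmetric]
      proof (rule integral_abs_bound_integral)
        show "integrable (gauss t) ?R" using R by (rule integrable.intros)
        show "integrable (gauss t) (\<lambda>v::'a. n\<^sup>2 * \<omega> * (norm v)\<^sup>2 + Q' * norm v ^ 4)"
          using N2 N4(1) by (auto simp: has_bochner_integral_iff)
        fix v :: 'a
        have "Q * norm v ^ 4 \<le> Q' * norm v ^ 4" by (intro mult_right_mono) (auto simp: Q'_def)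
        then show "\<bar>?R v\<bar> \<le> n\<^sup>2 * \<omega> * (norm v)\<^sup>2 + Q' * norm v ^ 4"
          using Q[of v] by (simp add: n_def)
      qed
      also have "\<dots> = n\<^sup>2 * \<omega> * (n * t) + Q' * (\<integral>v. norm v ^ 4 \<partial>(gauss t :: 'a measure))"
        using N2 N4(1) by (simp add: has_bochner_integral_iff)
      also have "\<dots> \<le> n\<^sup>2 * \<omega> * (n * t) + Q' * (3 * n\<^sup>2 * t\<^sup>2)"
        using N4(2) by (intro add_left_mono mult_left_mono) (auto simp: Q'_def n_def)
      finally have 1: "\<bar>heat t U z - U z - t * L / 2\<bar> \<le> n\<^sup>2 * \<omega> * (n * t) + Q' * (3 * n\<^sup>2 * t\<^sup>2)" .
      have "\<bar>U z - exp (- \<kappa> * t) * heat t U z\<bar> \<le> C * t\<^sup>2"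
        using near[of z j] r by (simp add: t)
      then have "exp (\<kappa> * t) * \<bar>U z - exp (- \<kappa> * t) * heat t U z\<bar> \<le> exp (\<kappa> * t) * (C * t\<^sup>2)"
        by (rule mult_left_mono) simp
      also have "exp (\<kappa> * t) * \<bar>U z - exp (- \<kappa> * t) * heat t U z\<bar> = \<bar>exp (\<kappa> * t) * (U z - exp (- \<kappa> * t) * heat t U z)\<bar>"
        by (simp add: abs_mult)
      also have "exp (\<kappa> * t) * (U z - exp (- \<kappa> * t) * heat t U z) = exp (\<kappa> * t) * U z - heat t U z"
        by (simp add: right_diff_distrib exp_minus field_simps)
      also have "exp (\<kappa> * t) * (C * t\<^sup>2) \<le> exp \<kappa> * (C * t\<^sup>2)"
        using \<kappa> t0 C by (intro mult_right_mono) (auto simp: mult_left_le)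
      finally have 2: "\<bar>exp (\<kappa> * t) * U z - heat t U z\<bar> \<le> exp \<kappa> * (C * t\<^sup>2)" .
      have "\<bar>(exp (\<kappa> * t) - 1) * U z - t * L / 2\<bar> \<le> n\<^sup>2 * \<omega> * (n * t) + Q' * (3 * n\<^sup>2 * t\<^sup>2) + exp \<kappa> * (C * t\<^sup>2)"
        using 1 2 unfolding left_diff_distrib by linarith
      then have "\<bar>(exp (\<kappa> * t) - 1) * U z - t * L / 2\<bar> / t \<le> (n\<^sup>2 * \<omega> * (n * t) + Q' * (3 * n\<^sup>2 * t\<^sup>2) + exp \<kappa> * (C * t\<^sup>2)) / t"
        using t0 by (intro divide_right_mono) auto
      also have "\<bar>(exp (\<kappa> * t) - 1) * U z - t * L / 2\<bar> / t = \<bar>((exp (\<kappa> * t) - 1) * U z - t * L / 2) / t\<bar>"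
        using t0 by (simp add: abs_divide)
      also have "((exp (\<kappa> * t) - 1) * U z - t * L / 2) / t = (exp (\<kappa> * t) - 1) / t * U z - L / 2"
        using t0 by (simp add: field_simps)
      also have "(n\<^sup>2 * \<omega> * (n * t) + Q' * (3 * n\<^sup>2 * t\<^sup>2) + exp \<kappa> * (C * t\<^sup>2)) / t = n\<^sup>2 * n * \<omega> + (Q' * (3 * n\<^sup>2) + C * exp \<kappa>) * t"
        using t0 by (simp add: field_simps power2_eq_square)
      finally show ?thesis .
    qed
    have t0: "(\<lambda>j. (1 / 2 :: real) ^ j) \<longlonglongrightarrow> 0" by (intro LIMSEQ_realpow_zero) auto
    have "((\<lambda>t. exp (\<kappa> * t)) has_field_derivative \<kappa>) (at 0)"
      by (auto intro!: derivative_eq_intros)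
    then have "((\<lambda>t. (exp (\<kappa> * t) - 1) / t) \<longlongrightarrow> \<kappa>) (at 0)"
      unfolding has_field_derivative_iff by simp
    then have e: "(\<lambda>j. (exp (\<kappa> * (1 / 2) ^ j) - 1) / (1 / 2) ^ j) \<longlonglongrightarrow> \<kappa>"
      by (rule filterlim_compose) (use t0 in \<open>auto simp: filterlim_at\<close>)
    have "(\<lambda>j. \<bar>(exp (\<kappa> * (1 / 2) ^ j) - 1) / (1 / 2) ^ j * U z - L / 2\<bar>) \<longlonglongrightarrow> \<bar>\<kappa> * U z - L / 2\<bar>"
      by (intro tendsto_intros e)
    moreover have "(\<lambda>j. n\<^sup>2 * n * \<omega> + (Q' * (3 * n\<^sup>2) + C * exp \<kappa>) * (1 / 2) ^ j) \<longlonglongrightarrow> n\<^sup>2 * n * \<omega> + (Q' * (3 * n\<^sup>2) + C * exp \<kappa>) * 0"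
      by (intro tendsto_intros t0)
    ultimately show ?thesis
      using main by (intro LIMSEQ_le[of _ _ _ "n\<^sup>2 * n * \<omega>"]) auto
  qed
  have "\<bar>\<kappa> * U z - L / 2\<bar> \<le> 0"
  proof (rule field_le_epsilon)
    fix e :: real assume e: "0 < e"
    have n: "0 < n" by (simp add: n_def)
    show "\<bar>\<kappa> * U z - L / 2\<bar> \<le> 0 + e"
      using *[of "e / (n\<^sup>2 * n)"] e n by simp
  qed
  then show ?thesis by (simp add: L_def)
qed

end

section \<open>Panharmonic functions\<close>

lemma partial_deriv_eqI:
  assumes "(u has_derivative (\<lambda>h. \<Sum>b\<in>Basis. (h \<bullet> b) * G b)) (at y)" and b: "b \<in> Basis"
  shows "partial_deriv b u y = G b"
proof -
  have "frechet_derivative u (at y) = (\<lambda>h. \<Sum>b\<in>Basis. (h \<bullet> b) * G b)"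
    using frechet_derivative_at[OF assms(1)] by simp
  then show ?thesis
    using b by (simp add: partial_deriv_def inner_Basis if_distrib[of "\<lambda>x. x * _"] sum.delta cong: if_cong)
qed

lemma has_derivative_partial_deriv:
  fixes u :: "'a::euclidean_space \<Rightarrow> real"
  assumes "u differentiable (at y)"
  shows "(u has_derivative (\<lambda>h. \<Sum>b\<in>Basis. (h \<bullet> b) * partial_deriv b u y)) (at y)"
proof -
  have d: "(u has_derivative frechet_derivative u (at y)) (at y)"
    using assms by (simp add: frechet_derivative_works)
  from linear_eq_sum_Basis[OF has_derivative_linear[OF d]] d show ?thesis
    unfolding partial_deriv_def by simp
qed

text \<open>The local data may change from point to point; uniqueness of derivatives identifies all
  of them with the iterated \<open>partial_deriv\<close>, so the pieces fit together.\<close>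

lemma C2_onI:
  fixes u :: "'a::euclidean_space \<Rightarrow> real"
  assumes local: "\<And>z. z \<in> D \<Longrightarrow> \<exists>r>0. \<exists>G H.
      (\<forall>y\<in>ball z r. (u has_derivative (\<lambda>h. \<Sum>b\<in>Basis. (h \<bullet> b) * G b y)) (at y)) \<and>
      (\<forall>b\<in>Basis. \<forall>y\<in>ball z r. (G b has_derivative (\<lambda>h. \<Sum>c\<in>Basis. (h \<bullet> c) * H b c y)) (at y)) \<and>
      (\<forall>b\<in>Basis. \<forall>c\<in>Basis. continuous_on (ball z r) (H b c)) \<and> (\<Sum>b\<in>Basis. H b b z) = l z"
  shows "C2_on D u" and "\<And>z. z \<in> D \<Longrightarrow> laplacian u z = l z"
proof -
  have *: "u differentiable (at z) \<and> (\<forall>b\<in>Basis. partial_deriv b u differentiable (at z)) \<and>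
      (\<forall>b\<in>Basis. \<forall>c\<in>Basis. isCont (partial_deriv c (partial_deriv b u)) z) \<and> laplacian u z = l z" if z: "z \<in> D" for z
  proof -
    let ?P = "\<lambda>r G H. (\<forall>y\<in>ball z r. (u has_derivative (\<lambda>h. \<Sum>b\<in>Basis. (h \<bullet> b) * G b y)) (at y)) \<and>
      (\<forall>b\<in>Basis. \<forall>y\<in>ball z r. (G b has_derivative (\<lambda>h. \<Sum>c\<in>Basis. (h \<bullet> c) * H b c y)) (at y)) \<and>
      (\<forall>b\<in>Basis. \<forall>c\<in>Basis. continuous_on (ball z r) (H b c)) \<and> (\<Sum>b\<in>Basis. H b b z) = l z"
    obtain r G H where r: "0 < r" and P: "?P r G H"
      using local[OF z] by (elim exE conjE) (rule that; simp only: simp_thms)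
    have u: "(u has_derivative (\<lambda>h. \<Sum>b\<in>Basis. (h \<bullet> b) * G b y)) (at y)" if "y \<in> ball z r" for y
      using P that by blast
    have G: "(G b has_derivative (\<lambda>h. \<Sum>c\<in>Basis. (h \<bullet> c) * H b c y)) (at y)" if "b \<in> Basis" "y \<in> ball z r" for b y
      using P that by blast
    have H: "continuous_on (ball z r) (H b c)" if "b \<in> Basis" "c \<in> Basis" for b c
      using P that by blast
    have l: "(\<Sum>b\<in>Basis. H b b z) = l z" using P by blast
    have zr: "z \<in> ball z r" using r by simp
    have p: "partial_deriv b u y = G b y" if "b \<in> Basis" "y \<in> ball z r" for b y
      by (rule partial_deriv_eqI[OF u[OF that(2)] that(1)])
    have dp: "(partial_deriv b u has_derivative (\<lambda>h. \<Sum>c\<in>Basis. (h \<bullet> c) * H b c y)) (at y)" if b: "b \<in> Basis" and y: "y \<in> ball z r" for b y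
    proof (rule has_derivative_transform_within_open[OF G[OF b y] open_ball y])
      show "G b x = partial_deriv b u x" if "x \<in> ball z r" for x using p[OF b that] by simp
    qed
    have pp: "partial_deriv c (partial_deriv b u) y = H b c y" if "b \<in> Basis" "c \<in> Basis" "y \<in> ball z r" for b c y
      by (rule partial_deriv_eqI[OF dp[OF that(1,3)] that(2)])
    have "isCont (partial_deriv c (partial_deriv b u)) z" if b: "b \<in> Basis" "c \<in> Basis" for b c
    proof -
      have "continuous_on (ball z r) (partial_deriv c (partial_deriv b u))"
        by (rule continuous_on_eq[OF H[OF b]]) (simp add: pp[OF b])
      then show ?thesis using zr by (simp add: continuous_on_eq_continuous_at)
    qed
    moreover have "laplacian u z = l z"
      unfolding laplacian_def l[symmetric] using pp zr by (intro sum.cong) auto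
    ultimately show ?thesis
      using u[OF zr] dp[OF _ zr] by (auto simp: differentiable_def)
  qed
  show "C2_on D u"
    unfolding C2_on_def using * by (auto intro: continuous_at_imp_continuous_on)
  show "\<And>z. z \<in> D \<Longrightarrow> laplacian u z = l z" using * by blast
qed

lemma panharmonic_onI_heat:
  fixes U :: "'a::euclidean_space \<Rightarrow> real"
  assumes "U \<in> borel_measurable borel" and "\<And>y. \<bar>U y\<bar> \<le> m" 
    and near: "\<And>z. z \<in> D \<Longrightarrow> \<exists>r>0. \<exists>C\<ge>0. \<forall>y\<in>ball z r. \<forall>j. \<bar>U y - exp (- (\<mu>\<^sup>2 / 2) * (1 / 2) ^ j) * heat ((1 / 2) ^ j) U y\<bar> \<le> C * ((1 / 2) ^ j)\<^sup>2"
  shows "panharmonic_on \<mu> D U"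
proof -
  have "\<exists>r>0. \<exists>G H.
      (\<forall>y\<in>ball z r. (U has_derivative (\<lambda>h. \<Sum>b\<in>Basis. (h \<bullet> b) * G b y)) (at y)) \<and>
      (\<forall>b\<in>Basis. \<forall>y\<in>ball z r. (G b has_derivative (\<lambda>h. \<Sum>c\<in>Basis. (h \<bullet> c) * H b c y)) (at y)) \<and>
      (\<forall>b\<in>Basis. \<forall>c\<in>Basis. continuous_on (ball z r) (H b c)) \<and> (\<Sum>b\<in>Basis. H b b z) = \<mu>\<^sup>2 * U z" if z: "z \<in> D" for z
  proof -
    obtain r C where r: "0 < r" "0 \<le> C" "\<forall>y\<in>ball z r. \<forall>j. \<bar>U y - exp (- (\<mu>\<^sup>2 / 2) * (1 / 2) ^ j) * heat ((1 / 2) ^ j) U y\<bar> \<le> C * ((1 / 2) ^ j)\<^sup>2"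
      using near[OF z] by blast
    interpret approx_eigenfunction U m "\<mu>\<^sup>2 / 2" C r z
      by unfold_locales (use assms(1,2) r in auto)
    show ?thesis
      using U_has_derivative G_has_derivative H_continuous laplacian_eq r(1)
      by (intro exI[of _ "r / 2"] conjI exI[of _ G] exI[of _ H]) auto
  qed
  note C2_onI[of D U "\<lambda>z. \<mu>\<^sup>2 * U z", OF this]
  then show ?thesis by (auto simp: panharmonic_on_def)
qed

text \<open>The quadratic \<open>2n/\<mu>\<^sup>2 + |y|\<^sup>2\<close> is a supersolution that tends to infinity, so
  subtracting a small multiple of it forces the maximum to be attained.\<close>

lemma panharmonic_le_zero:
  fixes u :: "'a::euclidean_space \<Rightarrow> real"
  assumes \<mu>: "0 < \<mu>" and D: "open D" and cont: "continuous_on (closure D) u" and bdd: "bounded (u ` closure D)"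
    and pan: "panharmonic_on \<mu> D u" and bdry: "\<And>y. y \<in> frontier D \<Longrightarrow> u y \<le> 0" and x: "x \<in> closure D"
  shows "u x \<le> 0"
proof -
  define n where "n = real DIM('a)"
  \<comment> \<open>The Laplacian of \<open>S\<close> is \<open>2 * n\<close>, and the constant term
    makes \<open>\<mu>\<^sup>2 * S\<close> at least that large.\<close>
  define S where "S y = 2 * n / \<mu>\<^sup>2 + (norm y)\<^sup>2" for y :: 'a
  obtain M where M: "\<And>y. y \<in> closure D \<Longrightarrow> \<bar>u y\<bar> \<le> M" using bdd by (auto simp: bounded_iff)
  have n: "0 < n" by (simp add: n_def)
  have S: "0 < S y" "(norm y)\<^sup>2 \<le> S y" for y using \<mu> n by (auto simp: S_def intro!: add_pos_nonneg)
  have main: "u x \<le> \<epsilon> * S x" if \<epsilon>: "0 < \<epsilon>" for \<epsilon>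
  proof (rule ccontr)
    assume neg: "\<not> ?thesis"
    define w where "w y = u y - \<epsilon> * S y" for y
    \<comment> \<open>Outside radius \<open>sqrt (\<bar>M\<bar> / \<epsilon>)\<close> the function
      \<open>w\<close> is not positive, so a positive maximum lies strictly inside; adding
      \<open>norm x\<close> brings the competitor \<open>x\<close> into the compact set.\<close>
    define R where "R = sqrt (\<bar>M\<bar> / \<epsilon>) + norm x"
    have big: "w y \<le> 0" if y: "y \<in> closure D" "sqrt (\<bar>M\<bar> / \<epsilon>) \<le> norm y" for y
    proof -
      have "(sqrt (\<bar>M\<bar> / \<epsilon>))\<^sup>2 \<le> (norm y)\<^sup>2" using y \<epsilon> by (intro power_mono) auto
      then have "\<bar>M\<bar> \<le> \<epsilon> * (norm y)\<^sup>2" using \<epsilon> by (simp add: field_simps)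
      also have "\<dots> \<le> \<epsilon> * S y" using S \<epsilon> by (intro mult_left_mono) auto
      finally show ?thesis using M[OF y(1)] by (simp add: w_def)
    qed
    define K where "K = closure D \<inter> cball 0 R"
    have "x \<in> K" using x \<epsilon> by (simp add: K_def R_def)
    moreover have "compact K" by (auto simp: K_def intro!: closed_Int_compact)
    moreover have "continuous_on K w"
      unfolding w_def S_def using cont by (intro continuous_intros) (auto simp: K_def intro: continuous_on_subset)
    ultimately obtain p where p: "p \<in> K" and max: "\<And>y. y \<in> K \<Longrightarrow> w y \<le> w p"
      using continuous_attains_sup[of K w] by blast
    have wx: "0 < w x" using neg by (simp add: w_def)
    then have wp: "0 < w p" using max[OF \<open>x \<in> K\<close>] by simp
    have pc: "p \<in> closure D" using p by (simp add: K_def)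
    have "0 < \<epsilon> * S p" using S(1) \<epsilon> by simp
    then have "p \<notin> frontier D" using wp bdry[of p] by (auto simp: w_def)
    then have pD: "p \<in> D" using pc D by (simp add: frontier_def interior_open)
    have "\<not> sqrt (\<bar>M\<bar> / \<epsilon>) \<le> norm p" using big[OF pc] wp by auto
    then have "norm p < R" using norm_ge_zero[of x] unfolding R_def by linarith
    then have "p \<in> D \<inter> ball 0 R" using pD by simp
    then obtain r where r: "0 < r" "ball p r \<subseteq> D \<inter> ball 0 R"
      using D open_contains_ball by (metis open_Int open_ball)
    let ?G = "\<lambda>b y. partial_deriv b u y - \<epsilon> * (2 * (y \<bullet> b))"
    let ?H = "\<lambda>b c y. partial_deriv c (partial_deriv b u) y - (if b = c then \<epsilon> * 2 else 0)"
    have C2: "C2_on D u" and lap: "laplacian u p = \<mu>\<^sup>2 * u p"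
      using pan pD by (auto simp: panharmonic_on_def)
    have "?H e e p \<le> 0" if e: "e \<in> Basis" for e
    proof (rule second_derivative_test[of r p w ?G ?H, OF r(1) _ _ _ _ e])
      fix y assume y: "y \<in> ball p r"
      then have yD: "y \<in> D" "norm y < R" using r by auto
      have S': "(S has_derivative (\<lambda>h. 2 * (y \<bullet> h))) (at y)"
        unfolding S_def power2_norm_eq_inner by (auto intro!: derivative_eq_intros simp: inner_commute)
      have "(w has_derivative (\<lambda>h. (\<Sum>b\<in>Basis. (h \<bullet> b) * partial_deriv b u y) - \<epsilon> * (2 * (y \<bullet> h)))) (at y)"
        unfolding w_def using C2 yD
        by (intro has_derivative_diff has_derivative_mult_right S' has_derivative_partial_deriv) (auto simp: C2_on_def)
      moreover have "(\<Sum>b\<in>Basis. (h \<bullet> b) * partial_deriv b u y) - \<epsilon> * (2 * (y \<bullet> h)) = (\<Sum>b\<in>Basis. (h \<bullet> b) * ?G b y)" for h :: 'a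
        unfolding euclidean_inner[of y h] right_diff_distrib sum_subtractf sum_distrib_left
        by (intro arg_cong2[where f = minus] sum.cong refl) simp
      ultimately show "(w has_derivative (\<lambda>h. \<Sum>b\<in>Basis. (h \<bullet> b) * ?G b y)) (at y)"
        by simp
      show "w y \<le> w p" using yD closure_subset[of D] by (intro max) (auto simp: K_def)
    next
      fix b y :: 'a assume b: "b \<in> Basis" and y: "y \<in> ball p r"
      then have yD: "y \<in> D" using r by auto
      have "(?G b has_derivative (\<lambda>h. (\<Sum>c\<in>Basis. (h \<bullet> c) * partial_deriv c (partial_deriv b u) y) - \<epsilon> * (2 * (h \<bullet> b)))) (at y)"
        using C2 yD b
        by (intro has_derivative_diff has_derivative_mult_right has_derivative_partial_deriv has_derivative_inner_left has_derivative_ident) (auto simp: C2_on_def)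
      moreover have "(\<Sum>c\<in>Basis. (h \<bullet> c) * partial_deriv c (partial_deriv b u) y) - \<epsilon> * (2 * (h \<bullet> b)) = (\<Sum>c\<in>Basis. (h \<bullet> c) * ?H b c y)" for h :: 'a
      proof -
        have "(\<Sum>c\<in>Basis. (h \<bullet> c) * (if b = c then \<epsilon> * 2 else 0)) = \<epsilon> * (2 * (h \<bullet> b))"
          using b by (simp add: if_distrib[of "\<lambda>x. _ * x"] sum.delta cong: if_cong)
        then show ?thesis unfolding right_diff_distrib sum_subtractf by simp
      qed
      ultimately show "(?G b has_derivative (\<lambda>h. \<Sum>c\<in>Basis. (h \<bullet> c) * ?H b c y)) (at y)"
        by simp
    next
      fix b c :: 'a assume "b \<in> Basis" "c \<in> Basis"
      then show "continuous_on (ball p r) (?H b c)"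
        using C2 r by (intro continuous_on_diff continuous_on_const continuous_on_subset[where s = D and t = "ball p r"]) (auto simp: C2_on_def)
    qed
    then have "(\<Sum>e\<in>Basis. ?H e e p) \<le> 0" by (intro sum_nonpos) auto
    \<comment> \<open>At the maximum the Laplacian of \<open>u\<close> is at most that of
      \<open>\<epsilon> * S\<close>. Via the equation for \<open>u\<close> and the choice of
      \<open>S\<close> this gives \<open>w p \<le> 0\<close>, a contradiction.\<close>
    then have "\<mu>\<^sup>2 * u p \<le> \<epsilon> * (2 * n)"
      using lap by (simp add: laplacian_def sum_subtractf n_def mult_ac)
    also have "\<dots> \<le> \<mu>\<^sup>2 * (\<epsilon> * S p)"
      using \<mu> \<epsilon> by (simp add: S_def field_simps)
    finally have "u p \<le> \<epsilon> * S p" using \<mu> by simp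
    then show False using wp by (simp add: w_def)
  qed
  show ?thesis
  proof (rule field_le_epsilon)
    fix e :: real assume "0 < e"
    then show "u x \<le> 0 + e" using main[of "e / S x"] S(1)[of x] by simp
  qed
qed

section \<open>Uniqueness of bounded solutions\<close>

lemma panharmonic_on_diff:
  fixes u v :: "'a::euclidean_space \<Rightarrow> real"
  assumes D: "open D" and "panharmonic_on \<mu> D u" "panharmonic_on \<mu> D v"
  shows "panharmonic_on \<mu> D (\<lambda>x. u x - v x)"
proof -
  have C: "C2_on D u" "C2_on D v" using assms by (auto simp: panharmonic_on_def)
  have *: "\<exists>r>0. \<exists>G H.
      (\<forall>y\<in>ball z r. ((\<lambda>x. u x - v x) has_derivative (\<lambda>h. \<Sum>b\<in>Basis. (h \<bullet> b) * G b y)) (at y)) \<and>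
      (\<forall>b\<in>Basis. \<forall>y\<in>ball z r. (G b has_derivative (\<lambda>h. \<Sum>c\<in>Basis. (h \<bullet> c) * H b c y)) (at y)) \<and>
      (\<forall>b\<in>Basis. \<forall>c\<in>Basis. continuous_on (ball z r) (H b c)) \<and> (\<Sum>b\<in>Basis. H b b z) = \<mu>\<^sup>2 * (u z - v z)" if z: "z \<in> D" for z
  proof -
    obtain r where r: "0 < r" "ball z r \<subseteq> D" using D z open_contains_ball by metis
    have lin: "(\<lambda>h::'a. (\<Sum>b\<in>Basis. (h \<bullet> b) * f b) - (\<Sum>b\<in>Basis. (h \<bullet> b) * g b)) = (\<lambda>h. \<Sum>b\<in>Basis. (h \<bullet> b) * (f b - g b))" for f g
      by (simp add: right_diff_distrib sum_subtractf)
    let ?G = "\<lambda>b y. partial_deriv b u y - partial_deriv b v y"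
    let ?H = "\<lambda>b c y. partial_deriv c (partial_deriv b u) y - partial_deriv c (partial_deriv b v) y"
    have "((\<lambda>x. u x - v x) has_derivative (\<lambda>h. \<Sum>b\<in>Basis. (h \<bullet> b) * ?G b y)) (at y)" if "y \<in> ball z r" for y
      unfolding lin[symmetric] using that r C
      by (intro has_derivative_diff has_derivative_partial_deriv) (auto simp: C2_on_def)
    moreover have "(?G b has_derivative (\<lambda>h. \<Sum>c\<in>Basis. (h \<bullet> c) * ?H b c y)) (at y)" if "b \<in> Basis" "y \<in> ball z r" for b y
      unfolding lin[symmetric] using that r C
      by (intro has_derivative_diff has_derivative_partial_deriv) (auto simp: C2_on_def)
    moreover have "continuous_on (ball z r) (?H b c)" if "b \<in> Basis" "c \<in> Basis" for b c
      using that C by (intro continuous_on_diff continuous_on_subset[OF _ r(2)]) (auto simp: C2_on_def)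
    moreover have "(\<Sum>b\<in>Basis. ?H b b z) = \<mu>\<^sup>2 * (u z - v z)"
      using assms z by (simp add: panharmonic_on_def sum_subtractf laplacian_def[symmetric] right_diff_distrib)
    ultimately show ?thesis
      using r(1) by (intro exI[of _ r] conjI exI[of _ ?G] exI[of _ ?H]) auto
  qed
  from C2_onI[of D "\<lambda>x. u x - v x" "\<lambda>z. \<mu>\<^sup>2 * (u z - v z)", OF *] show ?thesis
    by (auto simp: panharmonic_on_def)
qed

theorem panharmonic_unique:
  fixes u v :: "'a::euclidean_space \<Rightarrow> real"
  assumes \<mu>: "0 < \<mu>" and D: "open D"
    and u: "continuous_on (closure D) u" "bounded (u ` closure D)" "panharmonic_on \<mu> D u"
    and v: "continuous_on (closure D) v" "bounded (v ` closure D)" "panharmonic_on \<mu> D v"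
    and eq: "\<And>y. y \<in> frontier D \<Longrightarrow> u y = v y" and x: "x \<in> closure D"
  shows "u x = v x"
proof -
  have "u x - v x \<le> 0" if "continuous_on (closure D) u" "bounded (u ` closure D)" "panharmonic_on \<mu> D u"
    "continuous_on (closure D) v" "bounded (v ` closure D)" "panharmonic_on \<mu> D v" 
    "\<And>y. y \<in> frontier D \<Longrightarrow> u y = v y" for u v
  proof (rule panharmonic_le_zero[OF \<mu> D _ _ panharmonic_on_diff[OF D that(3,6)] _ x])
    show "continuous_on (closure D) (\<lambda>x. u x - v x)" using that by (intro continuous_intros)
    show "bounded ((\<lambda>x. u x - v x) ` closure D)" using that by (intro bounded_minus_comp)
  qed (use that in auto)
  from this[OF u v eq] this[OF v u eq[symmetric]] show ?thesis by simp
qed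

section \<open>Sampled paths\<close>

text \<open>Paths are represented by their values at the dyadic times; the index \<open>(m, i)\<close> stands for \<open>i / 2 ^ m\<close>.\<close>

definition dyad :: "nat \<times> nat \<Rightarrow> real" where
  "dyad q = real (snd q) / 2 ^ fst q"

definition sample :: "(real \<Rightarrow> 'a) \<Rightarrow> nat \<times> nat \<Rightarrow> 'a" where
  "sample p q = p (dyad q)"

abbreviation path_space :: "(nat \<times> nat \<Rightarrow> 'a::topological_space) measure" where
  "path_space \<equiv> PiM UNIV (\<lambda>_. borel)"

lemma dyad_nonneg [simp]: "0 \<le> dyad q"
  by (simp add: dyad_def)

lemma space_path_space [simp]: "space path_space = UNIV"
  by (simp add: space_PiM PiE_UNIV_domain)

lemma measurable_sample:
  assumes "\<And>t. 0 \<le> t \<Longrightarrow> X t \<in> borel_measurable M"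
  shows "(\<lambda>\<omega>. sample (\<lambda>t. X t \<omega>)) \<in> measurable M path_space"
  by (rule measurable_PiM_single') (auto simp: sample_def assms)

text \<open>Rounding up keeps the dyadic time at or after \<open>s\<close>, hence above any positive
  lower bound imposed on \<open>s\<close>, as \<open>path_exit_sample\<close> requires.\<close>

definition dyad_up :: "real \<Rightarrow> nat \<Rightarrow> nat \<times> nat" where
  "dyad_up s m = (m, nat \<lceil>s * 2 ^ m\<rceil>)"

lemma dyad_up:
  assumes "0 \<le> s"
  shows "s \<le> dyad (dyad_up s m)" and "dyad (dyad_up s m) < s + 1 / 2 ^ m" and "(\<lambda>m. dyad (dyad_up s m)) \<longlonglongrightarrow> s"
proof -
  have e: "dyad (dyad_up s m) = of_int \<lceil>s * 2 ^ m\<rceil> / 2 ^ m" for m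
    using assms by (simp add: dyad_def dyad_up_def)
  show le: "s \<le> dyad (dyad_up s m)" for m
    unfolding e by (simp add: field_simps)
  have "of_int \<lceil>s * 2 ^ m\<rceil> < s * 2 ^ m + 1" for m by linarith
  then have lt: "dyad (dyad_up s m) < s + 1 / 2 ^ m" for m
    unfolding e by (simp add: field_simps)
  then show "dyad (dyad_up s m) < s + 1 / 2 ^ m" .
  have "(\<lambda>m. s + (1 / 2) ^ m) \<longlonglongrightarrow> s + 0"
    by (intro tendsto_intros LIMSEQ_realpow_zero) auto
  then have l: "(\<lambda>m. s + (1 / 2) ^ m) \<longlonglongrightarrow> s" by simp
  show "(\<lambda>m. dyad (dyad_up s m)) \<longlonglongrightarrow> s"
    by (rule tendsto_sandwich[OF _ _ tendsto_const l]) (use le lt in \<open>auto simp: power_divide intro!: always_eventually less_imp_le\<close>)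
qed

text \<open>Evaluation at a real time through dyadic values only. As a limit of selections among
  countably many coordinates it is jointly measurable in the path and a random time.\<close>

definition path_at :: "(nat \<times> nat \<Rightarrow> 'a::{banach, second_countable_topology}) \<Rightarrow> real \<Rightarrow> 'a" where
  "path_at y s = lim (\<lambda>m. y (dyad_up s m))"

lemma path_at_sample:
  assumes "continuous_on {0..} p" and "0 \<le> s"
  shows "path_at (sample p) s = p s"
proof -
  have "(\<lambda>m. p (dyad (dyad_up s m))) \<longlonglongrightarrow> p s"
    using assms by (intro continuous_on_tendsto_compose[OF assms(1) dyad_up(3)]) auto
  then show ?thesis unfolding path_at_def sample_def by (rule limI)
qed

lemma measurable_path_at [measurable (raw)]:
  fixes Y :: "'b \<Rightarrow> nat \<times> nat \<Rightarrow> 'a::{banach, second_countable_topology}"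
  assumes Y: "Y \<in> measurable M path_space" and [measurable]: "R \<in> borel_measurable M"
  shows "(\<lambda>\<omega>. path_at (Y \<omega>) (R \<omega>)) \<in> borel_measurable M"
  unfolding path_at_def
proof (rule borel_measurable_lim_metric)
  fix m
  have "(\<lambda>\<omega>. Y \<omega> (m, nat \<lceil>R \<omega> * 2 ^ m\<rceil>)) \<in> borel_measurable M"
  proof (rule measurable_compose_countable[where f = "\<lambda>i \<omega>. Y \<omega> (m, i)"])
    show "(\<lambda>\<omega>. Y \<omega> (m, i)) \<in> borel_measurable M" for i
      using measurable_compose[OF Y measurable_component_singleton[of "(m, i)" UNIV "\<lambda>_. borel"]] by simp
  qed measurable
  then show "(\<lambda>\<omega>. Y \<omega> (dyad_up (R \<omega>) m)) \<in> borel_measurable M"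
    by (simp add: dyad_up_def)
qed

text \<open>The exit time expressed by dyadic values. For times at least \<open>1 / 2 ^ j\<close>,
  hitting the closed complement of \<open>D\<close> is the limit over \<open>k\<close> of hitting
  its open neighbourhoods of radius \<open>1 / Suc k\<close>, which a continuous path does at dyadic
  times; the outer infimum admits all positive times.\<close>

definition path_exit :: "'a::real_normed_vector set \<Rightarrow> (nat \<times> nat \<Rightarrow> 'a) \<Rightarrow> ereal" where
  "path_exit D y = (INF j. SUP k. INF q. if 1 / 2 ^ j \<le> dyad q \<and> y q \<in> (\<Union>v\<in>- D. ball v (1 / real (Suc k))) then ereal (dyad q) else \<infinity>)"

lemma measurable_path_exit [measurable]:
  "path_exit D \<in> borel_measurable (path_space :: (nat \<times> nat \<Rightarrow> 'a::real_normed_vector) measure)"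
proof -
  have [measurable]: "(\<Union>v\<in>- D. ball v (1 / real (Suc k))) \<in> sets borel" for k
    by (intro borel_open open_UN) auto
  show ?thesis unfolding path_exit_def[abs_def] by measurable
qed

text \<open>The delicate inequality is that the neighbourhoods are not hit much too early: the image
  of a compact time interval without exit has positive distance from the complement, so it misses
  the neighbourhoods for large \<open>k\<close>.\<close>

lemma path_exit_sample:
  fixes p :: "real \<Rightarrow> 'a::euclidean_space"
  assumes p: "continuous_on {0..} p" and D: "open D"
  shows "path_exit D (sample p) = (INF t\<in>{t. 0 < t \<and> p t \<notin> D}. ereal t)"
proof -
  define N where "N k = (\<Union>v\<in>- D. ball v (1 / real (Suc k)))" for k
  define I where "I \<delta> k = (INF q. if \<delta> \<le> dyad q \<and> p (dyad q) \<in> N k then ereal (dyad q) else \<infinity>)" for \<delta> k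
  define T where "T \<delta> = (INF t\<in>{t. \<delta> \<le> t \<and> p t \<notin> D}. ereal t)" for \<delta>
  have main: "(SUP k. I \<delta> k) = T \<delta>" if \<delta>: "0 < \<delta>" for \<delta>
  proof (rule antisym)
    show "(SUP k. I \<delta> k) \<le> T \<delta>"
      unfolding T_def
    proof (intro SUP_least INF_greatest)
      fix k t assume "t \<in> {t. \<delta> \<le> t \<and> p t \<notin> D}"
      then have t: "\<delta> \<le> t" "p t \<notin> D" "0 \<le> t" using \<delta> by auto
      show "I \<delta> k \<le> ereal t"
      proof (rule ereal_le_epsilon2)
        fix e :: real assume e: "0 < e"
        have "(\<lambda>m. p (dyad (dyad_up t m))) \<longlonglongrightarrow> p t"
          using t by (intro continuous_on_tendsto_compose[OF p dyad_up(3)]) auto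
        then have "\<forall>\<^sub>F m in sequentially. dist (p (dyad (dyad_up t m))) (p t) < 1 / real (Suc k)"
          by (rule tendstoD) simp
        moreover have "\<forall>\<^sub>F m in sequentially. dyad (dyad_up t m) < t + e"
          using e by (intro order_tendstoD[OF dyad_up(3)[OF t(3)]]) auto
        ultimately obtain m where m: "dist (p (dyad (dyad_up t m))) (p t) < 1 / real (Suc k)" "dyad (dyad_up t m) < t + e"
          using eventually_happens'[OF sequentially_bot eventually_conj] by blast
        have "p (dyad (dyad_up t m)) \<in> N k"
          unfolding N_def using m(1) t by (intro UN_I[of "p t"]) (auto simp: dist_commute)
        then have "I \<delta> k \<le> ereal (dyad (dyad_up t m))"
          unfolding I_def using dyad_up(1)[OF t(3), of m] t(1) by (intro INF_lower2[of "dyad_up t m"]) auto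
        also have "\<dots> \<le> ereal t + ereal e" using m(2) by simp
        finally show "I \<delta> k \<le> ereal t + ereal e" .
      qed
    qed
    show "T \<delta> \<le> (SUP k. I \<delta> k)"
    proof (rule dense_le)
      fix x assume x: "x < T \<delta>"
      show "x \<le> (SUP k. I \<delta> k)"
      proof (cases x)
        case (real s)
        let ?A = "p ` {\<delta>..s}"
        have inD: "?A \<subseteq> D"
        proof
          fix v assume "v \<in> ?A"
          then obtain u where u: "\<delta> \<le> u" "u \<le> s" "v = p u" by auto
          show "v \<in> D"
          proof (rule ccontr)
            assume "v \<notin> D"
            then have "T \<delta> \<le> ereal u" unfolding T_def using u by (intro INF_lower) auto
            then show False using x u real by (metis ereal_less_eq(3) leD le_less_trans)
          qed
        qed
        have "\<exists>e>0. \<forall>v\<in>?A. ball v e \<subseteq> D"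
        proof (cases "?A = {}")
          case False
          have "compact ?A" using \<delta> by (intro compact_continuous_image continuous_on_subset[OF p]) auto
          from compact_in_open_separated[OF False this D inD] obtain e where
            e: "0 < e" "{x. infdist x ?A \<le> e} \<subseteq> D" by blast
          have "ball v e \<subseteq> D" if "v \<in> ?A" for v
          proof
            fix x assume "x \<in> ball v e"
            then have "infdist x ?A \<le> e" using infdist_le[OF that, of x] by (simp add: dist_commute)
            then show "x \<in> D" using e by auto
          qed
          then show ?thesis using e(1) by blast
        qed (auto intro: exI[of _ 1])
        then obtain e where e: "0 < e" "\<And>v. v \<in> ?A \<Longrightarrow> ball v e \<subseteq> D" by blast
        obtain k where k: "1 / real (Suc k) < e" using nat_approx_posE[OF e(1)] by (metis inverse_eq_divide of_nat_Suc)
        have "x \<le> I \<delta> k"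
          unfolding I_def
        proof (rule INF_greatest)
          fix q
          show "x \<le> (if \<delta> \<le> dyad q \<and> p (dyad q) \<in> N k then ereal (dyad q) else \<infinity>)"
          proof (cases "\<delta> \<le> dyad q \<and> p (dyad q) \<in> N k")
            case True
            have "s < dyad q"
            proof (rule ccontr)
              assume "\<not> ?thesis"
              then have A: "p (dyad q) \<in> ?A" using True by auto
              obtain v where v: "v \<notin> D" "dist v (p (dyad q)) < 1 / real (Suc k)"
                using True by (auto simp: N_def)
              have "v \<in> ball (p (dyad q)) e" using v k by (simp add: dist_commute)
              then show False using e(2)[OF A] v by auto
            qed
            then show ?thesis using True real by simp
          next
            case False
            then show ?thesis by (subst if_not_P) simp_all
          qed
        qed
        then show ?thesis by (rule SUP_upper2[OF UNIV_I])
      qed (use x in auto)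
    qed
  qed
  have "path_exit D (sample p) = (INF j. SUP k. I (1 / 2 ^ j) k)"
    by (simp add: path_exit_def sample_def I_def N_def)
  also have "\<dots> = (INF j::nat. T (1 / 2 ^ j))"
    by (intro INF_cong refl main) simp
  also have "\<dots> = (INF t\<in>{t. 0 < t \<and> p t \<notin> D}. ereal t)"
  proof (rule antisym)
    show "(INF t\<in>{t. 0 < t \<and> p t \<notin> D}. ereal t) \<le> (INF j::nat. T (1 / 2 ^ j))"
      unfolding T_def by (intro INF_greatest INF_lower) (auto intro: less_le_trans[rotated])
    show "(INF j::nat. T (1 / 2 ^ j)) \<le> (INF t\<in>{t. 0 < t \<and> p t \<notin> D}. ereal t)"
    proof (rule INF_greatest)
      fix t assume t: "t \<in> {t. 0 < t \<and> p t \<notin> D}"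
      obtain j where "(1 / 2) ^ j < t" using t real_arch_pow_inv[of t "1 / 2"] by auto
      then have "1 / 2 ^ j \<le> t" by (simp add: power_divide)
      then have "T (1 / 2 ^ j) \<le> ereal t" unfolding T_def using t by (intro INF_lower) auto
      then show "(INF j::nat. T (1 / 2 ^ j)) \<le> ereal t" by (rule INF_lower2[OF UNIV_I])
    qed
  qed
  finally show ?thesis .
qed

section \<open>The law of Brownian motion\<close>

text \<open>Increments rather than values, since these are the independent quantities. The index set
  \<open>{..<Suc K}\<close> is never empty.\<close>

definition grid_increments :: "(real \<Rightarrow> 'a::real_vector) \<Rightarrow> nat \<Rightarrow> nat \<Rightarrow> nat \<Rightarrow> 'a" where
  "grid_increments p n K = (\<lambda>l\<in>{..<Suc K}. p (real (Suc l) / 2 ^ n) - p (real l / 2 ^ n))"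

text \<open>Finitely many dyadic times lie on a common grid, and a displacement from time 0 is a sum
  of grid increments. The event \<open>E\<close> is chosen before the path, so the same
  \<open>E\<close> serves every process and every shift.\<close>

lemma sample_box_eq_grid_event:
  fixes X :: "nat \<times> nat \<Rightarrow> 'a::euclidean_space set"
  assumes J: "finite J" and X: "\<forall>q\<in>J. X q \<in> sets borel"
  shows "\<exists>n K. \<exists>E\<in>sets (PiM {..<Suc K} (\<lambda>_. borel)). \<forall>p. (\<forall>q\<in>J. p (dyad q) - p 0 \<in> X q) \<longleftrightarrow> grid_increments p n K \<in> E"
proof -
  obtain n where n: "\<And>q. q \<in> J \<Longrightarrow> fst q \<le> n"
    using J by (meson finite_imageI finite_nat_set_iff_bounded_le imageI)
  \<comment> \<open>The position of the time \<open>dyad q\<close> on the common grid of mesh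
    \<open>1 / 2 ^ n\<close>.\<close>
  define c where "c q = snd q * 2 ^ (n - fst q)" for q :: "nat \<times> nat"
  obtain K where K: "\<And>q. q \<in> J \<Longrightarrow> c q \<le> K"
    using J by (meson finite_imageI finite_nat_set_iff_bounded_le imageI)
  have d: "dyad q = real (c q) / 2 ^ n" if "q \<in> J" for q
    using n[OF that] by (simp add: dyad_def c_def field_simps flip: power_add)
  define E where "E = {x \<in> space (PiM {..<Suc K} (\<lambda>_. borel :: 'a measure)). \<forall>q\<in>J. (\<Sum>l<c q. x l) \<in> X q}"
  have "E \<in> sets (PiM {..<Suc K} (\<lambda>_. borel))"
    unfolding E_def
  proof (rule sets.sets_Collect_finite_All[OF _ J])
    fix q assume q: "q \<in> J"
    have [measurable]: "X q \<in> sets borel" using X q by blast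
    have "(\<lambda>x. \<Sum>l<c q. x l) \<in> borel_measurable (PiM {..<Suc K} (\<lambda>_. borel :: 'a measure))"
      using K[OF q] by (intro borel_measurable_sum measurable_component_singleton) auto
    then show "{x \<in> space (PiM {..<Suc K} (\<lambda>_. borel :: 'a measure)). (\<Sum>l<c q. x l) \<in> X q} \<in> sets (PiM {..<Suc K} (\<lambda>_. borel))"
      by measurable
  qed
  moreover have "(\<forall>q\<in>J. p (dyad q) - p 0 \<in> X q) \<longleftrightarrow> grid_increments p n K \<in> E" for p
  proof -
    have "(\<Sum>l<c q. grid_increments p n K l) = p (dyad q) - p 0" if "q \<in> J" for q
    proof -
      have "(\<Sum>l<c q. grid_increments p n K l) = (\<Sum>l<c q. p (real (Suc l) / 2 ^ n) - p (real l / 2 ^ n))"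
        using K[OF that] by (intro sum.cong) (auto simp: grid_increments_def)
      also have "\<dots> = p (real (c q) / 2 ^ n) - p (real 0 / 2 ^ n)"
        by (rule sum_lessThan_telescope)
      finally show ?thesis using d[OF that] by simp
    qed
    moreover have "grid_increments p n K \<in> space (PiM {..<Suc K} (\<lambda>_. borel))"
      by (simp add: grid_increments_def space_PiM)
    ultimately show ?thesis by (auto simp: E_def)
  qed
  ultimately show ?thesis by blast
qed

context brownian_motion
begin

lemma distr_increment:
  assumes "0 \<le> s" "s < t"
  shows "distr M borel (\<lambda>\<omega>. W t \<omega> - W s \<omega>) = gauss (t - s)"
proof -
  have "distr M borel (\<lambda>\<omega>. W t \<omega> - W s \<omega>) = distr M lborel (\<lambda>\<omega>. W t \<omega> - W s \<omega>)"
    by (rule distr_cong) auto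
  then show ?thesis
    using gaussian_increments[OF assms] by (simp add: distributed_def gauss_def)
qed

lemma measurable_increment:
  assumes "0 \<le> s" "0 \<le> t"
  shows "random_variable borel (\<lambda>\<omega>. W t \<omega> - W s \<omega>)"
  using measurable assms by (intro borel_measurable_diff)

lemma measurable_grid_increments:
  assumes t: "0 \<le> t"
  shows "random_variable (PiM {..<Suc K} (\<lambda>_. borel)) (\<lambda>\<omega>. grid_increments (\<lambda>s. W (t + s) \<omega>) n K)"
  unfolding grid_increments_def using t by (intro measurable_restrict measurable_increment) auto

lemma distr_grid_increments:
  assumes t: "0 \<le> t"
  shows "distr M (PiM {..<Suc K} (\<lambda>_. borel)) (\<lambda>\<omega>. grid_increments (\<lambda>s. W (t + s) \<omega>) n K) = PiM {..<Suc K} (\<lambda>_. gauss (1 / 2 ^ n))"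
proof -
  let ?t = "\<lambda>l::nat. t + real l / 2 ^ n"
  let ?X = "\<lambda>l \<omega>. W (?t (Suc l)) \<omega> - W (?t l) \<omega>"
  have "indep_vars (\<lambda>_. borel) ?X {..<Suc K}"
    using t by (intro independent_increments) (auto simp: divide_strict_right_mono)
  then have "distr M (PiM {..<Suc K} (\<lambda>_. borel)) (\<lambda>\<omega>. \<lambda>l\<in>{..<Suc K}. ?X l \<omega>) = PiM {..<Suc K} (\<lambda>l. distr M borel (?X l))"
    using t by (subst (asm) indep_vars_iff_distr_eq_PiM') (auto intro!: measurable_increment)
  also have "\<dots> = PiM {..<Suc K} (\<lambda>_. gauss (1 / 2 ^ n))"
  proof (rule PiM_cong)
    fix l
    have "?t (Suc l) - ?t l = 1 / 2 ^ n" by (simp add: field_simps)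
    then show "distr M borel (?X l) = gauss (1 / 2 ^ n)"
      using distr_increment[of "?t l" "?t (Suc l)"] t by (simp add: divide_strict_right_mono)
  qed simp
  finally show ?thesis by (simp add: grid_increments_def)
qed

lemma grid_increments_indep_past:
  assumes t: "0 < t" and [measurable]: "A \<in> sets borel" and E: "E \<in> sets (PiM {..<Suc K} (\<lambda>_. borel))"
  shows "emeasure M {\<omega>\<in>space M. W t \<omega> - W 0 \<omega> \<in> A \<and> grid_increments (\<lambda>s. W (t + s) \<omega>) n K \<in> E}
    = emeasure (gauss t) A * emeasure (PiM {..<Suc K} (\<lambda>_. gauss (1 / 2 ^ n))) E"
proof -
  \<comment> \<open>The times \<open>0\<close>, \<open>t\<close>, \<open>t + 1 / 2 ^ n\<close> and
    so on: increment number 0 is the displacement up to \<open>t\<close>, all others form the grid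
    after \<open>t\<close>.\<close>
  define T where "T l = (case l of 0 \<Rightarrow> 0 | Suc l \<Rightarrow> t + real l / 2 ^ n)" for l :: nat
  let ?X = "\<lambda>l \<omega>. W (T (Suc l)) \<omega> - W (T l) \<omega>"
  let ?P = "PiM {..<Suc K} (\<lambda>_. borel :: 'a measure)"
  have ind: "indep_vars (\<lambda>_. borel) ?X {..<Suc (Suc K)}"
    using t by (intro independent_increments) (auto simp: T_def divide_strict_right_mono split: nat.split)
  let ?g = "\<lambda>x. \<lambda>l\<in>{..<Suc K}. x (Suc l) :: 'a"
  define A' where "A' = {x \<in> space (PiM {0::nat} (\<lambda>_. borel)). x 0 \<in> A}"
  have A': "A' \<in> sets (PiM {0} (\<lambda>_. borel))"
    unfolding A'_def by measurable
  have "indep_var (PiM {0} (\<lambda>_. borel)) ((\<lambda>x. x) \<circ> (\<lambda>\<omega>. \<lambda>l\<in>{0}. ?X l \<omega>)) ?P (?g \<circ> (\<lambda>\<omega>. \<lambda>l\<in>{1..Suc K}. ?X l \<omega>))"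
    by (rule indep_var_compose[OF indep_var_restrict[OF ind]])
      (auto intro!: measurable_restrict measurable_component_singleton)
  moreover have "?g \<circ> (\<lambda>\<omega>. \<lambda>l\<in>{1..Suc K}. ?X l \<omega>) = (\<lambda>\<omega>. grid_increments (\<lambda>s. W (t + s) \<omega>) n K)"
    by (auto simp: T_def grid_increments_def fun_eq_iff)
  ultimately have "indep_var (PiM {0} (\<lambda>_. borel)) ((\<lambda>x. x) \<circ> (\<lambda>\<omega>. \<lambda>l\<in>{0}. ?X l \<omega>)) ?P (\<lambda>\<omega>. grid_increments (\<lambda>s. W (t + s) \<omega>) n K)"
    by simp
  from indep_varD[OF this A' E]
  have "prob {\<omega>\<in>space M. W t \<omega> - W 0 \<omega> \<in> A \<and> grid_increments (\<lambda>s. W (t + s) \<omega>) n K \<in> E} =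
    prob ((\<lambda>\<omega>. W t \<omega> - W 0 \<omega>) -` A \<inter> space M) * prob ((\<lambda>\<omega>. grid_increments (\<lambda>s. W (t + s) \<omega>) n K) -` E \<inter> space M)"
    by (simp add: A'_def T_def space_PiM vimage_def Int_def conj_commute)
  moreover have "ennreal (prob ((\<lambda>\<omega>. W t \<omega> - W 0 \<omega>) -` A \<inter> space M)) = emeasure (gauss t) A"
    unfolding emeasure_eq_measure[symmetric] distr_increment[OF order.refl t, unfolded diff_zero, symmetric]
    using t by (intro emeasure_distr[symmetric] measurable_increment) auto
  moreover have "ennreal (prob ((\<lambda>\<omega>. grid_increments (\<lambda>s. W (t + s) \<omega>) n K) -` E \<inter> space M)) = emeasure (PiM {..<Suc K} (\<lambda>_. gauss (1 / 2 ^ n))) E"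
    unfolding emeasure_eq_measure[symmetric] distr_grid_increments[OF less_imp_le[OF t], symmetric]
    by (rule emeasure_distr[symmetric, OF measurable_grid_increments[OF less_imp_le[OF t]] E])
  ultimately show ?thesis
    by (simp add: emeasure_eq_measure ennreal_mult)
qed

definition increments_from :: "real \<Rightarrow> 'w \<Rightarrow> nat \<times> nat \<Rightarrow> 'a" where
  "increments_from t \<omega> = sample (\<lambda>s. W (t + s) \<omega> - W t \<omega>)"

lemma measurable_increments_from:
  assumes "0 \<le> t"
  shows "random_variable path_space (increments_from t)"
  unfolding increments_from_def[abs_def] using assms by (intro measurable_sample measurable_increment) auto

text \<open>The law of the path relative to its starting point; the law from any other point is
  obtained by translation.\<close>

definition path_law :: "(nat \<times> nat \<Rightarrow> 'a) measure" where
  "path_law = distr M path_space (increments_from 0)"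

lemma prob_space_path_law: "prob_space path_law"
  unfolding path_law_def by (intro prob_space_distr measurable_increments_from) simp

lemma sets_path_law [simp, measurable_cong]: "sets path_law = sets path_space"
  by (simp add: path_law_def)

lemma space_path_law [simp]: "space path_law = UNIV"
  by (simp add: path_law_def)

end

section \<open>Uniqueness of the path law and the Markov property\<close>

lemma path_law_box:
  assumes "brownian_motion M W z" and E: "E \<in> sets (PiM {..<Suc K} (\<lambda>_. borel))"
    and eq: "\<forall>p. (\<forall>q\<in>J. p (dyad q) - p 0 \<in> X q) \<longleftrightarrow> grid_increments p n K \<in> E" 
    and J: "finite J" and X: "\<forall>q\<in>J. X q \<in> sets borel"
  shows "emeasure (brownian_motion.path_law M W) (prod_emb UNIV (\<lambda>_. borel) J (PiE J X)) = emeasure (PiM {..<Suc K} (\<lambda>_. gauss (1 / 2 ^ n))) E"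
proof -
  interpret brownian_motion M W z by fact
  have "prod_emb UNIV (\<lambda>_. borel) J (PiE J X) \<in> sets path_space"
    using J X by (intro sets_PiM_I) auto
  then have "emeasure path_law (prod_emb UNIV (\<lambda>_. borel) J (PiE J X)) = emeasure M (increments_from 0 -` prod_emb UNIV (\<lambda>_. borel) J (PiE J X) \<inter> space M)"
    unfolding path_law_def by (intro emeasure_distr measurable_increments_from) auto
  also have "increments_from 0 -` prod_emb UNIV (\<lambda>_. borel) J (PiE J X) \<inter> space M = (\<lambda>\<omega>. grid_increments (\<lambda>s. W (0 + s) \<omega>) n K) -` E \<inter> space M"
    unfolding vimage_def eq[THEN spec, symmetric] by (auto simp: prod_emb_def increments_from_def sample_def PiE_iff restrict_def extensional_def)
  also have "emeasure M \<dots> = emeasure (PiM {..<Suc K} (\<lambda>_. gauss (1 / 2 ^ n))) E"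
    unfolding distr_grid_increments[OF order.refl, symmetric]
    by (rule emeasure_distr[symmetric, OF measurable_grid_increments[OF order.refl] E])
  finally show ?thesis .
qed

text \<open>This links the laws \<open>P y\<close> for different \<open>y\<close>. Boxes over
  finitely many dyadic times determine a measure on path space, and their probabilities depend only
  on Gaussian grid increments.\<close>

theorem path_law_unique:
  fixes W :: "real \<Rightarrow> 'w \<Rightarrow> 'a::euclidean_space"
  assumes W: "brownian_motion M W z" and B: "brownian_motion N B z'"
  shows "brownian_motion.path_law M W = brownian_motion.path_law N B"
proof -
  interpret W: brownian_motion M W z by fact
  interpret B: brownian_motion N B z' by fact
  interpret L: prob_space W.path_law by (rule W.prob_space_path_law)
  show ?thesis
  proof (rule measure_eqI_PiM_infinite)
    fix X :: "nat \<times> nat \<Rightarrow> 'a set" and J :: "(nat \<times> nat) set"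
    assume J: "finite J" and "\<And>q. q \<in> J \<Longrightarrow> X q \<in> sets borel"
    then have X: "\<forall>q\<in>J. X q \<in> sets borel" by blast
    from sample_box_eq_grid_event[where X = X, OF J X] obtain n K E where
      E1: "E \<in> sets (PiM {..<Suc K} (\<lambda>_. borel))" and "\<forall>p. (\<forall>q\<in>J. p (dyad q) - p 0 \<in> X q) \<longleftrightarrow> grid_increments p n K \<in> E"
      by (elim exE bexE) (rule that)
    note E = E1 this(2)
    show "emeasure W.path_law (prod_emb UNIV (\<lambda>_. borel) J (PiE J X)) = emeasure B.path_law (prod_emb UNIV (\<lambda>_. borel) J (PiE J X))"
      unfolding path_law_box[where X = X, OF W E J X] path_law_box[where X = X, OF B E J X] ..
  qed (auto simp: L.finite_measure_axioms)
qed

text \<open>Rectangles determine a product measure. For a fixed first side \<open>A\<close>, the law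
  of \<open>Y\<close> on the event that \<open>X\<close> lies in \<open>A\<close> and the multiple
  of \<open>L\<close> by the mass of \<open>A\<close> are finite measures on path space, so boxes
  are enough on the second side.\<close>

lemma (in prob_space) distr_pair_path_eqI:
  fixes X :: "'a \<Rightarrow> 'b::euclidean_space" and Y :: "'a \<Rightarrow> nat \<times> nat \<Rightarrow> 'b"
  assumes X [measurable]: "random_variable borel X" and Y [measurable]: "random_variable path_space Y"
    and K: "prob_space K" "sets K = sets borel" and L: "prob_space L" "sets L = sets path_space"
    and box: "\<And>A J B. A \<in> sets borel \<Longrightarrow> finite J \<Longrightarrow> \<forall>q\<in>J. B q \<in> sets borel \<Longrightarrow>
      emeasure M {\<omega>\<in>space M. X \<omega> \<in> A \<and> Y \<omega> \<in> prod_emb UNIV (\<lambda>_. borel) J (PiE J B)} =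
      emeasure K A * emeasure L (prod_emb UNIV (\<lambda>_. borel) J (PiE J B))"
  shows "distr M (borel \<Otimes>\<^sub>M path_space) (\<lambda>\<omega>. (X \<omega>, Y \<omega>)) = K \<Otimes>\<^sub>M L"
proof (rule sym, rule pair_measure_eqI)
  interpret K: prob_space K by fact
  interpret L: prob_space L by fact
  show "sigma_finite_measure K" "sigma_finite_measure L" ..
  show "sets (K \<Otimes>\<^sub>M L) = sets (distr M (borel \<Otimes>\<^sub>M path_space) (\<lambda>\<omega>. (X \<omega>, Y \<omega>)))"
    using sets_pair_measure_cong[OF K(2) L(2)] by simp
  fix A B assume "A \<in> sets K" "B \<in> sets L"
  then have A [measurable]: "A \<in> sets borel" and B: "B \<in> sets path_space" using K L by auto
  define Q where "Q = {\<omega>\<in>space M. X \<omega> \<in> A}"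
  have [measurable]: "Q \<in> sets M" unfolding Q_def by measurable
  have dens: "emeasure (distr (density M (indicator Q)) path_space Y) C = emeasure M {\<omega>\<in>space M. X \<omega> \<in> A \<and> Y \<omega> \<in> C}"
    if [measurable]: "C \<in> sets path_space" for C
  proof -
    have "emeasure (distr (density M (indicator Q)) path_space Y) C = (\<integral>\<^sup>+\<omega>. indicator Q \<omega> * indicator (Y -` C \<inter> space M) \<omega> \<partial>M)"
      by (subst emeasure_distr) (auto simp: emeasure_density)
    also have "\<dots> = (\<integral>\<^sup>+\<omega>. indicator {\<omega>\<in>space M. X \<omega> \<in> A \<and> Y \<omega> \<in> C} \<omega> \<partial>M)"
      by (intro nn_integral_cong) (auto simp: Q_def split: split_indicator)
    finally show ?thesis by simp
  qed
  have "distr (density M (indicator Q)) path_space Y = scale_measure (emeasure K A) L"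
  proof (rule measure_eqI_PiM_infinite)
    show "finite_measure (distr (density M (indicator Q)) path_space Y)"
    proof
      have "UNIV \<in> sets (path_space :: (nat \<times> nat \<Rightarrow> 'b) measure)"
        using sets.top[of "path_space :: (nat \<times> nat \<Rightarrow> 'b) measure"] by simp
      from dens[OF this] show "emeasure (distr (density M (indicator Q)) path_space Y) (space (distr (density M (indicator Q)) path_space Y)) \<noteq> \<infinity>"
        by (simp add: emeasure_eq_measure)
    qed
    fix B :: "nat \<times> nat \<Rightarrow> 'b set" and J :: "(nat \<times> nat) set"
    assume J: "finite J" and "\<And>q. q \<in> J \<Longrightarrow> B q \<in> sets borel"
    then have B: "\<forall>q\<in>J. B q \<in> sets borel" by blast
    then have "prod_emb UNIV (\<lambda>_. borel) J (PiE J B) \<in> sets path_space" using J by (intro sets_PiM_I) auto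
    then show "emeasure (distr (density M (indicator Q)) path_space Y) (prod_emb UNIV (\<lambda>_. borel) J (PiE J B)) =
        emeasure (scale_measure (emeasure K A) L) (prod_emb UNIV (\<lambda>_. borel) J (PiE J B))"
      unfolding emeasure_scale_measure box[OF A J B, symmetric] by (rule dens)
  qed (use L in auto)
  then have "emeasure K A * emeasure L B = emeasure (distr (density M (indicator Q)) path_space Y) B"
    by simp
  also have "\<dots> = emeasure (distr M (borel \<Otimes>\<^sub>M path_space) (\<lambda>\<omega>. (X \<omega>, Y \<omega>))) (A \<times> B)"
    using B by (subst dens, simp, subst emeasure_distr) (auto intro!: arg_cong[where f = "emeasure M"])
  finally show "emeasure K A * emeasure L B = emeasure (distr M (borel \<Otimes>\<^sub>M path_space) (\<lambda>\<omega>. (X \<omega>, Y \<omega>))) (A \<times> B)" .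
qed

text \<open>Only the displacement up to \<open>t\<close>, not the whole past, is shown independent
  of the future: this suffices for functionals of the path after time \<open>t\<close>.\<close>

theorem (in brownian_motion) markov_law:
  assumes t: "0 < t"
  shows "distr M (borel \<Otimes>\<^sub>M path_space) (\<lambda>\<omega>. (W t \<omega> - W 0 \<omega>, increments_from t \<omega>)) = gauss t \<Otimes>\<^sub>M path_law"
proof (rule distr_pair_path_eqI)
  show "random_variable borel (\<lambda>\<omega>. W t \<omega> - W 0 \<omega>)" "random_variable path_space (increments_from t)"
    using t by (auto intro: measurable_increment measurable_increments_from)
  show "prob_space (gauss t :: 'a measure)" using t by (rule prob_space_gauss)
  show "prob_space path_law" by (rule prob_space_path_law)
  fix A :: "'a set" and X :: "nat \<times> nat \<Rightarrow> 'a set" and J :: "(nat \<times> nat) set"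
  assume A: "A \<in> sets borel" and J: "finite J" and X: "\<forall>q\<in>J. X q \<in> sets borel"
  from sample_box_eq_grid_event[where X = X, OF J X] obtain n K E where
    E1: "E \<in> sets (PiM {..<Suc K} (\<lambda>_. borel))" and "\<forall>p. (\<forall>q\<in>J. p (dyad q) - p 0 \<in> X q) \<longleftrightarrow> grid_increments p n K \<in> E"
    by (elim exE bexE) (rule that)
  note E = E1 this(2)
  have "increments_from t \<omega> \<in> prod_emb UNIV (\<lambda>_. borel) J (PiE J X) \<longleftrightarrow> grid_increments (\<lambda>s. W (t + s) \<omega>) n K \<in> E" for \<omega>
    unfolding E(2)[THEN spec, symmetric] by (auto simp: prod_emb_def increments_from_def sample_def PiE_iff restrict_def extensional_def)
  then show "emeasure M {\<omega>\<in>space M. W t \<omega> - W 0 \<omega> \<in> A \<and> increments_from t \<omega> \<in> prod_emb UNIV (\<lambda>_. borel) J (PiE J X)} =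
      emeasure (gauss t) A * emeasure path_law (prod_emb UNIV (\<lambda>_. borel) J (PiE J X))"
    using grid_increments_indep_past[OF t A E1] path_law_box[where X = X, OF brownian_motion_axioms E J X] by simp
qed simp_all

section \<open>Expectations of path functionals\<close>

lemma measurable_translate_path [measurable]:
  "(\<lambda>x q. fst x + snd x q) \<in> measurable ((borel :: 'a::euclidean_space measure) \<Otimes>\<^sub>M path_space) path_space"
  by (rule measurable_PiM_single') auto

lemma measurable_translate_path':
  "(\<lambda>y q. (z :: 'a::euclidean_space) + y q) \<in> measurable path_space path_space"
  by (rule measurable_PiM_single') auto

lemma abs_integral_le:
  fixes f g :: "'b \<Rightarrow> real"
  assumes "integrable M f" "integrable M g" "\<And>x. x \<in> space M \<Longrightarrow> \<bar>f x\<bar> \<le> g x"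
  shows "\<bar>\<integral>x. f x \<partial>M\<bar> \<le> (\<integral>x. g x \<partial>M)"
  using assms by (intro order.trans[OF integral_abs_bound] integral_mono) auto

context brownian_motion
begin

text \<open>The expectation from an arbitrary starting point under one fixed law, by translation of
  the path. Dependence on the starting point becomes measurable and can be fed to
  \<open>heat\<close>.\<close>

definition mean_from :: "((nat \<times> nat \<Rightarrow> 'a) \<Rightarrow> real) \<Rightarrow> 'a \<Rightarrow> real" where
  "mean_from F z' = (\<integral>y. F (\<lambda>q. z' + y q) \<partial>path_law)"

lemma continuous_increments:
  assumes "\<omega> \<in> space M" and "0 \<le> t"
  shows "continuous_on {0..} (\<lambda>s. z' + (W (t + s) \<omega> - W 0 \<omega>))"
  using assms by (intro continuous_intros continuous_on_compose2[OF continuous_paths]) auto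

context
  fixes F :: "(nat \<times> nat \<Rightarrow> 'a) \<Rightarrow> real" and m :: real
  assumes F [measurable]: "F \<in> borel_measurable path_space" and F_le: "\<And>y. \<bar>F y\<bar> \<le> m"
begin

lemma measurable_translate_comp [measurable]: "(\<lambda>y. F (\<lambda>q. z' + y q)) \<in> borel_measurable path_space"
  using measurable_compose[OF measurable_translate_path' F] .

lemma measurable_mean_from [measurable]: "mean_from F \<in> borel_measurable borel"
proof -
  interpret L: prob_space path_law by (rule prob_space_path_law)
  have "(\<lambda>x. F (\<lambda>q. fst x + snd x q)) \<in> borel_measurable (borel \<Otimes>\<^sub>M path_space)"
    using measurable_compose[OF measurable_translate_path F] .
  then show ?thesis
    unfolding mean_from_def[abs_def]
    by (intro L.borel_measurable_lebesgue_integral) (simp add: case_prod_beta' cong: measurable_cong_sets sets_pair_measure_cong)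
qed

lemma abs_mean_from_le: "\<bar>mean_from F z'\<bar> \<le> m"
proof -
  interpret L: prob_space path_law by (rule prob_space_path_law)
  have i: "integrable path_law (\<lambda>y. F (\<lambda>q. z' + y q))"
    by (rule L.integrable_const_bound[where B = m]) (auto simp: F_le)
  have "\<bar>mean_from F z'\<bar> \<le> (\<integral>y. m \<partial>path_law)"
    unfolding mean_from_def using i F_le by (intro abs_integral_le) auto
  then show ?thesis using L.prob_space by simp
qed

lemma mean_from_eq: "mean_from F z' = (\<integral>\<omega>. F (sample (\<lambda>s. z' + (W s \<omega> - W 0 \<omega>))) \<partial>M)"
  unfolding mean_from_def path_law_def
  by (subst integral_distr) (auto intro!: measurable_increments_from simp: increments_from_def sample_def[abs_def])

text \<open>The path after time \<open>t\<close> starts from the displaced point, whose displacement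
  has law \<open>gauss t\<close>, and continues with fresh increments.\<close>

lemma mean_from_markov:
  assumes t: "0 < t"
  shows "(\<integral>\<omega>. F (sample (\<lambda>s. z' + (W (t + s) \<omega> - W 0 \<omega>))) \<partial>M) = heat t (mean_from F) z'"
proof -
  interpret G: prob_space "gauss t :: 'a measure" using t by (rule prob_space_gauss)
  interpret L: prob_space path_law by (rule prob_space_path_law)
  interpret P: pair_prob_space "gauss t :: 'a measure" path_law ..
  let ?F = "\<lambda>x. F (\<lambda>q. (z' + fst x) + snd x q)"
  have "(\<lambda>x. (z' + fst x, snd x)) \<in> measurable (borel \<Otimes>\<^sub>M path_space) (borel \<Otimes>\<^sub>M (path_space :: (nat \<times> nat \<Rightarrow> 'a) measure))"
    by measurable
  from measurable_compose[OF measurable_compose[OF this measurable_translate_path] F]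
  have m: "?F \<in> borel_measurable (borel \<Otimes>\<^sub>M path_space)" by simp
  have mW: "random_variable (borel \<Otimes>\<^sub>M path_space) (\<lambda>\<omega>. (W t \<omega> - W 0 \<omega>, increments_from t \<omega>))"
    using t by (intro measurable_Pair measurable_increment measurable_increments_from) auto
  have "(\<integral>\<omega>. F (sample (\<lambda>s. z' + (W (t + s) \<omega> - W 0 \<omega>))) \<partial>M) = (\<integral>\<omega>. ?F (W t \<omega> - W 0 \<omega>, increments_from t \<omega>) \<partial>M)"
    by (intro Bochner_Integration.integral_cong refl arg_cong[where f = F]) (auto simp: increments_from_def sample_def)
  also have "\<dots> = (\<integral>x. ?F x \<partial>distr M (borel \<Otimes>\<^sub>M path_space) (\<lambda>\<omega>. (W t \<omega> - W 0 \<omega>, increments_from t \<omega>)))"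
    using m by (intro integral_distr[symmetric] mW)
  also have "\<dots> = (\<integral>x. ?F x \<partial>(gauss t \<Otimes>\<^sub>M path_law))"
    unfolding markov_law[OF t] ..
  also have "\<dots> = (\<integral>v. \<integral>y. ?F (v, y) \<partial>path_law \<partial>gauss t)"
    using m by (intro P.integral_fst'[symmetric] P.integrable_const_bound[where B = m])
      (auto simp: F_le cong: measurable_cong_sets sets_pair_measure_cong)
  also have "\<dots> = heat t (mean_from F) z'"
    by (simp add: heat_def mean_from_def)
  finally show ?thesis .
qed

end

text \<open>The starting point is prescribed only almost surely; recentring the path changes it on a
  null set, after which \<open>path_law_unique\<close> applies.\<close>

lemma expectation_path_functional:
  assumes B: "brownian_motion N B z'" and F [measurable]: "F \<in> borel_measurable path_space"
  shows "(\<integral>\<omega>. F (sample (\<lambda>s. B s \<omega>)) \<partial>N) = mean_from F z'"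
proof -
  interpret B: brownian_motion N B z' by fact
  have "(\<integral>\<omega>. F (sample (\<lambda>s. B s \<omega>)) \<partial>N) = (\<integral>\<omega>. F (sample (\<lambda>s. z' + (B s \<omega> - B 0 \<omega>))) \<partial>N)"
  proof (rule integral_cong_AE)
    show "(\<lambda>\<omega>. F (sample (\<lambda>s. B s \<omega>))) \<in> borel_measurable N"
      by (rule measurable_compose[OF _ F]) (intro measurable_sample B.measurable)
    show "(\<lambda>\<omega>. F (sample (\<lambda>s. z' + (B s \<omega> - B 0 \<omega>)))) \<in> borel_measurable N"
      by (rule measurable_compose[OF _ F]) (intro measurable_sample borel_measurable_add borel_measurable_const B.measurable_increment, auto)
    show "AE \<omega> in N. F (sample (\<lambda>s. B s \<omega>)) = F (sample (\<lambda>s. z' + (B s \<omega> - B 0 \<omega>)))"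
      using B.start by eventually_elim simp
  qed
  also have "\<dots> = B.mean_from F z'"
    unfolding B.mean_from_def B.path_law_def
    by (subst integral_distr)
      (auto intro!: B.measurable_increments_from measurable_compose[OF measurable_translate_path' F] simp: B.increments_from_def sample_def[abs_def])
  also have "\<dots> = mean_from F z'"
    unfolding B.mean_from_def mean_from_def path_law_unique[OF B brownian_motion_axioms] ..
  finally show ?thesis .
qed

end

section \<open>Maximal inequality\<close>

text \<open>A grid point with even index already occurs one level up, and one with odd index is a
  single step away from such a point: each level costs at most one step.\<close>

lemma dyadic_chain:
  fixes p :: "real \<Rightarrow> 'a::real_normed_vector"
  assumes c: "\<And>l. 0 \<le> c l" and step: "\<And>l k. k < 2 ^ l \<Longrightarrow> norm (p (real (Suc k) * t / 2 ^ l) - p (real k * t / 2 ^ l)) \<le> c l"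
  shows "j \<le> 2 ^ n \<Longrightarrow> norm (p (real j * t / 2 ^ n) - p 0) \<le> (\<Sum>l\<le>n. c l)"
proof (induction n arbitrary: j)
  case 0
  then consider "j = 0" | "j = 1" by force
  then show ?case using step[of 0 0] c[of 0] by cases auto
next
  case (Suc n)
  define i where "i = j div 2"
  have half: "p (real (2 * i) * t / 2 ^ Suc n) = p (real i * t / 2 ^ n)" by simp
  have i: "i \<le> 2 ^ n" using Suc.prems by (simp add: i_def)
  show ?case
  proof (cases "even j")
    case True
    then have "j = 2 * i" by (simp add: i_def)
    then show ?thesis using Suc.IH[OF i] half c[of "Suc n"] by simp
  next
    case False
    then have j: "j = Suc (2 * i)" by (simp add: i_def)
    have "norm (p (real j * t / 2 ^ Suc n) - p (real (2 * i) * t / 2 ^ Suc n)) \<le> c (Suc n)"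
      using Suc.prems unfolding j by (intro step) simp
    moreover have "norm (p (real j * t / 2 ^ Suc n) - p 0) \<le> norm (p (real j * t / 2 ^ Suc n) - p (real (2 * i) * t / 2 ^ Suc n)) + norm (p (real (2 * i) * t / 2 ^ Suc n) - p 0)"
      using norm_triangle_ineq[of "p (real j * t / 2 ^ Suc n) - p (real (2 * i) * t / 2 ^ Suc n)" "p (real (2 * i) * t / 2 ^ Suc n) - p 0"] by simp
    ultimately show ?thesis using Suc.IH[OF i] unfolding half by simp
  qed
qed

lemma norm_le_of_dyadic_chain:
  fixes p :: "real \<Rightarrow> 'a::real_normed_vector"
  assumes p: "continuous_on {0..} p" and t: "0 < t" and s: "s \<in> {0..t}"
    and c: "\<And>l. 0 \<le> c l" and step: "\<And>l k. k < 2 ^ l \<Longrightarrow> norm (p (real (Suc k) * t / 2 ^ l) - p (real k * t / 2 ^ l)) \<le> c l"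
    and C: "\<And>n. (\<Sum>l\<le>n. c l) \<le> C"
  shows "norm (p s - p 0) \<le> C"
proof -
  have s': "0 \<le> s / t" "s / t \<le> 1" using s t by auto
  define j where "j n = nat \<lceil>s / t * 2 ^ n\<rceil>" for n
  have d: "dyad (dyad_up (s / t) n) = real (j n) / 2 ^ n" for n
    by (simp add: dyad_def dyad_up_def j_def)
  have j: "j n \<le> 2 ^ n" for n
  proof -
    have "\<lceil>s / t * 2 ^ n\<rceil> \<le> \<lceil>(2 ^ n :: real)\<rceil>" using s' by (intro ceiling_mono mult_left_le_one_le) auto
    also have "\<dots> = 2 ^ n" using ceiling_of_int[of "2 ^ n"] by simp
    finally show ?thesis by (simp add: j_def nat_le_iff)
  qed
  have "(\<lambda>n. dyad (dyad_up (s / t) n) * t) \<longlonglongrightarrow> s / t * t"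
    by (intro tendsto_intros dyad_up(3) s')
  then have "(\<lambda>n. real (j n) * t / 2 ^ n) \<longlonglongrightarrow> s" using t by (simp add: d)
  then have "(\<lambda>n. p (real (j n) * t / 2 ^ n)) \<longlonglongrightarrow> p s"
    using s t by (intro continuous_on_tendsto_compose[OF p]) auto
  then have "(\<lambda>n. norm (p (real (j n) * t / 2 ^ n) - p 0)) \<longlonglongrightarrow> norm (p s - p 0)"
    by (intro tendsto_intros)
  then show ?thesis
    by (rule LIMSEQ_le_const2) (use dyadic_chain[of c p t, OF c step j] C in \<open>auto intro: order.trans\<close>)
qed

text \<open>Chaining along the dyadic times: a union bound and fourth moments suffice. Since the
  measurability of the supremum is not at hand, the exceptional event is bounded from outside.\<close>

lemma (in brownian_motion) maximal_inequality:
  fixes r :: real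
  assumes r: "0 < r"
  shows "\<exists>C\<ge>0. \<forall>t>0. \<exists>A\<in>events. prob A \<le> C * t\<^sup>2 \<and> (\<forall>\<omega>\<in>space M - A. \<forall>s\<in>{0..t}. norm (W s \<omega> - W 0 \<omega>) < r)"
proof -
  \<comment> \<open>The thresholds \<open>c l\<close> must sum, so \<open>q < 1\<close>. At level
    \<open>l\<close> there are \<open>2 ^ l\<close> increments, each exceeding \<open>c l\<close>
    with probability of order \<open>(t / 2 ^ l)\<^sup>2 / q ^ (4 * l)\<close>; the union bound has
    ratio \<theta>, which forces \<open>q ^ 4 > 1 / 2\<close>. With \<open>q = 9 / 10\<close> the
    factor \<open>r / 20\<close> makes the thresholds sum to at most \<open>r / 2\<close>.\<close>
  define q where "q = (9 / 10 :: real)"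
  define c where "c l = r / 20 * q ^ l" for l :: nat
  define K where "K = 3 * (real DIM('a))\<^sup>2 * (20 / r) ^ 4"
  define \<theta> where "\<theta> = 1 / (2 * q ^ 4)"
  have \<theta>: "0 \<le> \<theta>" "\<theta> < 1" by (auto simp: \<theta>_def q_def power4_eq_xxxx)
  have cpos: "0 < c l" for l using r by (simp add: c_def q_def)
  have K0: "0 \<le> K" by (simp add: K_def)
  have csum: "(\<Sum>l\<le>n. c l) \<le> r / 2" for n
  proof -
    have "(\<Sum>l\<le>n. q ^ l) \<le> (\<Sum>l. q ^ l)"
      by (intro sum_le_suminf summable_geometric) (auto simp: q_def)
    also have "\<dots> = 10" by (subst suminf_geometric) (auto simp: q_def)
    finally have "r / 20 * (\<Sum>l\<le>n. q ^ l) \<le> r / 20 * 10" using r by (intro mult_left_mono) auto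
    then show ?thesis unfolding c_def sum_distrib_left[symmetric] by simp
  qed
  have "\<exists>A\<in>events. prob A \<le> K / (1 - \<theta>) * t\<^sup>2 \<and> (\<forall>\<omega>\<in>space M - A. \<forall>s\<in>{0..t}. norm (W s \<omega> - W 0 \<omega>) < r)" if t: "0 < t" for t
  proof -
    let ?d = "\<lambda>l k \<omega>. W (real (Suc k) * t / 2 ^ l) \<omega> - W (real k * t / 2 ^ l) \<omega>"
    define B where "B l k = {\<omega>\<in>space M. c l \<le> norm (?d l k \<omega>)}" for l k
    define A where "A l = (\<Union>k<2 ^ l. B l k)" for l :: nat
    have md: "random_variable borel (?d l k)" for l k
      using t by (intro measurable_increment) auto
    have Bm: "B l k \<in> events" for l k
      unfolding B_def using md by measurable
    then have Am: "A l \<in> events" for l unfolding A_def by (intro sets.finite_UN) auto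
    have Bp: "prob (B l k) \<le> K * t\<^sup>2 * (1 / (4 * q ^ 4)) ^ l" for l k
    proof -
      have tl: "0 < t / 2 ^ l" using t by simp
      have "distr M borel (?d l k) = gauss (t / 2 ^ l)"
        using distr_increment[of "real k * t / 2 ^ l" "real (Suc k) * t / 2 ^ l"] t
        by (simp add: divide_strict_right_mono diff_divide_distrib[symmetric] algebra_simps)
      moreover have "prob (B l k) = measure (distr M borel (?d l k)) {v. c l \<le> norm v}"
        using md by (subst measure_distr) (auto simp: B_def intro!: arg_cong[where f = prob])
      ultimately have "prob (B l k) \<le> 3 * (DIM('a))\<^sup>2 * (t / 2 ^ l)\<^sup>2 / c l ^ 4"
        using gauss_tail[OF tl cpos[of l], where 'a = 'a] by simp
      also have "\<dots> = K * t\<^sup>2 * (1 / (4 * q ^ 4)) ^ l"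
      proof -
        have "(2 ^ l)\<^sup>2 = (4 :: real) ^ l" by (simp add: power2_eq_square power_mult_distrib[symmetric])
        then have 1: "(t / 2 ^ l)\<^sup>2 = t\<^sup>2 / 4 ^ l" by (simp add: power_divide)
        have 2: "c l ^ 4 = (r / 20) ^ 4 * (q ^ 4) ^ l"
          unfolding c_def power_mult_distrib by (simp only: power_mult[symmetric] mult.commute)
        show ?thesis unfolding 1 2 K_def using r by (simp add: power_divide power_mult_distrib field_simps)
      qed
      finally show ?thesis .
    qed
    have Ap: "prob (A l) \<le> K * t\<^sup>2 * \<theta> ^ l" for l
    proof -
      have "prob (A l) \<le> (\<Sum>k<2 ^ l. prob (B l k))"
        unfolding A_def using Bm by (intro finite_measure_subadditive_finite) auto
      also have "\<dots> \<le> (\<Sum>k<(2::nat) ^ l. K * t\<^sup>2 * (1 / (4 * q ^ 4)) ^ l)" by (intro sum_mono Bp)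
      also have "\<dots> = K * t\<^sup>2 * (2 * (1 / (4 * q ^ 4))) ^ l" unfolding power_mult_distrib[of 2] by simp
      finally show ?thesis by (simp add: \<theta>_def)
    qed
    have sm: "summable (\<lambda>l. K * t\<^sup>2 * \<theta> ^ l)" using \<theta> by (intro summable_mult summable_geometric) auto
    have sp: "summable (\<lambda>l. prob (A l))"
      by (rule summable_comparison_test'[OF sm]) (use Ap in auto)
    have "prob (\<Union>l. A l) \<le> (\<Sum>l. prob (A l))"
      using Am by (intro finite_measure_subadditive_countably sp) auto
    also have "\<dots> \<le> (\<Sum>l. K * t\<^sup>2 * \<theta> ^ l)" by (intro suminf_le Ap sp sm)
    also have "\<dots> = K / (1 - \<theta>) * t\<^sup>2"
      using \<theta> by (simp add: suminf_mult suminf_geometric summable_geometric)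
    finally have P: "prob (\<Union>l. A l) \<le> K / (1 - \<theta>) * t\<^sup>2" .
    have "norm (W s \<omega> - W 0 \<omega>) < r" if \<omega>: "\<omega> \<in> space M - (\<Union>l. A l)" and s: "s \<in> {0..t}" for \<omega> s
    proof -
      have "norm (?d l k \<omega>) \<le> c l" if "k < 2 ^ l" for l k
      proof (rule ccontr)
        assume "\<not> ?thesis"
        then have "\<omega> \<in> B l k" using \<omega> by (simp add: B_def)
        then show False using \<omega> that by (auto simp: A_def)
      qed
      from norm_le_of_dyadic_chain[of "\<lambda>s. W s \<omega>", OF _ t s less_imp_le[OF cpos] this csum] \<omega>
      have "norm (W s \<omega> - W 0 \<omega>) \<le> r / 2" using continuous_paths by blast
      then show ?thesis using r by simp
    qed
    then show ?thesis using P Am by (intro bexI[of _ "\<Union>l. A l"]) auto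
  qed
  moreover have "0 \<le> K / (1 - \<theta>)" using K0 \<theta> by simp
  ultimately show ?thesis by blast
qed

section \<open>Discounted exit values\<close>

lemma path_exit_nonneg: "0 \<le> path_exit D y"
  unfolding path_exit_def by (intro INF_greatest SUP_upper2[of 0] INF_greatest) auto

lemma path_exit_sample_eq:
  fixes Z :: "real \<Rightarrow> 'w \<Rightarrow> 'a::euclidean_space"
  assumes "continuous_on {0..} (\<lambda>t. Z t \<omega>)" and "open D"
  shows "path_exit D (sample (\<lambda>t. Z t \<omega>)) = exit_time Z D \<omega>"
  using path_exit_sample[OF assms] by (simp add: exit_time_def)

text \<open>An exit after time \<open>t\<close> is an exit, which gives the inequality for every
  path. Equality holds once no exit can occur up to \<open>t\<close>.\<close>

lemma path_exit_shift:
  fixes p :: "real \<Rightarrow> 'a::euclidean_space"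
  assumes p: "continuous_on {0..} p" and D: "open D" and t: "0 \<le> t"
  shows "path_exit D (sample p) \<le> ereal t + path_exit D (sample (\<lambda>s. p (t + s)))"
    and "(\<And>s. s \<in> {0..t} \<Longrightarrow> p s \<in> D) \<Longrightarrow> path_exit D (sample p) = ereal t + path_exit D (sample (\<lambda>s. p (t + s)))"
proof -
  have pt: "continuous_on {0..} (\<lambda>s. p (t + s))"
    using t by (intro continuous_on_compose2[OF p] continuous_intros) auto
  note e = path_exit_sample[OF p D] path_exit_sample[OF pt D]
  let ?S = "{s. 0 < s \<and> p (t + s) \<notin> D}"
  have add: "ereal t + (INF s\<in>?S. ereal s) = (INF s\<in>?S. ereal (t + s))"
  proof (cases "?S = {}")
    case True
    then show ?thesis unfolding True by (simp add: top_ereal_def)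
  next
    case False
    have "(INF s\<in>?S. ereal t + ereal s) = ereal t + (INF s\<in>?S. ereal s)"
      by (rule INF_ereal_add_right[OF False]) (use t in auto)
    then show ?thesis by simp
  qed
  show le: "path_exit D (sample p) \<le> ereal t + path_exit D (sample (\<lambda>s. p (t + s)))"
    unfolding e add using t by (intro INF_mono) (auto intro!: exI[of _ "t + _"] add_nonneg_pos)
  show "path_exit D (sample p) = ereal t + path_exit D (sample (\<lambda>s. p (t + s)))" if in_D: "\<And>s. s \<in> {0..t} \<Longrightarrow> p s \<in> D"
  proof (rule antisym[OF le])
    show "ereal t + path_exit D (sample (\<lambda>s. p (t + s))) \<le> path_exit D (sample p)"
      unfolding e add
    proof (rule INF_greatest)
      fix s assume s: "s \<in> {t. 0 < t \<and> p t \<notin> D}"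
      then have "t < s" using in_D[of s] by force
      then have "(INF s\<in>?S. ereal (t + s)) \<le> ereal (t + (s - t))" using s by (intro INF_lower) auto
      then show "(INF s\<in>?S. ereal (t + s)) \<le> ereal s" by simp
    qed
  qed
qed

text \<open>The value 0 for paths that never leave \<open>D\<close> is the limit of the discounted
  payoff when \<kappa> is positive and \<open>f\<close> is bounded.\<close>

definition exit_value :: "real \<Rightarrow> 'a::euclidean_space set \<Rightarrow> ('a \<Rightarrow> real) \<Rightarrow> (nat \<times> nat \<Rightarrow> 'a) \<Rightarrow> real" where
  "exit_value \<kappa> D f y = (if path_exit D y < \<infinity>
     then exp (- \<kappa> * real_of_ereal (path_exit D y)) * f (path_at y (real_of_ereal (path_exit D y))) else 0)"

lemma measurable_exit_value [measurable]:
  fixes f :: "'a::euclidean_space \<Rightarrow> real"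
  assumes [measurable]: "f \<in> borel_measurable borel"
  shows "exit_value \<kappa> D f \<in> borel_measurable path_space"
proof -
  have [measurable]: "(\<lambda>y. path_at y (real_of_ereal (path_exit D y))) \<in> borel_measurable (path_space :: (nat \<times> nat \<Rightarrow> 'a) measure)"
    by (intro measurable_path_at) measurable
  show ?thesis unfolding exit_value_def[abs_def] by measurable
qed

lemma abs_exit_value_le:
  assumes \<kappa>: "0 \<le> \<kappa>" and m: "\<And>v. \<bar>f v\<bar> \<le> m"
  shows "\<bar>exit_value \<kappa> D f y\<bar> \<le> m"
proof -
  have "0 \<le> real_of_ereal (path_exit D y)" using path_exit_nonneg by (rule real_of_ereal_pos)
  then have "exp (- \<kappa> * real_of_ereal (path_exit D y)) \<le> 1" using \<kappa> by simp
  then have "\<bar>exp (- \<kappa> * real_of_ereal (path_exit D y)) * f v\<bar> \<le> 1 * m" for v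
    unfolding abs_mult using m by (intro mult_mono) auto
  moreover have "0 \<le> m" using m[of undefined] by linarith
  ultimately show ?thesis by (simp add: exit_value_def)
qed

lemma exit_value_sample:
  assumes p: "continuous_on {0..} p" and e: "path_exit D (sample p) = ereal \<tau>"
  shows "exit_value \<kappa> D f (sample p) = exp (- \<kappa> * \<tau>) * f (p \<tau>)"
proof -
  have "0 \<le> \<tau>" using path_exit_nonneg[of D "sample p"] e by simp
  then show ?thesis using e path_at_sample[OF p] by (simp add: exit_value_def)
qed

lemma exit_value_shift:
  fixes p :: "real \<Rightarrow> 'a::euclidean_space"
  assumes p: "continuous_on {0..} p" and D: "open D" and t: "0 \<le> t" and in_D: "\<And>s. s \<in> {0..t} \<Longrightarrow> p s \<in> D"
  shows "exit_value \<kappa> D f (sample p) = exp (- \<kappa> * t) * exit_value \<kappa> D f (sample (\<lambda>s. p (t + s)))"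
proof -
  have pt: "continuous_on {0..} (\<lambda>s. p (t + s))"
    using t by (intro continuous_on_compose2[OF p] continuous_intros) auto
  note e = path_exit_shift(2)[OF p D t in_D]
  show ?thesis
  proof (cases "path_exit D (sample (\<lambda>s. p (t + s)))")
    case (real \<tau>)
    then have "path_exit D (sample p) = ereal (t + \<tau>)" using e by simp
    from exit_value_sample[OF p this] exit_value_sample[OF pt real] show ?thesis
      by (simp add: distrib_left exp_add[symmetric])
  next
    case PInf
    then show ?thesis using e by (simp add: exit_value_def)
  next
    case MInf
    then show ?thesis using path_exit_nonneg[of D "sample (\<lambda>s. p (t + s))"] by simp
  qed
qed

context brownian_motion
begin

lemma abs_integral_le_split:
  fixes f :: "'w \<Rightarrow> real"
  assumes f: "integrable M f" and A: "A \<in> events" and e: "0 \<le> e" "0 \<le> m"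
    and "\<And>\<omega>. \<omega> \<in> space M - A \<Longrightarrow> \<bar>f \<omega>\<bar> \<le> e" and "\<And>\<omega>. \<omega> \<in> space M \<Longrightarrow> \<bar>f \<omega>\<bar> \<le> m"
  shows "\<bar>\<integral>\<omega>. f \<omega> \<partial>M\<bar> \<le> e + m * prob A"
proof -
  have "\<bar>\<integral>\<omega>. f \<omega> \<partial>M\<bar> \<le> (\<integral>\<omega>. e + m * indicator A \<omega> \<partial>M)"
  proof (rule abs_integral_le[OF f])
    show "integrable M (\<lambda>\<omega>. e + m * indicator A \<omega>)"
      using A e by (intro integrable_const_bound[where B = "e + m"]) (auto split: split_indicator)
    fix \<omega> assume "\<omega> \<in> space M"
    then show "\<bar>f \<omega>\<bar> \<le> e + m * indicator A \<omega>"
      using assms(5,6)[of \<omega>] e by (cases "\<omega> \<in> A") auto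
  qed
  also have "\<dots> = (\<integral>\<omega>. e \<partial>M) + (\<integral>\<omega>. m * indicator A \<omega> \<partial>M)"
    using A e by (intro Bochner_Integration.integral_add integrable_const integrable_const_bound[where B = m]) (auto split: split_indicator)
  also have "\<dots> = e + m * prob A" using A prob_space by (simp add: Int_absorb1 sets.sets_into_space)
  finally show ?thesis .
qed

lemma measurable_sample_increments:
  assumes "0 \<le> t"
  shows "random_variable path_space (\<lambda>\<omega>. sample (\<lambda>s. z' + (W (t + s) \<omega> - W 0 \<omega>)))"
  using assms by (intro measurable_sample borel_measurable_add borel_measurable_const measurable_increment) auto

context
  fixes D :: "'a set" and f :: "'a \<Rightarrow> real" and m \<kappa> :: real
  assumes D: "open D" and f [measurable]: "f \<in> borel_measurable borel" and f_le: "\<And>v. \<bar>f v\<bar> \<le> m" and \<kappa>: "0 \<le> \<kappa>"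
begin

lemma exit_value_meas: "exit_value \<kappa> D f \<in> borel_measurable path_space"
  by measurable

lemma integrable_exit_value:
  assumes "0 \<le> t"
  shows "integrable M (\<lambda>\<omega>. exit_value \<kappa> D f (sample (\<lambda>s. z' + (W (t + s) \<omega> - W 0 \<omega>))))"
  using measurable_compose[OF measurable_sample_increments[OF assms] exit_value_meas]
  by (intro integrable_const_bound[where B = m]) (auto intro: abs_exit_value_le[OF \<kappa> f_le])

text \<open>A path that moves less than \<open>r / 2\<close> up to time \<open>t\<close> stays in
  \<open>D\<close>, and then its exit value is the discounted exit value of the shifted path. This
  fails only on an event of probability \<open>C * t\<^sup>2\<close>, where the difference is at
  most \<open>2 * m\<close>. Halving the radius makes the estimate uniform in
  \<open>y\<close>.\<close>

lemma heat_approximation: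
  assumes ball: "ball z0 r \<subseteq> D" and r: "0 < r"
  shows "\<exists>C\<ge>0. \<forall>y\<in>ball z0 (r / 2). \<forall>t>0.
    \<bar>mean_from (exit_value \<kappa> D f) y - exp (- \<kappa> * t) * heat t (mean_from (exit_value \<kappa> D f)) y\<bar> \<le> C * t\<^sup>2"
proof -
  obtain C where C: "0 \<le> C" and max: "\<And>t. 0 < t \<Longrightarrow> \<exists>A\<in>events. prob A \<le> C * t\<^sup>2 \<and> (\<forall>\<omega>\<in>space M - A. \<forall>s\<in>{0..t}. norm (W s \<omega> - W 0 \<omega>) < r / 2)"
    using maximal_inequality[of "r / 2"] r by auto
  have m: "0 \<le> m" using f_le[of undefined] by linarith
  let ?V = "exit_value \<kappa> D f"
  show ?thesis
  proof (intro exI[of _ "2 * m * C"] conjI ballI allI impI)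
    show "0 \<le> 2 * m * C" using m C by simp
    fix y and t :: real assume y: "y \<in> ball z0 (r / 2)" and t: "0 < t"
    obtain A where A: "A \<in> events" "prob A \<le> C * t\<^sup>2" "\<And>\<omega> s. \<omega> \<in> space M - A \<Longrightarrow> s \<in> {0..t} \<Longrightarrow> norm (W s \<omega> - W 0 \<omega>) < r / 2"
      using max[OF t] by blast
    let ?p = "\<lambda>\<omega> s. y + (W s \<omega> - W 0 \<omega>)"
    let ?g = "\<lambda>\<omega>. ?V (sample (?p \<omega>)) - exp (- \<kappa> * t) * ?V (sample (\<lambda>s. ?p \<omega> (t + s)))"
    have i: "integrable M (\<lambda>\<omega>. ?V (sample (?p \<omega>)))" "integrable M (\<lambda>\<omega>. ?V (sample (\<lambda>s. ?p \<omega> (t + s))))"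
      using integrable_exit_value[of 0 y] integrable_exit_value[of t y] t by auto
    have "(\<integral>\<omega>. ?g \<omega> \<partial>M) = mean_from ?V y - exp (- \<kappa> * t) * heat t (mean_from ?V) y"
      using i mean_from_eq[OF exit_value_meas abs_exit_value_le[OF \<kappa> f_le], of y] 
        mean_from_markov[OF exit_value_meas abs_exit_value_le[OF \<kappa> f_le] t, of y] by simp
    moreover have "\<bar>\<integral>\<omega>. ?g \<omega> \<partial>M\<bar> \<le> 0 + 2 * m * prob A"
    proof (rule abs_integral_le_split)
      show "integrable M ?g" using i by auto
      show "\<bar>?g \<omega>\<bar> \<le> 0" if \<omega>: "\<omega> \<in> space M - A" for \<omega>
      proof -
        have "?p \<omega> s \<in> D" if s: "s \<in> {0..t}" for s
        proof -
          have "dist z0 (?p \<omega> s) \<le> dist z0 y + norm (W s \<omega> - W 0 \<omega>)"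
            using dist_triangle[of z0 "?p \<omega> s" y] by (simp add: dist_norm norm_minus_commute)
          also have "\<dots> < r" using y A(3)[OF \<omega> s] by simp
          finally show ?thesis using ball by auto
        qed
        then have "?V (sample (?p \<omega>)) = exp (- \<kappa> * t) * ?V (sample (\<lambda>s. ?p \<omega> (t + s)))"
          using continuous_increments[of \<omega> 0 y] \<omega> t by (intro exit_value_shift D) auto
        then show ?thesis by simp
      qed
      show "\<bar>?g \<omega>\<bar> \<le> 2 * m" for \<omega>
      proof -
        have "\<bar>exp (- \<kappa> * t) * ?V (sample (\<lambda>s. ?p \<omega> (t + s)))\<bar> \<le> 1 * m"
          unfolding abs_mult using \<kappa> t abs_exit_value_le[OF \<kappa> f_le] by (intro mult_mono) auto
        moreover have "\<bar>?V (sample (?p \<omega>))\<bar> \<le> m" by (rule abs_exit_value_le[OF \<kappa> f_le])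
        ultimately show ?thesis by linarith
      qed
    qed (use A m in auto)
    moreover have "2 * m * prob A \<le> 2 * m * (C * t\<^sup>2)" using A(2) m by (intro mult_left_mono) auto
    ultimately show "\<bar>mean_from ?V y - exp (- \<kappa> * t) * heat t (mean_from ?V) y\<bar> \<le> 2 * m * C * t\<^sup>2"
      by simp
  qed
qed

end

theorem mean_exit_value_panharmonic:
  assumes D: "open D" and f: "f \<in> borel_measurable borel" and f_le: "\<And>v. \<bar>f v\<bar> \<le> m"
  shows "panharmonic_on \<mu> D (mean_from (exit_value (\<mu>\<^sup>2 / 2) D f))"
proof (rule panharmonic_onI_heat)
  have \<kappa>: "0 \<le> \<mu>\<^sup>2 / 2" by simp
  note V = measurable_exit_value[OF f] abs_exit_value_le[OF \<kappa> f_le]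
  show "mean_from (exit_value (\<mu>\<^sup>2 / 2) D f) \<in> borel_measurable borel"
    by (rule measurable_mean_from[OF V])
  show "\<bar>mean_from (exit_value (\<mu>\<^sup>2 / 2) D f) y\<bar> \<le> m" for y
    by (rule abs_mean_from_le[OF V])
  fix z assume "z \<in> D"
  then obtain r where r: "0 < r" "ball z r \<subseteq> D" using D open_contains_ball by blast
  from heat_approximation[OF D f f_le \<kappa> r(2,1)] obtain C where "0 \<le> C"
    "\<forall>y\<in>ball z (r / 2). \<forall>t>0. \<bar>mean_from (exit_value (\<mu>\<^sup>2 / 2) D f) y - exp (- (\<mu>\<^sup>2 / 2) * t) * heat t (mean_from (exit_value (\<mu>\<^sup>2 / 2) D f)) y\<bar> \<le> C * t\<^sup>2"
    by blast
  then show "\<exists>r>0. \<exists>C\<ge>0. \<forall>y\<in>ball z r. \<forall>j. \<bar>mean_from (exit_value (\<mu>\<^sup>2 / 2) D f) y -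
      exp (- (\<mu>\<^sup>2 / 2) * (1 / 2) ^ j) * heat ((1 / 2) ^ j) (mean_from (exit_value (\<mu>\<^sup>2 / 2) D f)) y\<bar> \<le> C * ((1 / 2) ^ j)\<^sup>2"
    using r(1) by (intro exI[of _ "r / 2"] conjI exI[of _ C]) auto
qed

section \<open>Boundary values at regular points\<close>

definition late :: "'a set \<Rightarrow> real \<Rightarrow> (nat \<times> nat \<Rightarrow> 'a) \<Rightarrow> real" where
  "late D \<eta> = indicator {y. ereal \<eta> < path_exit D y}"

lemma measurable_late [measurable]: "late D \<eta> \<in> borel_measurable path_space"
proof -
  have "{y \<in> space path_space. ereal \<eta> < path_exit D y} \<in> sets (path_space :: (nat \<times> nat \<Rightarrow> 'a) measure)" by measurable
  then have "{y. ereal \<eta> < path_exit D y} \<in> sets (path_space :: (nat \<times> nat \<Rightarrow> 'a) measure)" by simp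
  then show ?thesis unfolding late_def by measurable
qed

lemma abs_late_le: "\<bar>late D \<eta> y\<bar> \<le> 1"
  by (simp add: late_def)

text \<open>Upper semicontinuity of the probability of a late exit. Forget the path before a small
  time \<open>\<delta> k \<le> \<eta> / 2\<close>: a path exiting after \<eta> still exits after
  \<open>\<eta> / 2\<close> from then on. The latter probability is a heat image, hence continuous
  in the starting point, and at the regular point \<open>y\<close> it is small for large
  \<open>k\<close>.\<close>

lemma regular_point_late_exit:
  assumes D: "open D" and reg: "AE \<omega> in M. path_exit D (sample (\<lambda>s. y + (W s \<omega> - W 0 \<omega>))) = 0"
    and \<eta>: "0 < \<eta>" and e: "0 < e"
  shows "\<forall>\<^sub>F z in nhds y. mean_from (late D \<eta>) z < e"
proof -
  let ?p = "\<lambda>z \<omega> s. z + (W s \<omega> - W 0 \<omega>)"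
  define \<delta> where "\<delta> k = \<eta> / 2 / real (Suc k)" for k
  have \<delta>: "0 < \<delta> k" "\<delta> k \<le> \<eta> / 2" for k using \<eta> by (auto simp: \<delta>_def divide_le_eq mult_le_cancel_left1)
  have \<delta>0: "\<delta> \<longlonglongrightarrow> 0"
    unfolding \<delta>_def by (intro LIMSEQ_Suc lim_const_over_n)
  note late = measurable_late[of D "\<eta> / 2"] abs_late_le[of D "\<eta> / 2"]
  have "(\<lambda>k. \<integral>\<omega>. late D (\<eta> / 2) (sample (\<lambda>s. y + (W (\<delta> k + s) \<omega> - W 0 \<omega>))) \<partial>M) \<longlonglongrightarrow> (\<integral>\<omega>. 0 \<partial>M)"
  proof (rule integral_dominated_convergence[where w = "\<lambda>_. 1"])
    show "random_variable borel (\<lambda>\<omega>. late D (\<eta> / 2) (sample (\<lambda>s. y + (W (\<delta> k + s) \<omega> - W 0 \<omega>))))" for k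
      using \<delta>[of k] by (intro measurable_compose[OF measurable_sample_increments late(1)]) auto
    show "AE \<omega> in M. (\<lambda>k. late D (\<eta> / 2) (sample (\<lambda>s. y + (W (\<delta> k + s) \<omega> - W 0 \<omega>)))) \<longlonglongrightarrow> 0"
      using reg AE_space
    proof eventually_elim
      case (elim \<omega>)
      have c: "continuous_on {0..} (?p y \<omega>)" using continuous_increments[of \<omega> 0 y] elim(2) by simp
      have "(INF t\<in>{t. 0 < t \<and> ?p y \<omega> t \<notin> D}. ereal t) < ereal (\<eta> / 2)"
        using elim(1) \<eta> unfolding path_exit_sample[OF c D] by simp
      then obtain s where s: "0 < s" "?p y \<omega> s \<notin> D" "s < \<eta> / 2" unfolding INF_less_iff by auto
      have "\<forall>\<^sub>F k in sequentially. \<delta> k < s" using s by (intro order_tendstoD[OF \<delta>0]) auto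
      then have "\<forall>\<^sub>F k in sequentially. late D (\<eta> / 2) (sample (\<lambda>s. y + (W (\<delta> k + s) \<omega> - W 0 \<omega>))) = 0"
      proof eventually_elim
        case (elim k)
        have ck: "continuous_on {0..} (\<lambda>s. ?p y \<omega> (\<delta> k + s))"
          using \<delta>(1)[of k] by (intro continuous_on_compose2[OF c] continuous_intros) auto
        have "path_exit D (sample (\<lambda>s. ?p y \<omega> (\<delta> k + s))) \<le> ereal (s - \<delta> k)"
          unfolding path_exit_sample[OF ck D] using elim s by (intro INF_lower) auto
        also have "\<dots> \<le> ereal (\<eta> / 2)" using s \<delta>(1)[of k] by simp
        finally show ?case by (simp add: late_def)
      qed
      then show ?case by (rule tendsto_eventually)
    qed
  qed (auto simp: late(2))
  then have "\<forall>\<^sub>F k in sequentially. (\<integral>\<omega>. late D (\<eta> / 2) (sample (\<lambda>s. y + (W (\<delta> k + s) \<omega> - W 0 \<omega>))) \<partial>M) < e"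
    using e by (intro order_tendstoD(2)) auto
  then obtain k where k: "(\<integral>\<omega>. late D (\<eta> / 2) (sample (\<lambda>s. y + (W (\<delta> k + s) \<omega> - W 0 \<omega>))) \<partial>M) < e"
    by (auto dest: eventually_happens)
  define h where "h = heat (\<delta> k) (mean_from (late D (\<eta> / 2)))"
  have hy: "h y < e" using k unfolding h_def mean_from_markov[OF late \<delta>(1)] .
  have "continuous_on UNIV h"
    unfolding h_def by (rule continuous_on_heat[OF \<delta>(1) measurable_mean_from[OF late] abs_mean_from_le[OF late]])
  then have "(h \<longlongrightarrow> h y) (nhds y)"
    by (metis continuous_on_eq_continuous_at iso_tuple_UNIV_I open_UNIV isCont_def tendsto_at_iff_tendsto_nhds)
  then have ev: "\<forall>\<^sub>F z in nhds y. h z < e" using hy by (rule order_tendstoD)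
  have le: "mean_from (late D \<eta>) z \<le> h z" for z
    unfolding h_def mean_from_markov[OF late \<delta>(1), symmetric] mean_from_eq[OF measurable_late abs_late_le]
  proof (rule integral_mono)
    show "integrable M (\<lambda>\<omega>. late D \<eta> (sample (?p z \<omega>)))"
      using measurable_compose[OF measurable_sample_increments[OF order.refl, of z] measurable_late[of D \<eta>]]
      by (intro integrable_const_bound[where B = 1]) (auto simp: abs_late_le)
    show "integrable M (\<lambda>\<omega>. late D (\<eta> / 2) (sample (\<lambda>s. ?p z \<omega> (\<delta> k + s))))"
      using measurable_compose[OF measurable_sample_increments[OF less_imp_le[OF \<delta>(1)], of z] late(1)]
      by (intro integrable_const_bound[where B = 1]) (auto simp: abs_late_le)
    fix \<omega> assume \<omega>: "\<omega> \<in> space M"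
    have c: "continuous_on {0..} (?p z \<omega>)" using continuous_increments[of \<omega> 0 z] \<omega> by simp
    show "late D \<eta> (sample (?p z \<omega>)) \<le> late D (\<eta> / 2) (sample (\<lambda>s. ?p z \<omega> (\<delta> k + s)))"
    proof (cases "ereal \<eta> < path_exit D (sample (?p z \<omega>))")
      case True
      have "ereal \<eta> < path_exit D (sample (?p z \<omega>))" by fact
      also have "\<dots> \<le> ereal (\<delta> k) + path_exit D (sample (\<lambda>s. ?p z \<omega> (\<delta> k + s)))"
        by (rule path_exit_shift(1)[OF c D less_imp_le[OF \<delta>(1)]])
      finally have "ereal (\<eta> / 2) < path_exit D (sample (\<lambda>s. ?p z \<omega> (\<delta> k + s)))"
        using \<delta>(2)[of k] by (cases "path_exit D (sample (\<lambda>s. ?p z \<omega> (\<delta> k + s)))") auto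
      then show ?thesis by (simp add: late_def)
    qed (simp add: late_def)
  qed
  show ?thesis using ev by (rule eventually_mono) (rule le_less_trans[OF le])
qed

text \<open>Started near \<open>y\<close>, the path exits before \<eta> and has moved little by
  then, except on a small event; the exit position is close to \<open>y\<close> and the discount
  close to 1. The filter \<open>nhds y\<close> includes \<open>y\<close> itself, so the limit also
  fixes the value there.\<close>

theorem mean_exit_value_tendsto:
  assumes D: "open D" and f: "continuous_on UNIV f" and f_le: "\<And>v. \<bar>f v\<bar> \<le> m" and \<kappa>: "0 \<le> \<kappa>"
    and reg: "AE \<omega> in M. path_exit D (sample (\<lambda>s. y + (W s \<omega> - W 0 \<omega>))) = 0"
  shows "(mean_from (exit_value \<kappa> D f) \<longlongrightarrow> f y) (nhds y)"
proof (rule tendstoI)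
  fix e :: real assume e: "0 < e"
  have m: "0 \<le> m" using f_le[of undefined] by linarith
  have fm: "f \<in> borel_measurable borel" by (rule borel_measurable_continuous_onI[OF f])
  \<comment> \<open>The oscillation of \<open>f\<close> and the discount cost \<epsilon> each, and
    the bad event of probability at most \<open>2 * \<epsilon>\<close> costs \<open>2 * m\<close>
    times that: \<open>(4 * m + 2) * \<epsilon>\<close> in all.\<close>
  define \<epsilon> where "\<epsilon> = e / (4 * m + 3)"
  have \<epsilon>: "0 < \<epsilon>" "(4 * m + 2) * \<epsilon> < e" using e m by (auto simp: \<epsilon>_def field_simps)
  have "isCont f y" using f by (simp add: continuous_on_eq_continuous_at)
  then obtain \<rho> where \<rho>: "0 < \<rho>" "\<And>v. dist v y < \<rho> \<Longrightarrow> dist (f v) (f y) < \<epsilon>"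
    using \<epsilon>(1) unfolding continuous_at_eps_delta by blast
  obtain C where C: "0 \<le> C" and max: "\<And>t. 0 < t \<Longrightarrow> \<exists>A\<in>events. prob A \<le> C * t\<^sup>2 \<and> (\<forall>\<omega>\<in>space M - A. \<forall>s\<in>{0..t}. norm (W s \<omega> - W 0 \<omega>) < \<rho> / 2)"
    using maximal_inequality[of "\<rho> / 2"] \<rho>(1) by auto
  have "((\<lambda>t. m * (1 - exp (- \<kappa> * t))) \<longlongrightarrow> m * (1 - exp (- \<kappa> * 0))) (at_right 0)"
    "((\<lambda>t. C * t\<^sup>2) \<longlongrightarrow> C * 0\<^sup>2) (at_right 0)"
    by (intro tendsto_intros)+
  then have "\<forall>\<^sub>F t in at_right 0. m * (1 - exp (- \<kappa> * t)) < \<epsilon>" "\<forall>\<^sub>F t in at_right 0. C * t\<^sup>2 < \<epsilon>"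
    using \<epsilon>(1) by (auto intro: order_tendstoD)
  then have "\<forall>\<^sub>F t in at_right 0. m * (1 - exp (- \<kappa> * t)) < \<epsilon> \<and> C * t\<^sup>2 < \<epsilon> \<and> 0 < t"
    using eventually_at_right_less[of 0] by eventually_elim auto
  then obtain \<eta> where \<eta>: "m * (1 - exp (- \<kappa> * \<eta>)) < \<epsilon>" "C * \<eta>\<^sup>2 < \<epsilon>" "0 < \<eta>"
    using eventually_happens'[OF trivial_limit_at_right_real[of 0]] by blast
  obtain A where A: "A \<in> events" "prob A \<le> C * \<eta>\<^sup>2" "\<And>\<omega> s. \<omega> \<in> space M - A \<Longrightarrow> s \<in> {0..\<eta>} \<Longrightarrow> norm (W s \<omega> - W 0 \<omega>) < \<rho> / 2"
    using max[OF \<eta>(3)] by blast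
  have "\<forall>\<^sub>F z in nhds y. dist z y < \<rho> / 2" 
    by (rule eventually_mono[OF eventually_nhds_in_open[of "ball y (\<rho> / 2)" y]]) (use \<rho>(1) in \<open>auto simp: dist_commute\<close>)
  with regular_point_late_exit[OF D reg \<eta>(3) \<epsilon>(1)]
  show "\<forall>\<^sub>F z in nhds y. dist (mean_from (exit_value \<kappa> D f) z) (f y) < e"
  proof eventually_elim
    case (elim z)
    let ?p = "\<lambda>\<omega> s. z + (W s \<omega> - W 0 \<omega>)"
    let ?V = "exit_value \<kappa> D f"
    define L where "L = {\<omega> \<in> space M. ereal \<eta> < path_exit D (sample (?p \<omega>))}"
    have mp: "random_variable path_space (\<lambda>\<omega>. sample (?p \<omega>))"
      using measurable_sample_increments[of 0 z] by simp
    have L: "L \<in> events"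
      unfolding L_def using measurable_compose[OF mp measurable_path_exit[of D]] by measurable
    have "mean_from (late D \<eta>) z = (\<integral>\<omega>. indicator L \<omega> \<partial>M)"
      unfolding mean_from_eq[OF measurable_late abs_late_le]
      by (intro Bochner_Integration.integral_cong refl) (auto simp: L_def late_def split: split_indicator)
    then have PL: "prob L < \<epsilon>" using elim(1) L by simp
    have iV: "integrable M (\<lambda>\<omega>. ?V (sample (?p \<omega>)))"
      using integrable_exit_value[OF D fm f_le \<kappa>, where t = 0 and z' = z] by simp
    have "(\<integral>\<omega>. ?V (sample (?p \<omega>)) - f y \<partial>M) = mean_from ?V z - f y"
      using iV prob_space mean_from_eq[OF measurable_exit_value[OF fm] abs_exit_value_le[OF \<kappa> f_le], where z' = z] by simp
    moreover have "\<bar>\<integral>\<omega>. ?V (sample (?p \<omega>)) - f y \<partial>M\<bar> \<le> 2 * \<epsilon> + 2 * m * prob (A \<union> L)"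
    proof (rule abs_integral_le_split)
      show "integrable M (\<lambda>\<omega>. ?V (sample (?p \<omega>)) - f y)" using iV by auto
      show "\<bar>?V (sample (?p \<omega>)) - f y\<bar> \<le> 2 * m" for \<omega>
        using abs_exit_value_le[where f = f and m = m and D = D and y = "sample (?p \<omega>)", OF \<kappa> f_le] f_le[of y] by linarith
      fix \<omega> assume \<omega>: "\<omega> \<in> space M - (A \<union> L)"
      then have le: "path_exit D (sample (?p \<omega>)) \<le> ereal \<eta>" by (auto simp: L_def)
      with path_exit_nonneg[of D "sample (?p \<omega>)"] obtain \<tau> where \<tau>: "path_exit D (sample (?p \<omega>)) = ereal \<tau>" "0 \<le> \<tau>" "\<tau> \<le> \<eta>"
        by (cases "path_exit D (sample (?p \<omega>))") auto
      have c: "continuous_on {0..} (?p \<omega>)" using continuous_increments[of \<omega> 0 z] \<omega> by simp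
      note V = exit_value_sample[OF c \<tau>(1), of \<kappa> f]
      have "norm (W \<tau> \<omega> - W 0 \<omega>) < \<rho> / 2" using \<omega> \<tau> by (intro A(3)) auto
      then have "dist (?p \<omega> \<tau>) y < \<rho>"
        using elim(2) dist_triangle[of "?p \<omega> \<tau>" y z] by (simp add: dist_norm)
      then have 1: "\<bar>f (?p \<omega> \<tau>) - f y\<bar> < \<epsilon>" using \<rho>(2) by (simp add: dist_real_def)
      have e1: "exp (- \<kappa> * \<tau>) \<le> 1" "exp (- \<kappa> * \<eta>) \<le> exp (- \<kappa> * \<tau>)" using \<kappa> \<tau> by (auto intro: mult_left_mono)
      have "\<bar>exp (- \<kappa> * \<tau>) * f (?p \<omega> \<tau>) - f (?p \<omega> \<tau>)\<bar> = (1 - exp (- \<kappa> * \<tau>)) * \<bar>f (?p \<omega> \<tau>)\<bar>"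
      proof -
        have "exp (- \<kappa> * \<tau>) * f (?p \<omega> \<tau>) - f (?p \<omega> \<tau>) = - ((1 - exp (- \<kappa> * \<tau>)) * f (?p \<omega> \<tau>))"
          by (simp add: left_diff_distrib)
        then show ?thesis using e1(1) by (simp only: abs_minus_cancel abs_mult)
      qed
      also have "\<dots> \<le> (1 - exp (- \<kappa> * \<eta>)) * m" using e1 f_le m by (intro mult_mono) auto
      finally have "\<bar>exp (- \<kappa> * \<tau>) * f (?p \<omega> \<tau>) - f (?p \<omega> \<tau>)\<bar> < \<epsilon>" using \<eta>(1) by (simp add: mult.commute)
      then show "\<bar>?V (sample (?p \<omega>)) - f y\<bar> \<le> 2 * \<epsilon>" using 1 unfolding V by linarith
    qed (use A L \<epsilon> m in auto)
    moreover have "prob (A \<union> L) \<le> 2 * \<epsilon>"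
      using measure_Un_le[OF A(1) L] A(2) \<eta>(2) PL by linarith
    then have "2 * m * prob (A \<union> L) \<le> 2 * m * (2 * \<epsilon>)" using m by (intro mult_left_mono) auto
    ultimately have "\<bar>mean_from ?V z - f y\<bar> \<le> (4 * m + 2) * \<epsilon>" by (simp add: algebra_simps)
    then show ?case using \<epsilon>(2) by (simp add: dist_real_def)
  qed
qed

end

section \<open>A killed cosine expectation\<close>

context brownian_motion
begin

text \<open>The path up to time \<open>s\<close>, run over the unit time interval and constant afterwards.\<close>

definition past :: "real \<Rightarrow> 'w \<Rightarrow> nat \<times> nat \<Rightarrow> 'a" where
  "past s \<omega> = sample (\<lambda>u. W (s * min u 1) \<omega> - W 0 \<omega>)"

lemma measurable_past:
  assumes "0 \<le> s"
  shows "random_variable path_space (past s)"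
  unfolding past_def[abs_def] using assms by (intro measurable_sample measurable_increment) auto

lemma past_grid_indep_increment:
  assumes s: "0 < s" "s < t" and A: "A \<in> sets borel" and E: "E \<in> sets (PiM {..<Suc K} (\<lambda>_. borel))"
  shows "emeasure M {\<omega>\<in>space M. W t \<omega> - W s \<omega> \<in> A \<and> grid_increments (\<lambda>u. W (s * min u 1) \<omega>) n K \<in> E}
    = emeasure (gauss (t - s)) A * emeasure M {\<omega>\<in>space M. grid_increments (\<lambda>u. W (s * min u 1) \<omega>) n K \<in> E}"
proof -
  \<comment> \<open>A grid of \<open>2 ^ n\<close> steps on the interval up to \<open>s\<close>,
    followed by the time \<open>t\<close>: increment number \<open>2 ^ n\<close> is the one from
    \<open>s\<close> to \<open>t\<close>.\<close>
  define T where "T l = (if l \<le> 2 ^ n then s * (real l / 2 ^ n) else t)" for l :: nat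
  let ?X = "\<lambda>l \<omega>. W (T (Suc l)) \<omega> - W (T l) \<omega>"
  let ?P = "PiM {..<Suc K} (\<lambda>_. borel :: 'a measure)"
  have "T l < T (Suc l)" if "l < Suc (2 ^ n)" for l
    using s that by (auto simp: T_def divide_strict_right_mono mult_strict_left_mono le_less_Suc_eq less_Suc_eq)
  then have ind: "indep_vars (\<lambda>_. borel) ?X {..<Suc (2 ^ n)}"
    by (intro independent_increments) (auto simp: T_def)
  \<comment> \<open>The path is frozen after unit time, so its grid increments from index
    \<open>2 ^ n\<close> on vanish.\<close>
  let ?g = "\<lambda>x. \<lambda>l\<in>{..<Suc K}. if l < 2 ^ n then x l else 0 :: 'a"
  define A' where "A' = {x \<in> space (PiM {2 ^ n :: nat} (\<lambda>_. borel)). x (2 ^ n) \<in> A}"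
  have A': "A' \<in> sets (PiM {2 ^ n} (\<lambda>_. borel))"
    unfolding A'_def using A by measurable
  have gm: "?g \<in> measurable (PiM {..<2 ^ n} (\<lambda>_. borel)) ?P"
  proof (rule measurable_restrict)
    fix l show "(\<lambda>x. if l < 2 ^ n then x l else 0) \<in> borel_measurable (PiM {..<2 ^ n} (\<lambda>_. borel :: 'a measure))"
      by (cases "l < 2 ^ n") auto
  qed
  have "indep_var (PiM {2 ^ n} (\<lambda>_. borel)) ((\<lambda>x. x) \<circ> (\<lambda>\<omega>. \<lambda>l\<in>{2 ^ n}. ?X l \<omega>)) ?P (?g \<circ> (\<lambda>\<omega>. \<lambda>l\<in>{..<2 ^ n}. ?X l \<omega>))"
    by (rule indep_var_compose[OF indep_var_restrict[OF ind] _ gm]) auto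
  moreover have "?g \<circ> (\<lambda>\<omega>. \<lambda>l\<in>{..<2 ^ n}. ?X l \<omega>) = (\<lambda>\<omega>. grid_increments (\<lambda>u. W (s * min u 1) \<omega>) n K)"
  proof (intro ext)
    fix \<omega> l
    show "(?g \<circ> (\<lambda>\<omega>. \<lambda>l\<in>{..<2 ^ n}. ?X l \<omega>)) \<omega> l = grid_increments (\<lambda>u. W (s * min u 1) \<omega>) n K l"
    proof (cases "l < 2 ^ n")
      case True
      then have "real (Suc l) \<le> 2 ^ n" "real l \<le> 2 ^ n"
        by (metis Suc_leI of_nat_le_iff of_nat_numeral of_nat_power) (use True in \<open>simp add: less_imp_le\<close>)
      then have "real (Suc l) / 2 ^ n \<le> 1" "real l / 2 ^ n \<le> 1" by (auto simp: divide_le_eq_1)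
      then show ?thesis using True by (auto simp: T_def grid_increments_def min_def)
    next
      case False
      then have "2 ^ n \<le> real l" "2 ^ n \<le> real (Suc l)"
        by (metis not_less of_nat_le_iff of_nat_numeral of_nat_power)
          (use False in \<open>metis le_SucI not_less of_nat_le_iff of_nat_numeral of_nat_power\<close>)
      then have "min (real (Suc l) / 2 ^ n) 1 = 1" "min (real l / 2 ^ n) 1 = 1" by (auto simp: le_divide_eq_1 min_def)
      then show ?thesis using False by (simp add: grid_increments_def)
    qed
  qed
  ultimately have "indep_var (PiM {2 ^ n} (\<lambda>_. borel)) ((\<lambda>x. x) \<circ> (\<lambda>\<omega>. \<lambda>l\<in>{2 ^ n}. ?X l \<omega>)) ?P (\<lambda>\<omega>. grid_increments (\<lambda>u. W (s * min u 1) \<omega>) n K)"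
    by simp
  from indep_varD[OF this A' E]
  have "prob {\<omega>\<in>space M. W t \<omega> - W s \<omega> \<in> A \<and> grid_increments (\<lambda>u. W (s * min u 1) \<omega>) n K \<in> E} =
    prob ((\<lambda>\<omega>. W t \<omega> - W s \<omega>) -` A \<inter> space M) * prob {\<omega>\<in>space M. grid_increments (\<lambda>u. W (s * min u 1) \<omega>) n K \<in> E}"
    by (simp add: A'_def T_def space_PiM vimage_def Int_def conj_commute)
  moreover have "ennreal (prob ((\<lambda>\<omega>. W t \<omega> - W s \<omega>) -` A \<inter> space M)) = emeasure (gauss (t - s)) A"
    unfolding emeasure_eq_measure[symmetric] distr_increment[OF less_imp_le[OF s(1)] s(2), symmetric]
    using s A by (intro emeasure_distr[symmetric] measurable_increment) auto
  ultimately show ?thesis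
    by (simp add: emeasure_eq_measure ennreal_mult)
qed

text \<open>The counterpart of \<open>markov_law\<close> with the whole past on one side and a
  single increment on the other: survival up to time \<open>s\<close> depends on the entire
  past.\<close>

theorem past_indep_increment:
  assumes s: "0 < s" "s < t"
  shows "distr M (borel \<Otimes>\<^sub>M path_space) (\<lambda>\<omega>. (W t \<omega> - W s \<omega>, past s \<omega>)) = gauss (t - s) \<Otimes>\<^sub>M distr M path_space (past s)"
proof (rule distr_pair_path_eqI)
  show "random_variable borel (\<lambda>\<omega>. W t \<omega> - W s \<omega>)" and past: "random_variable path_space (past s)"
    using s by (auto intro: measurable_increment measurable_past)
  show "prob_space (gauss (t - s) :: 'a measure)" using s by (intro prob_space_gauss) simp
  show "prob_space (distr M path_space (past s))" by (rule prob_space_distr[OF past])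
  fix A :: "'a set" and X :: "nat \<times> nat \<Rightarrow> 'a set" and J :: "(nat \<times> nat) set"
  assume A: "A \<in> sets borel" and J: "finite J" and X: "\<forall>q\<in>J. X q \<in> sets borel"
  from sample_box_eq_grid_event[where X = X, OF J X] obtain n K E where
    E: "E \<in> sets (PiM {..<Suc K} (\<lambda>_. borel))" and eq: "\<forall>p. (\<forall>q\<in>J. p (dyad q) - p 0 \<in> X q) \<longleftrightarrow> grid_increments p n K \<in> E"
    by (elim exE bexE) (rule that)
  have box: "prod_emb UNIV (\<lambda>_. borel) J (PiE J X) \<in> sets path_space"
    using J X by (intro sets_PiM_I) auto
  have "past s \<omega> \<in> prod_emb UNIV (\<lambda>_. borel) J (PiE J X) \<longleftrightarrow> grid_increments (\<lambda>u. W (s * min u 1) \<omega>) n K \<in> E" for \<omega>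
    unfolding eq[THEN spec, symmetric] by (auto simp: prod_emb_def past_def sample_def PiE_iff restrict_def extensional_def)
  then show "emeasure M {\<omega>\<in>space M. W t \<omega> - W s \<omega> \<in> A \<and> past s \<omega> \<in> prod_emb UNIV (\<lambda>_. borel) J (PiE J X)} =
      emeasure (gauss (t - s)) A * emeasure (distr M path_space (past s)) (prod_emb UNIV (\<lambda>_. borel) J (PiE J X))"
    using past_grid_indep_increment[OF s A E, of n] box past
    by (simp add: emeasure_distr vimage_def Int_def conj_commute)
qed simp_all

lemma expectation_past_times_increment:
  fixes F :: "(nat \<times> nat \<Rightarrow> 'a) \<Rightarrow> real" and h :: "'a \<Rightarrow> real"
  assumes s: "0 < s" "s < t" and F [measurable]: "F \<in> borel_measurable path_space" and F_le: "\<And>y. \<bar>F y\<bar> \<le> m"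
    and h [measurable]: "h \<in> borel_measurable borel" and h_le: "\<And>v. \<bar>h v\<bar> \<le> k"
  shows "(\<integral>\<omega>. F (past s \<omega>) * h (W t \<omega> - W s \<omega>) \<partial>M) = (\<integral>\<omega>. F (past s \<omega>) \<partial>M) * (\<integral>\<omega>. h (W t \<omega> - W s \<omega>) \<partial>M)"
proof -
  have s0: "0 \<le> s" "0 \<le> t" using s by auto
  have [measurable]: "random_variable borel (\<lambda>\<omega>. W t \<omega> - W s \<omega>)" "random_variable path_space (past s)"
    using s0 by (auto intro: measurable_increment measurable_past)
  let ?L = "distr M path_space (past s)"
  have ts: "0 < t - s" using s by simp
  interpret G: prob_space "gauss (t - s) :: 'a measure" using ts by (rule prob_space_gauss)
  interpret L: prob_space ?L by (rule prob_space_distr) measurable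
  interpret P: pair_prob_space "gauss (t - s) :: 'a measure" ?L ..
  have mk: "0 \<le> m" using F_le[of undefined] by linarith
  have "(\<integral>\<omega>. F (past s \<omega>) * h (W t \<omega> - W s \<omega>) \<partial>M) = (\<integral>x. F (snd x) * h (fst x) \<partial>distr M (borel \<Otimes>\<^sub>M path_space) (\<lambda>\<omega>. (W t \<omega> - W s \<omega>, past s \<omega>)))"
    by (subst integral_distr) auto
  also have "\<dots> = (\<integral>x. F (snd x) * h (fst x) \<partial>(gauss (t - s) \<Otimes>\<^sub>M ?L))"
    unfolding past_indep_increment[OF s] ..
  also have "\<dots> = (\<integral>v. \<integral>y. F (snd (v, y)) * h (fst (v, y)) \<partial>?L \<partial>gauss (t - s))"
  proof (rule P.integral_fst'[symmetric], rule P.integrable_const_bound[where B = "m * k"])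
    show "AE x in gauss (t - s) \<Otimes>\<^sub>M ?L. norm (F (snd x) * h (fst x)) \<le> m * k"
      using F_le h_le mk by (auto simp: abs_mult intro!: mult_mono)
  qed measurable
  also have "\<dots> = (\<integral>y. F y \<partial>?L) * (\<integral>v. h v \<partial>gauss (t - s))"
    by simp
  also have "(\<integral>y. F y \<partial>?L) = (\<integral>\<omega>. F (past s \<omega>) \<partial>M)"
    by (subst integral_distr) auto
  also have "(\<integral>v. h v \<partial>gauss (t - s)) = (\<integral>\<omega>. h (W t \<omega> - W s \<omega>) \<partial>M)"
    unfolding distr_increment[OF s0(1) s(2), symmetric] by (subst integral_distr) auto
  finally show ?thesis .
qed

end

text \<open>Before \<tau> the path is in \<open>D\<close>, so its position at \<tau> is in the
  closure. It is not in \<open>D\<close>, since openness would keep the path inside a little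
  longer.\<close>

lemma exit_position:
  fixes p :: "real \<Rightarrow> 'a::euclidean_space"
  assumes p: "continuous_on {0..} p" and D: "open D" and p0: "p 0 \<in> D" and e: "path_exit D (sample p) = ereal \<tau>"
  shows "0 < \<tau>" and "p \<tau> \<in> frontier D" and "\<And>s. 0 \<le> s \<Longrightarrow> s < \<tau> \<Longrightarrow> p s \<in> D"
proof -
  have t0: "0 \<le> \<tau>" using path_exit_nonneg[of D "sample p"] e by simp
  have inf: "(INF t\<in>{t. 0 < t \<and> p t \<notin> D}. ereal t) = ereal \<tau>"
    using path_exit_sample[OF p D] e by simp
  show before: "p s \<in> D" if "0 \<le> s" "s < \<tau>" for s
  proof (rule ccontr)
    assume n: "p s \<notin> D"
    then have "s \<noteq> 0" using p0 by auto
    then have "ereal \<tau> \<le> ereal s" using n that unfolding inf[symmetric] by (intro INF_lower) auto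
    then show False using that by simp
  qed
  have notin: "p \<tau> \<notin> D"
  proof
    assume "p \<tau> \<in> D"
    then obtain r where r: "0 < r" "ball (p \<tau>) r \<subseteq> D" using D open_contains_ball by blast
    from p t0 obtain d where d: "0 < d" "\<And>s. 0 \<le> s \<Longrightarrow> dist s \<tau> < d \<Longrightarrow> dist (p s) (p \<tau>) < r"
      using r(1) unfolding continuous_on_iff by (metis atLeast_iff)
    have "(INF t\<in>{t. 0 < t \<and> p t \<notin> D}. ereal t) < ereal (\<tau> + d)" unfolding inf using d by simp
    then obtain s where s: "0 < s" "p s \<notin> D" "s < \<tau> + d" unfolding INF_less_iff by auto
    have "\<tau> \<le> s" using before[of s] s by force
    then have "dist (p s) (p \<tau>) < r" using s by (intro d) (auto simp: dist_real_def)
    then have "p s \<in> ball (p \<tau>) r" by (simp add: dist_commute)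
    then show False using r(2) s(2) by blast
  qed
  show "0 < \<tau>" using notin p0 t0 by (cases "\<tau> = 0") auto
  have "p \<tau> \<in> closure D"
    unfolding closure_approachable
  proof (intro allI impI)
    fix r :: real assume "0 < r"
    from p t0 obtain d where d: "0 < d" "\<And>s. 0 \<le> s \<Longrightarrow> dist s \<tau> < d \<Longrightarrow> dist (p s) (p \<tau>) < r"
      using \<open>0 < r\<close> unfolding continuous_on_iff by (metis atLeast_iff)
    define s where "s = max 0 (\<tau> - d / 2)"
    have "0 \<le> s" "s < \<tau>" "dist s \<tau> < d" using \<open>0 < \<tau>\<close> d(1) by (auto simp: s_def dist_real_def)
    then show "\<exists>y\<in>D. dist y (p \<tau>) < r" using before d by blast
  qed
  then show "p \<tau> \<in> frontier D" using notin D by (simp add: frontier_def interior_open)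
qed

text \<open>The exit time disregards time 0; starting in \<open>D\<close> is what allows the closed
  interval on the right.\<close>

lemma less_path_exit_iff:
  fixes p :: "real \<Rightarrow> 'a::euclidean_space"
  assumes p: "continuous_on {0..} p" and D: "open D" and p0: "p 0 \<in> D" and s: "0 \<le> s"
  shows "ereal s < path_exit D (sample p) \<longleftrightarrow> (\<forall>r\<in>{0..s}. p r \<in> D)"
proof
  assume l: "ereal s < path_exit D (sample p)"
  show "\<forall>r\<in>{0..s}. p r \<in> D"
  proof (rule ballI, rule ccontr)
    fix r assume r: "r \<in> {0..s}" "p r \<notin> D"
    then have "r \<noteq> 0" using p0 by auto
    then have "path_exit D (sample p) \<le> ereal r"
      unfolding path_exit_sample[OF p D] using r by (intro INF_lower) auto
    also have "\<dots> \<le> ereal s" using r by simp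
    finally show False using l by simp
  qed
next
  assume in_D: "\<forall>r\<in>{0..s}. p r \<in> D"
  show "ereal s < path_exit D (sample p)"
  proof (rule ccontr)
    assume "\<not> ?thesis"
    then obtain \<tau> where \<tau>: "path_exit D (sample p) = ereal \<tau>" "0 \<le> \<tau>" "\<tau> \<le> s"
      using path_exit_nonneg[of D "sample p"] by (cases "path_exit D (sample p)") auto
    from exit_position(2)[OF p D p0 \<tau>(1)] have "p \<tau> \<notin> D" using D by (auto simp: frontier_def interior_open)
    then show False using in_D \<tau> by auto
  qed
qed

text \<open>Real and imaginary part of the characteristic function of a centred normal variable with
  variance \<open>t - s\<close>.\<close>

lemma (in brownian_motion) normal_increment_cos_sin:
  fixes \<mu> :: real
  assumes st: "0 \<le> s" "s < t" and b: "b \<in> Basis"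
  shows "expectation (\<lambda>\<omega>. cos (\<mu> * ((W t \<omega> - W s \<omega>) \<bullet> b))) = exp (- (\<mu>\<^sup>2 / 2) * (t - s))"
    and "expectation (\<lambda>\<omega>. sin (\<mu> * ((W t \<omega> - W s \<omega>) \<bullet> b))) = 0"
proof -
  define \<sigma> where "\<sigma> = sqrt (t - s)"
  have \<sigma>: "0 < \<sigma>" "\<sigma>\<^sup>2 = t - s" using st by (auto simp: \<sigma>_def)
  let ?X = "\<lambda>\<omega>. (W t \<omega> - W s \<omega>) \<bullet> b"
  have mW: "random_variable borel (\<lambda>\<omega>. W t \<omega> - W s \<omega>)" using st by (intro measurable_increment) auto
  then have mX [measurable]: "random_variable borel ?X" by measurable
  have "distr M borel ?X = distr (distr M borel (\<lambda>\<omega>. W t \<omega> - W s \<omega>)) borel (\<lambda>v. v \<bullet> b)"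
    using mW by (subst distr_distr) (auto simp: comp_def)
  then have "distr M borel ?X = density lborel (normal_density 0 \<sigma>)"
    unfolding distr_increment[OF st] \<sigma>_def using st b by (simp add: distr_gauss_inner)
  then have "distributed M lborel ?X (normal_density 0 \<sigma>)"
    unfolding distributed_def by (auto intro!: distr_cong simp: cong: distr_cong)
  then have "distributed M lborel (\<lambda>\<omega>. (?X \<omega> - 0) / \<sigma>) std_normal_density"
    using normal_standard_normal_convert[OF \<sigma>(1), of ?X 0] by simp
  then have d: "distr M borel (\<lambda>\<omega>. ?X \<omega> / \<sigma>) = std_normal_distribution"
    unfolding distributed_def by (auto cong: distr_cong)
  have "complex_of_real (exp (- (\<mu> * \<sigma>)\<^sup>2 / 2)) = char std_normal_distribution (\<mu> * \<sigma>)"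
    unfolding char_std_normal_distribution by simp
  also have "\<dots> = (\<integral>\<omega>. iexp (\<mu> * \<sigma> * (?X \<omega> / \<sigma>)) \<partial>M)"
    unfolding d[symmetric] char_def by (subst integral_distr) auto
  also have "\<dots> = (\<integral>\<omega>. Complex (cos (\<mu> * ?X \<omega>)) (sin (\<mu> * ?X \<omega>)) \<partial>M)"
    using \<sigma>(1) by (intro Bochner_Integration.integral_cong refl) (simp add: exp_Euler cos_of_real sin_of_real complex_eq_iff flip: of_real_mult)
  finally have eq: "(\<integral>\<omega>. Complex (cos (\<mu> * ?X \<omega>)) (sin (\<mu> * ?X \<omega>)) \<partial>M) = complex_of_real (exp (- (\<mu> * \<sigma>)\<^sup>2 / 2))" ..
  have i: "integrable M (\<lambda>\<omega>. complex_of_real (cos (\<mu> * ?X \<omega>)) + \<i> * complex_of_real (sin (\<mu> * ?X \<omega>)))"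
    by (rule integrable_const_bound[where B = 1]) (auto simp: cmod_def)
  then have i': "integrable M (\<lambda>\<omega>. Complex (cos (\<mu> * ?X \<omega>)) (sin (\<mu> * ?X \<omega>)))"
    by (simp add: Complex_eq)
  have "expectation (\<lambda>\<omega>. cos (\<mu> * ?X \<omega>)) = Re (\<integral>\<omega>. Complex (cos (\<mu> * ?X \<omega>)) (sin (\<mu> * ?X \<omega>)) \<partial>M)"
    using integral_Re[OF i'] by simp
  also have "\<dots> = exp (- (\<mu>\<^sup>2 / 2) * (t - s))" unfolding eq by (simp add: power_mult_distrib \<sigma>(2))
  finally show "expectation (\<lambda>\<omega>. cos (\<mu> * ?X \<omega>)) = exp (- (\<mu>\<^sup>2 / 2) * (t - s))" .
  have "expectation (\<lambda>\<omega>. sin (\<mu> * ?X \<omega>)) = Im (\<integral>\<omega>. Complex (cos (\<mu> * ?X \<omega>)) (sin (\<mu> * ?X \<omega>)) \<partial>M)"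
    using integral_Im[OF i'] by simp
  then show "expectation (\<lambda>\<omega>. sin (\<mu> * ?X \<omega>)) = 0" unfolding eq by simp
qed

text \<open>\<open>exp (\<mu>\<^sup>2 t / 2) * cos (\<mu> * B t)\<close> is a martingale that vanishes when \<open>\<bar>B\<bar>\<close> reaches a zero of
  \<open>cos (\<mu> * _)\<close>. It is stopped at the first grid point after the exit time, and the grid is refined.\<close>

theorem killed_cosine:
  fixes B :: "real \<Rightarrow> 'w \<Rightarrow> real"
  assumes BM: "brownian_motion M B 0" and a: "0 < a" and cosa: "cos (\<mu> * a) = 0" and T: "0 \<le> T"
  shows "(\<integral>\<omega>. cos (\<mu> * B T \<omega>) * of_bool (ereal T < path_exit {-a<..<a} (sample (\<lambda>s. B s \<omega>))) \<partial>M) = exp (- (\<mu>\<^sup>2 / 2) * T)"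
proof -
  interpret brownian_motion M B 0 by fact
  define \<kappa> where "\<kappa> = \<mu>\<^sup>2 / 2"
  have \<kappa>: "0 \<le> \<kappa>" by (simp add: \<kappa>_def)
  define I where "I = {-a<..<a}"
  have I: "open I" "0 \<in> I" using a by (auto simp: I_def)
  \<comment> \<open>\<open>B\<close> starts at 0 only almost surely, while \<open>b\<close> does so
    on every path; the pathwise arguments below then hold without exceptions.\<close>
  define b where "b s \<omega> = B s \<omega> - B 0 \<omega>" for s \<omega>
  define \<sigma> where "\<sigma> \<omega> = path_exit I (sample (\<lambda>s. b s \<omega>))" for \<omega>
  define J where "J s \<omega> = (of_bool (ereal s < \<sigma> \<omega>) :: real)" for s \<omega>
  define C where "C s \<omega> = cos (\<mu> * b s \<omega>)" for s \<omega>
  have b_cont: "continuous_on {0..} (\<lambda>s. b s \<omega>)" if "\<omega> \<in> space M" for \<omega>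
    using continuous_increments[OF that order.refl, of 0] by (simp add: b_def)
  have b_meas [measurable]: "random_variable borel (b s)" if "0 \<le> s" for s
    unfolding b_def[abs_def] using that by (intro measurable_increment) auto
  have "\<sigma> = (\<lambda>\<omega>. path_exit I (increments_from 0 \<omega>))"
    by (simp add: \<sigma>_def b_def increments_from_def fun_eq_iff)
  then have [measurable]: "\<sigma> \<in> borel_measurable M"
    using measurable_compose[OF measurable_increments_from[OF order.refl] measurable_path_exit] by simp
  have J_meas [measurable]: "J s \<in> borel_measurable M" for s
    unfolding J_def[abs_def] by measurable
  have C_meas [measurable]: "C s \<in> borel_measurable M" if "0 \<le> s" for s
    unfolding C_def[abs_def] using b_meas[OF that] by measurable
  have J01: "0 \<le> J s \<omega>" "J s \<omega> \<le> 1" "s \<le> t \<Longrightarrow> J t \<omega> \<le> J s \<omega>" for s t \<omega>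
    by (auto simp: J_def intro: le_less_trans[of "ereal s" "ereal t"])
  have C1: "\<bar>C s \<omega>\<bar> \<le> 1" for s \<omega> by (simp add: C_def)
  have J_iff: "ereal s < \<sigma> \<omega> \<longleftrightarrow> (\<forall>r\<in>{0..s}. b r \<omega> \<in> I)" if "\<omega> \<in> space M" "0 \<le> s" for s \<omega>
    unfolding \<sigma>_def using less_path_exit_iff[OF b_cont[OF that(1)] I(1) _ that(2)] I(2) by (simp add: b_def)
  have J0: "J 0 \<omega> = 1" if "\<omega> \<in> space M" for \<omega>
    unfolding J_def using J_iff[OF that, of 0] I(2) by (simp add: b_def)
  have int: "integrable M (\<lambda>\<omega>. C t \<omega> * J s \<omega>)" if "0 \<le> t" for s t
  proof (rule integrable_const_bound[where B = 1])
    show "AE \<omega> in M. norm (C t \<omega> * J s \<omega>) \<le> 1"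
      using C1 J01 by (intro AE_I2) (auto simp: abs_mult intro!: mult_le_one)
  qed (use that in measurable)
  \<comment> \<open>The addition formula splits \<open>C t\<close> into products of a function of
    the past and a function of the increment. The sine of the increment has mean 0, the cosine has
    mean \<open>exp (- \<kappa> * (t - s))\<close>.\<close>
  have step: "expectation (\<lambda>\<omega>. C t \<omega> * J s \<omega>) = exp (- \<kappa> * (t - s)) * expectation (\<lambda>\<omega>. C s \<omega> * J s \<omega>)" if st: "0 \<le> s" "s < t" for s t
  proof -
    have cs: "expectation (\<lambda>\<omega>. cos (\<mu> * (B t \<omega> - B s \<omega>))) = exp (- \<kappa> * (t - s))" "expectation (\<lambda>\<omega>. sin (\<mu> * (B t \<omega> - B s \<omega>))) = 0"
      using normal_increment_cos_sin[OF st, of 1 \<mu>] by (simp_all add: \<kappa>_def)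
    show ?thesis
    proof (cases "s = 0")
      \<comment> \<open>At time 0 every path survives; \<open>past_indep_increment\<close> covers
        only positive \<open>s\<close>.\<close>
      case True
      have "expectation (\<lambda>\<omega>. C t \<omega> * J s \<omega>) = expectation (\<lambda>\<omega>. cos (\<mu> * (B t \<omega> - B s \<omega>)))"
        using True J0 by (intro Bochner_Integration.integral_cong refl) (simp add: C_def b_def)
      moreover have "expectation (\<lambda>\<omega>. C s \<omega> * J s \<omega>) = expectation (\<lambda>\<omega>. 1)"
        using True J0 by (intro Bochner_Integration.integral_cong refl) (simp add: C_def b_def)
      ultimately show ?thesis using cs prob_space by simp
    next
      case False
      with st have s: "0 < s" by simp
      \<comment> \<open>For the path of \<open>past s\<close>, frozen after time 1, never exiting
        means surviving up to \<open>s\<close>, and the value at time 1 is the value of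
        \<open>b\<close> at time \<open>s\<close>.\<close>
      define F where "F g y = g (\<mu> * path_at y 1) * (of_bool (path_exit I y = \<infinity>) :: real)" for g :: "real \<Rightarrow> real" and y
      have F_meas: "F g \<in> borel_measurable path_space" if [measurable]: "g \<in> borel_measurable borel" for g
        unfolding F_def[abs_def] by measurable
      have F_eq: "F g (past s \<omega>) = g (\<mu> * b s \<omega>) * J s \<omega>" if \<omega>: "\<omega> \<in> space M" for g \<omega>
      proof -
        let ?p = "\<lambda>u. b (s * min u 1) \<omega>"
        have p: "continuous_on {0..} ?p"
          using s by (intro continuous_on_compose2[OF b_cont[OF \<omega>]] continuous_intros) auto
        have past: "past s \<omega> = sample ?p" by (simp add: past_def b_def)
        have "path_exit I (sample ?p) = \<infinity> \<longleftrightarrow> (\<forall>u>0. ?p u \<in> I)"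
          unfolding path_exit_sample[OF p I(1)] top_ereal_def[symmetric] INF_top_conv by (auto simp: top_ereal_def)
        also have "\<dots> \<longleftrightarrow> (\<forall>r\<in>{0..s}. b r \<omega> \<in> I)"
        proof
          assume l: "\<forall>u>0. ?p u \<in> I"
          show "\<forall>r\<in>{0..s}. b r \<omega> \<in> I"
          proof
            fix r assume r: "r \<in> {0..s}"
            show "b r \<omega> \<in> I"
            proof (cases "r = 0")
              case False
              then show ?thesis using l[rule_format, of "r / s"] r s by (simp add: min_def)
            qed (use I in \<open>simp add: b_def\<close>)
          qed
        next
          assume r: "\<forall>r\<in>{0..s}. b r \<omega> \<in> I"
          then show "\<forall>u>0. ?p u \<in> I" using s by (auto intro!: mult_left_le)
        qed
        finally have "path_exit I (sample ?p) = \<infinity> \<longleftrightarrow> ereal s < \<sigma> \<omega>"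
          using J_iff[OF \<omega> st(1)] by simp
        then show ?thesis
          unfolding F_def past using path_at_sample[OF p, of 1] by (simp add: J_def)
      qed
      have "expectation (\<lambda>\<omega>. C t \<omega> * J s \<omega>) = expectation (\<lambda>\<omega>. F cos (past s \<omega>) * cos (\<mu> * (B t \<omega> - B s \<omega>)) - F sin (past s \<omega>) * sin (\<mu> * (B t \<omega> - B s \<omega>)))"
      proof (intro Bochner_Integration.integral_cong refl)
        fix \<omega> assume \<omega>: "\<omega> \<in> space M"
        have e: "\<mu> * b t \<omega> = \<mu> * b s \<omega> + \<mu> * (B t \<omega> - B s \<omega>)" by (simp add: b_def algebra_simps)
        show "C t \<omega> * J s \<omega> = F cos (past s \<omega>) * cos (\<mu> * (B t \<omega> - B s \<omega>)) - F sin (past s \<omega>) * sin (\<mu> * (B t \<omega> - B s \<omega>))"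
          unfolding F_eq[OF \<omega>] C_def e cos_add left_diff_distrib by (simp add: mult_ac)
      qed
      also have "\<dots> = expectation (\<lambda>\<omega>. F cos (past s \<omega>) * cos (\<mu> * (B t \<omega> - B s \<omega>))) - expectation (\<lambda>\<omega>. F sin (past s \<omega>) * sin (\<mu> * (B t \<omega> - B s \<omega>)))"
      proof -
        have i: "integrable M (\<lambda>\<omega>. F g (past s \<omega>) * h (\<mu> * (B t \<omega> - B s \<omega>)))"
          if [measurable]: "g \<in> borel_measurable borel" "h \<in> borel_measurable borel" and gh: "\<And>v. \<bar>g v\<bar> \<le> 1" "\<And>v. \<bar>h v\<bar> \<le> 1" for g h :: "real \<Rightarrow> real"
        proof (rule integrable_const_bound[where B = 1])
          show "AE \<omega> in M. norm (F g (past s \<omega>) * h (\<mu> * (B t \<omega> - B s \<omega>))) \<le> 1"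
            using gh by (intro AE_I2) (auto simp: abs_mult F_def intro!: mult_le_one)
          have [measurable]: "random_variable borel (\<lambda>\<omega>. B t \<omega> - B s \<omega>)" using st by (intro measurable_increment) auto
          have [measurable]: "(\<lambda>\<omega>. F g (past s \<omega>)) \<in> borel_measurable M"
            by (rule measurable_compose[OF measurable_past[OF st(1)] F_meas]) measurable
          show "random_variable borel (\<lambda>\<omega>. F g (past s \<omega>) * h (\<mu> * (B t \<omega> - B s \<omega>)))" by measurable
        qed
        show ?thesis by (intro Bochner_Integration.integral_diff i) auto
      qed
      also have "expectation (\<lambda>\<omega>. F cos (past s \<omega>) * cos (\<mu> * (B t \<omega> - B s \<omega>))) = expectation (\<lambda>\<omega>. F cos (past s \<omega>)) * exp (- \<kappa> * (t - s))"
        unfolding cs(1)[symmetric]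
        by (rule expectation_past_times_increment[OF s st(2) F_meas, where m = 1 and k = 1 and h = "\<lambda>v. cos (\<mu> * v)"])
          (auto simp: F_def abs_mult intro!: mult_le_one)
      also have "expectation (\<lambda>\<omega>. F sin (past s \<omega>) * sin (\<mu> * (B t \<omega> - B s \<omega>))) = expectation (\<lambda>\<omega>. F sin (past s \<omega>)) * 0"
        unfolding cs(2)[symmetric]
        by (rule expectation_past_times_increment[OF s st(2) F_meas, where m = 1 and k = 1 and h = "\<lambda>v. sin (\<mu> * v)"])
          (auto simp: F_def abs_mult intro!: mult_le_one)
      also have "expectation (\<lambda>\<omega>. F cos (past s \<omega>)) = expectation (\<lambda>\<omega>. C s \<omega> * J s \<omega>)"
        by (intro Bochner_Integration.integral_cong refl) (simp add: F_eq C_def)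
      finally show ?thesis by simp
    qed
  qed
  have main: "expectation (\<lambda>\<omega>. C T \<omega> * J T \<omega>) = exp (- \<kappa> * T)"
  proof (cases "T = 0")
    case True
    have "expectation (\<lambda>\<omega>. C T \<omega> * J T \<omega>) = expectation (\<lambda>\<omega>. 1)"
      using True J0 by (intro Bochner_Integration.integral_cong refl) (simp add: C_def b_def)
    then show ?thesis using True prob_space by simp
  next
    case False
    with T have T: "0 < T" by simp
    define \<delta> where "\<delta> N = T / real (Suc N)" for N
    have \<delta>: "0 < \<delta> N" "real (Suc N) * \<delta> N = T" for N using T by (auto simp: \<delta>_def)
    \<comment> \<open>The error made by stopping at the grid point after the exit instead of at the
      exit. The indicator \<open>J\<close> drops at most once, so at most one summand is nonzero and
      the weights sum to at most 1.\<close>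
    define R where "R N \<omega> = (\<Sum>k<Suc N. \<bar>C (real (Suc k) * \<delta> N) \<omega>\<bar> * (J (real k * \<delta> N) \<omega> - J (real (Suc k) * \<delta> N) \<omega>))" for N \<omega>
    have Jdiff: "0 \<le> J (real k * \<delta> N) \<omega> - J (real (Suc k) * \<delta> N) \<omega>" for k N \<omega>
      using J01(3)[of "real k * \<delta> N" "real (Suc k) * \<delta> N"] \<delta>(1)[of N] by (simp add: mult_right_mono)
    have Jsum: "(\<Sum>k<Suc N. J (real k * \<delta> N) \<omega> - J (real (Suc k) * \<delta> N) \<omega>) \<le> 1" for N \<omega>
      using sum_lessThan_telescope'[of "\<lambda>k. J (real k * \<delta> N) \<omega>" "Suc N"] J01(1)[of "real (Suc N) * \<delta> N" \<omega>] J01(2)[of "real 0 * \<delta> N" \<omega>] by linarith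
    have Rle: "R N \<omega> \<le> c" if "0 \<le> c" "\<And>k. J (real k * \<delta> N) \<omega> \<noteq> J (real (Suc k) * \<delta> N) \<omega> \<Longrightarrow> \<bar>C (real (Suc k) * \<delta> N) \<omega>\<bar> \<le> c" for N \<omega> c
    proof -
      have "R N \<omega> \<le> (\<Sum>k<Suc N. c * (J (real k * \<delta> N) \<omega> - J (real (Suc k) * \<delta> N) \<omega>))"
        unfolding R_def
      proof (rule sum_mono)
        fix k
        show "\<bar>C (real (Suc k) * \<delta> N) \<omega>\<bar> * (J (real k * \<delta> N) \<omega> - J (real (Suc k) * \<delta> N) \<omega>) \<le> c * (J (real k * \<delta> N) \<omega> - J (real (Suc k) * \<delta> N) \<omega>)"
          using that(2)[of k] Jdiff[of k N \<omega>]
          by (cases "J (real k * \<delta> N) \<omega> = J (real (Suc k) * \<delta> N) \<omega>") (auto intro: mult_right_mono)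
      qed
      also have "\<dots> = c * (\<Sum>k<Suc N. J (real k * \<delta> N) \<omega> - J (real (Suc k) * \<delta> N) \<omega>)" by (simp only: sum_distrib_left)
      also have "\<dots> \<le> c" using mult_left_mono[OF Jsum[of N \<omega>] that(1)] by simp
      finally show ?thesis .
    qed
    have R0: "0 \<le> R N \<omega>" for N \<omega> unfolding R_def using Jdiff by (intro sum_nonneg mult_nonneg_nonneg) auto
    have R1: "R N \<omega> \<le> 1" for N \<omega> by (rule Rle) (auto simp: C1)
    have R_meas: "R N \<in> borel_measurable M" for N
      unfolding R_def[abs_def] using \<delta>(1)[of N]
      by (intro borel_measurable_sum borel_measurable_times borel_measurable_diff borel_measurable_abs C_meas J_meas) auto
    have R_lim: "(\<lambda>N. R N \<omega>) \<longlonglongrightarrow> 0" if \<omega>: "\<omega> \<in> space M" for \<omega>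
    proof (rule LIMSEQ_I)
      fix e :: real assume e: "0 < e"
      have "\<exists>d>0. \<forall>N. \<delta> N < d \<longrightarrow> R N \<omega> \<le> e / 2"
      proof (cases "\<sigma> \<omega>")
        case (real s)
        note ep = exit_position[OF b_cont[OF \<omega>] I(1) _ real[unfolded \<sigma>_def]]
        have "0 < s" "b s \<omega> \<in> frontier I" using ep(1,2) I(2) by (auto simp: b_def)
        \<comment> \<open>The path leaves the interval at \<open>a\<close> or \<open>-a\<close>,
          where the cosine vanishes. The grid point after the exit is less than \<open>d\<close>
          later when the mesh is below \<open>d\<close>, so by continuity the cosine is small
          there.\<close>
        then have "C s \<omega> = 0" using a cosa by (auto simp: I_def C_def frontier_def)
        moreover have "continuous_on {0..} (\<lambda>r. C r \<omega>)"
          unfolding C_def using b_cont[OF \<omega>] by (intro continuous_intros)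
        ultimately obtain d where d: "0 < d" "\<And>r. 0 \<le> r \<Longrightarrow> dist r s < d \<Longrightarrow> \<bar>C r \<omega>\<bar> < e / 2"
          using e \<open>0 < s\<close> unfolding continuous_on_iff dist_real_def
          by (metis atLeast_iff diff_zero half_gt_zero less_imp_le)
        have "R N \<omega> \<le> e / 2" if N: "\<delta> N < d" for N
        proof (rule Rle)
          fix k assume "J (real k * \<delta> N) \<omega> \<noteq> J (real (Suc k) * \<delta> N) \<omega>"
          then have "real k * \<delta> N < s" "s \<le> real (Suc k) * \<delta> N"
            using Jdiff[of k N \<omega>] by (auto simp: J_def real of_bool_def split: if_splits)
          then have "dist (real (Suc k) * \<delta> N) s < d" using N by (simp add: dist_real_def algebra_simps)
          then show "\<bar>C (real (Suc k) * \<delta> N) \<omega>\<bar> \<le> e / 2" using d(2) \<delta>(1)[of N] by (simp add: less_imp_le)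
        qed (use e in simp)
        then show ?thesis using d(1) by blast
      next
        case PInf
        then have "R N \<omega> = 0" for N by (simp add: R_def J_def)
        then show ?thesis using e by (intro exI[of _ 1]) simp
      next
        case MInf
        then show ?thesis using path_exit_nonneg[of I "sample (\<lambda>s. b s \<omega>)"] by (simp add: \<sigma>_def)
      qed
      then obtain d where d: "0 < d" "\<And>N. \<delta> N < d \<Longrightarrow> R N \<omega> \<le> e / 2" by blast
      have "\<delta> \<longlonglongrightarrow> 0" unfolding \<delta>_def by (intro LIMSEQ_Suc lim_const_over_n)
      then have "\<forall>\<^sub>F N in sequentially. \<delta> N < d" using d(1) by (rule order_tendstoD)
      then obtain N0 where "\<And>N. N0 \<le> N \<Longrightarrow> \<delta> N < d" by (auto simp: eventually_sequentially)
      then show "\<exists>no. \<forall>n\<ge>no. norm (R n \<omega> - 0) < e"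
      proof (intro exI[of _ N0] allI impI)
        fix n assume "N0 \<le> n"
        then have "R n \<omega> \<le> e / 2" using d(2) \<open>\<And>N. N0 \<le> N \<Longrightarrow> \<delta> N < d\<close> by blast
        then show "norm (R n \<omega> - 0) < e" using R0[of n \<omega>] e by simp
      qed
    qed
    have ER: "(\<lambda>N. expectation (R N)) \<longlonglongrightarrow> expectation (\<lambda>_. 0)"
      by (rule integral_dominated_convergence[where w = "\<lambda>_. 1"]) (use R0 R1 R_meas R_lim in auto)
    have bnd: "\<bar>exp (\<kappa> * T) * expectation (\<lambda>\<omega>. C T \<omega> * J T \<omega>) - 1\<bar> \<le> exp (\<kappa> * T) * expectation (R N)" for N
    proof -
      let ?t = "\<lambda>k. real k * \<delta> N"
      \<comment> \<open>By \<open>step\<close>, \<open>A\<close> would be constant if the survival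
        indicator did not change; its drop over one grid interval costs at most
        \<open>exp (\<kappa> * T) * r k\<close>.\<close>
      define A where "A k = exp (\<kappa> * ?t k) * expectation (\<lambda>\<omega>. C (?t k) \<omega> * J (?t k) \<omega>)" for k
      define r where "r k = expectation (\<lambda>\<omega>. \<bar>C (?t (Suc k)) \<omega>\<bar> * (J (?t k) \<omega> - J (?t (Suc k)) \<omega>))" for k
      have t0: "0 \<le> ?t k" "?t k < ?t (Suc k)" for k using \<delta>(1)[of N] by auto
      have ir: "integrable M (\<lambda>\<omega>. \<bar>C (?t (Suc k)) \<omega>\<bar> * (J (?t k) \<omega> - J (?t (Suc k)) \<omega>))" for k
      proof (rule integrable_const_bound[where B = 1])
        have "\<bar>J (?t k) \<omega> - J (?t (Suc k)) \<omega>\<bar> \<le> 1" for \<omega> using J01(1,2)[of "?t k" \<omega>] J01(1,2)[of "?t (Suc k)" \<omega>] by linarith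
        then show "AE \<omega> in M. norm (\<bar>C (?t (Suc k)) \<omega>\<bar> * (J (?t k) \<omega> - J (?t (Suc k)) \<omega>)) \<le> 1"
          using C1 by (intro AE_I2) (auto simp: abs_mult intro!: mult_le_one)
        show "random_variable borel (\<lambda>\<omega>. \<bar>C (?t (Suc k)) \<omega>\<bar> * (J (?t k) \<omega> - J (?t (Suc k)) \<omega>))"
          using C_meas[OF t0(1)] by (intro borel_measurable_times borel_measurable_diff borel_measurable_abs J_meas)
      qed
      have diff: "\<bar>A (Suc k) - A k\<bar> \<le> exp (\<kappa> * T) * r k" if k: "k < Suc N" for k
      proof -
        have eA: "A k = exp (\<kappa> * ?t (Suc k)) * expectation (\<lambda>\<omega>. C (?t (Suc k)) \<omega> * J (?t k) \<omega>)"
          unfolding step[OF t0] A_def mult.assoc[symmetric] exp_add[symmetric] by (simp add: algebra_simps)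
        have "A (Suc k) - A k = exp (\<kappa> * ?t (Suc k)) * (expectation (\<lambda>\<omega>. C (?t (Suc k)) \<omega> * J (?t (Suc k)) \<omega>) - expectation (\<lambda>\<omega>. C (?t (Suc k)) \<omega> * J (?t k) \<omega>))"
          unfolding eA by (simp only: A_def right_diff_distrib)
        also have "expectation (\<lambda>\<omega>. C (?t (Suc k)) \<omega> * J (?t (Suc k)) \<omega>) - expectation (\<lambda>\<omega>. C (?t (Suc k)) \<omega> * J (?t k) \<omega>)
            = expectation (\<lambda>\<omega>. C (?t (Suc k)) \<omega> * J (?t (Suc k)) \<omega> - C (?t (Suc k)) \<omega> * J (?t k) \<omega>)"
          by (rule Bochner_Integration.integral_diff[symmetric]) (rule int[OF t0(1)])+
        finally have "\<bar>A (Suc k) - A k\<bar> = exp (\<kappa> * ?t (Suc k)) * \<bar>expectation (\<lambda>\<omega>. C (?t (Suc k)) \<omega> * J (?t (Suc k)) \<omega> - C (?t (Suc k)) \<omega> * J (?t k) \<omega>)\<bar>"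
          by (simp add: abs_mult)
        also have "\<dots> \<le> exp (\<kappa> * T) * r k"
        proof (rule mult_mono)
          have "?t (Suc k) \<le> real (Suc N) * \<delta> N" using k \<delta>(1)[of N] by (intro mult_right_mono) auto
          then show "exp (\<kappa> * ?t (Suc k)) \<le> exp (\<kappa> * T)" using \<delta>(2)[of N] \<kappa> by (simp add: mult_left_mono)
          show "\<bar>expectation (\<lambda>\<omega>. C (?t (Suc k)) \<omega> * J (?t (Suc k)) \<omega> - C (?t (Suc k)) \<omega> * J (?t k) \<omega>)\<bar> \<le> r k"
            unfolding r_def
          proof (rule abs_integral_le[OF Bochner_Integration.integrable_diff[OF int[OF t0(1)] int[OF t0(1)]] ir])
            fix \<omega>
            have "\<bar>C (?t (Suc k)) \<omega> * J (?t (Suc k)) \<omega> - C (?t (Suc k)) \<omega> * J (?t k) \<omega>\<bar> = \<bar>C (?t (Suc k)) \<omega>\<bar> * \<bar>J (?t (Suc k)) \<omega> - J (?t k) \<omega>\<bar>"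
              by (simp only: right_diff_distrib[symmetric] abs_mult)
            also have "\<bar>J (?t (Suc k)) \<omega> - J (?t k) \<omega>\<bar> = J (?t k) \<omega> - J (?t (Suc k)) \<omega>"
              using Jdiff[of k N \<omega>] by linarith
            finally show "\<bar>C (?t (Suc k)) \<omega> * J (?t (Suc k)) \<omega> - C (?t (Suc k)) \<omega> * J (?t k) \<omega>\<bar> \<le> \<bar>C (?t (Suc k)) \<omega>\<bar> * (J (?t k) \<omega> - J (?t (Suc k)) \<omega>)" by simp
          qed
        qed auto
        finally show ?thesis .
      qed
      have "expectation (\<lambda>\<omega>. C (?t 0) \<omega> * J (?t 0) \<omega>) = expectation (\<lambda>\<omega>. 1)"
        by (intro Bochner_Integration.integral_cong refl) (simp add: J0 C_def b_def)
      then have A0: "A 0 = 1" using prob_space by (simp add: A_def)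
      have AN: "A (Suc N) = exp (\<kappa> * T) * expectation (\<lambda>\<omega>. C T \<omega> * J T \<omega>)"
        unfolding A_def \<delta>(2) ..
      have "\<bar>A (Suc N) - A 0\<bar> = \<bar>\<Sum>k<Suc N. A (Suc k) - A k\<bar>" by (subst sum_lessThan_telescope) simp
      also have "\<dots> \<le> (\<Sum>k<Suc N. exp (\<kappa> * T) * r k)"
        by (intro order.trans[OF sum_abs] sum_mono diff) simp
      also have "\<dots> = exp (\<kappa> * T) * (\<Sum>k<Suc N. r k)" by (simp only: sum_distrib_left)
      also have "(\<Sum>k<Suc N. r k) = expectation (R N)"
        unfolding r_def R_def by (rule Bochner_Integration.integral_sum[symmetric]) (rule ir)
      finally show ?thesis unfolding A0 AN .
    qed
    have "(\<lambda>N. exp (\<kappa> * T) * expectation (R N)) \<longlonglongrightarrow> exp (\<kappa> * T) * expectation (\<lambda>_. 0)"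
      by (intro tendsto_intros ER)
    then have "\<bar>exp (\<kappa> * T) * expectation (\<lambda>\<omega>. C T \<omega> * J T \<omega>) - 1\<bar> \<le> exp (\<kappa> * T) * expectation (\<lambda>_. 0)"
      by (rule LIMSEQ_le_const) (use bnd in auto)
    then have "exp (\<kappa> * T) * expectation (\<lambda>\<omega>. C T \<omega> * J T \<omega>) = 1" by simp
    then show ?thesis by (simp add: exp_minus field_simps)
  qed
  have "(\<integral>\<omega>. cos (\<mu> * B T \<omega>) * of_bool (ereal T < path_exit {-a<..<a} (sample (\<lambda>s. B s \<omega>))) \<partial>M) = expectation (\<lambda>\<omega>. C T \<omega> * J T \<omega>)"
  proof (rule integral_cong_AE)
    have [measurable]: "(\<lambda>\<omega>. path_exit {-a<..<a} (sample (\<lambda>s. B s \<omega>))) \<in> borel_measurable M"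
      by (rule measurable_compose[OF measurable_sample[OF measurable] measurable_path_exit])
    have [measurable]: "B T \<in> borel_measurable M" by (rule measurable[OF T])
    show "(\<lambda>\<omega>. cos (\<mu> * B T \<omega>) * of_bool (ereal T < path_exit {-a<..<a} (sample (\<lambda>s. B s \<omega>)))) \<in> borel_measurable M"
      by measurable
    show "(\<lambda>\<omega>. C T \<omega> * J T \<omega>) \<in> borel_measurable M" using C_meas[OF T] by measurable
    show "AE \<omega> in M. cos (\<mu> * B T \<omega>) * of_bool (ereal T < path_exit {-a<..<a} (sample (\<lambda>s. B s \<omega>))) = C T \<omega> * J T \<omega>"
      using start by eventually_elim (simp add: C_def J_def b_def \<sigma>_def I_def)
  qed
  then show ?thesis using main by (simp add: \<kappa>_def)
qed

section \<open>Exit times and positions of continuous processes\<close>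

lemma exit_time_nonneg: "0 \<le> exit_time Z D \<omega>"
  unfolding exit_time_def by (intro INF_greatest) auto

lemma measurable_exit_time:
  fixes Z :: "real \<Rightarrow> 'w \<Rightarrow> 'a::euclidean_space"
  assumes Z_meas: "\<And>t. 0 \<le> t \<Longrightarrow> Z t \<in> borel_measurable M"
    and Z_cont: "\<And>\<omega>. \<omega> \<in> space M \<Longrightarrow> continuous_on {0..} (\<lambda>t. Z t \<omega>)" and D: "open D"
  shows "exit_time Z D \<in> borel_measurable M"
proof -
  have "(\<lambda>\<omega>. path_exit D (sample (\<lambda>t. Z t \<omega>))) \<in> borel_measurable M"
    by (rule measurable_compose[OF measurable_sample[OF Z_meas] measurable_path_exit])
  moreover have "path_exit D (sample (\<lambda>t. Z t \<omega>)) = exit_time Z D \<omega>" if "\<omega> \<in> space M" for \<omega>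
    by (rule path_exit_sample_eq[where Z = Z and \<omega> = \<omega>, OF Z_cont[OF that] D])
  ultimately show ?thesis by (simp cong: measurable_cong)
qed

lemma measurable_stopped:
  fixes Z :: "real \<Rightarrow> 'w \<Rightarrow> 'a::euclidean_space"
  assumes Z_meas: "\<And>t. 0 \<le> t \<Longrightarrow> Z t \<in> borel_measurable M"
    and Z_cont: "\<And>\<omega>. \<omega> \<in> space M \<Longrightarrow> continuous_on {0..} (\<lambda>t. Z t \<omega>)"
    and T [measurable]: "T \<in> borel_measurable M" and T0: "\<And>\<omega>. 0 \<le> T \<omega>"
  shows "stopped Z T \<in> borel_measurable M"
proof -
  have "(\<lambda>\<omega>. path_at (sample (\<lambda>t. Z t \<omega>)) (real_of_ereal (T \<omega>))) \<in> borel_measurable M"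
    by (intro measurable_path_at measurable_sample Z_meas) measurable
  moreover have "path_at (sample (\<lambda>t. Z t \<omega>)) (real_of_ereal (T \<omega>)) = stopped Z T \<omega>" if "\<omega> \<in> space M" for \<omega>
    unfolding stopped_def by (rule path_at_sample[OF Z_cont[OF that] real_of_ereal_pos[OF T0]])
  ultimately show ?thesis by (simp cong: measurable_cong)
qed

section \<open>The panharmonic measure\<close>

locale brownian_family =
  fixes P :: "'a::euclidean_space \<Rightarrow> 'w measure" and W :: "real \<Rightarrow> 'w \<Rightarrow> 'a"
  assumes brownian: "\<And>z. brownian_motion (P z) W z"
begin

sublocale BM: brownian_motion "P z" W z for z
  by (rule brownian)

definition exit_mean :: "real \<Rightarrow> 'a set \<Rightarrow> ('a \<Rightarrow> real) \<Rightarrow> 'a \<Rightarrow> real" where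
  "exit_mean \<kappa> D f z = (\<integral>\<omega>. exit_value \<kappa> D f (sample (\<lambda>s. W s \<omega>)) \<partial>P z)"

text \<open>The laws \<open>P z\<close> for all starting points are replaced by the single law
  \<open>P y\<close>, with \<open>y\<close> arbitrary; smoothness and limits in \<open>z\<close>
  become accessible.\<close>

lemma exit_mean_eq:
  assumes "f \<in> borel_measurable borel"
  shows "exit_mean \<kappa> D f = brownian_motion.mean_from (P y) W (exit_value \<kappa> D f)"
  unfolding exit_mean_def using BM.expectation_path_functional[OF brownian measurable_exit_value[OF assms]] by blast

definition exit_weight :: "real \<Rightarrow> 'a set \<Rightarrow> 'w \<Rightarrow> real" where
  "exit_weight \<kappa> D \<omega> = (if exit_time W D \<omega> < \<infinity> then exp (- \<kappa> * real_of_ereal (exit_time W D \<omega>)) else 0)"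

text \<open>The weight vanishes where the exit time is infinite, which hides the meaningless stopped
  position there. For a pole in \<open>D\<close> the restriction to the frontier loses no mass, by
  \<open>stopped_in_frontier\<close>.\<close>

definition exit_measure :: "real \<Rightarrow> 'a set \<Rightarrow> 'a \<Rightarrow> 'a measure" where
  "exit_measure \<kappa> D x = restrict_space
     (distr (density (P x) (\<lambda>\<omega>. ennreal (exit_weight \<kappa> D \<omega>))) borel (stopped W (exit_time W D))) (frontier D)"

context
  fixes D :: "'a set"
  assumes D: "open D"
begin

lemma measurable_exit_time_W [measurable]: "exit_time W D \<in> borel_measurable (P x)"
  by (rule measurable_exit_time[OF BM.measurable BM.continuous_paths D])

lemma measurable_stopped_W [measurable]: "stopped W (exit_time W D) \<in> borel_measurable (P x)"
  by (rule measurable_stopped[OF BM.measurable BM.continuous_paths measurable_exit_time_W exit_time_nonneg])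

lemma measurable_exit_weight [measurable]: "exit_weight \<kappa> D \<in> borel_measurable (P x)"
  unfolding exit_weight_def[abs_def] by measurable

lemma exit_weight_nonneg: "0 \<le> exit_weight \<kappa> D \<omega>"
  by (simp add: exit_weight_def)

lemma exit_weight_le:
  assumes "0 \<le> \<kappa>"
  shows "exit_weight \<kappa> D \<omega> \<le> 1"
  using assms real_of_ereal_pos[OF exit_time_nonneg[of W D \<omega>]] by (simp add: exit_weight_def)

lemma stopped_in_frontier:
  assumes x: "x \<in> D"
  shows "AE \<omega> in P x. exit_time W D \<omega> < \<infinity> \<longrightarrow> stopped W (exit_time W D) \<omega> \<in> frontier D"
  using BM.start[of x] AE_space
proof eventually_elim
  case (elim \<omega>)
  show ?case
  proof
    assume "exit_time W D \<omega> < \<infinity>"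
    then obtain \<tau> where \<tau>: "exit_time W D \<omega> = ereal \<tau>"
      using exit_time_nonneg[of W D \<omega>] by (cases "exit_time W D \<omega>") auto
    have c: "continuous_on {0..} (\<lambda>s. W s \<omega>)" using elim(2) by (rule BM.continuous_paths)
    have "path_exit D (sample (\<lambda>s. W s \<omega>)) = ereal \<tau>" using path_exit_sample_eq[of W \<omega> D, OF c D] \<tau> by simp
    from exit_position(2)[OF c D _ this] elim(1) x show "stopped W (exit_time W D) \<omega> \<in> frontier D"
      by (simp add: stopped_def \<tau>)
  qed
qed

lemma exit_value_eq_weight:
  assumes "\<omega> \<in> space (P x)"
  shows "exit_value \<kappa> D f (sample (\<lambda>s. W s \<omega>)) = exit_weight \<kappa> D \<omega> * f (stopped W (exit_time W D) \<omega>)"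
proof -
  have c: "continuous_on {0..} (\<lambda>s. W s \<omega>)" using assms by (rule BM.continuous_paths)
  show ?thesis
    unfolding exit_value_def path_exit_sample_eq[of W \<omega> D, OF c D] exit_weight_def stopped_def
      path_at_sample[OF c real_of_ereal_pos[OF exit_time_nonneg]] by simp
qed

lemma sets_exit_measure: "sets (exit_measure \<kappa> D x) = sets (restrict_space borel (frontier D))"
  by (simp add: exit_measure_def sets_restrict_space)

lemma space_exit_measure: "space (exit_measure \<kappa> D x) = frontier D"
  by (simp add: exit_measure_def space_restrict_space)

lemma has_integral_exit_measure:
  assumes x: "x \<in> D" and \<kappa>: "0 \<le> \<kappa>" and f [measurable]: "f \<in> borel_measurable borel" and f_le: "\<And>v. \<bar>f v\<bar> \<le> m"
  shows "has_bochner_integral (exit_measure \<kappa> D x) f (exit_mean \<kappa> D f x)"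
proof -
  let ?S = "stopped W (exit_time W D)"
  let ?g = "\<lambda>\<omega>. exit_weight \<kappa> D \<omega> * (indicator (frontier D) (?S \<omega>) * f (?S \<omega>))"
  have [measurable]: "frontier D \<in> sets borel" by (intro borel_closed frontier_closed)
  have m: "0 \<le> m" using f_le[of undefined] by linarith
  have i: "integrable (P x) ?g"
  proof (rule BM.integrable_const_bound[where B = m])
    have "\<bar>?g \<omega>\<bar> \<le> 1 * (1 * m)" for \<omega>
      unfolding abs_mult using exit_weight_nonneg exit_weight_le[OF \<kappa>] f_le m by (intro mult_mono) auto
    then show "AE \<omega> in P x. norm (?g \<omega>) \<le> m" by simp
  qed measurable
  have "(\<integral>\<omega>. ?g \<omega> \<partial>P x) = exit_mean \<kappa> D f x"
    unfolding exit_mean_def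
  proof (rule integral_cong_AE)
    show "(\<lambda>\<omega>. exit_value \<kappa> D f (sample (\<lambda>s. W s \<omega>))) \<in> borel_measurable (P x)"
      by (rule measurable_compose[OF measurable_sample[OF BM.measurable] measurable_exit_value[OF f]])
    show "AE \<omega> in P x. ?g \<omega> = exit_value \<kappa> D f (sample (\<lambda>s. W s \<omega>))"
      using stopped_in_frontier[OF x] AE_space
    proof eventually_elim
      case (elim \<omega>)
      then show ?case
        unfolding exit_value_eq_weight[OF elim(2)] by (auto simp: exit_weight_def split: split_indicator)
    qed
  qed measurable
  with i have "has_bochner_integral (P x) ?g (exit_mean \<kappa> D f x)"
    by (simp add: has_bochner_integral_iff)
  then show ?thesis
    unfolding exit_measure_def
    by (subst has_bochner_integral_restrict_space)
      (auto simp: has_bochner_integral_iff integrable_distr_eq integral_distr integrable_density integral_density exit_weight_nonneg)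
qed

lemma emeasure_exit_measure:
  assumes \<kappa>: "0 \<le> \<kappa>" and A: "A \<in> sets borel" "A \<subseteq> frontier D"
  shows "emeasure (exit_measure \<kappa> D x) A = ennreal (\<integral>\<omega>. exit_weight \<kappa> D \<omega> * indicator A (stopped W (exit_time W D) \<omega>) \<partial>P x)"
proof -
  let ?S = "stopped W (exit_time W D)"
  have [measurable]: "A \<in> sets borel" by (rule A)
  have F: "frontier D \<in> sets borel" by (intro borel_closed frontier_closed)
  have "emeasure (exit_measure \<kappa> D x) A = emeasure (distr (density (P x) (\<lambda>\<omega>. ennreal (exit_weight \<kappa> D \<omega>))) borel ?S) A"
    unfolding exit_measure_def using F A by (intro emeasure_restrict_space) auto
  also have "\<dots> = (\<integral>\<^sup>+\<omega>. ennreal (exit_weight \<kappa> D \<omega>) * indicator (?S -` A \<inter> space (P x)) \<omega> \<partial>P x)"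
    by (subst emeasure_distr) (auto simp: emeasure_density)
  also have "\<dots> = (\<integral>\<^sup>+\<omega>. ennreal (exit_weight \<kappa> D \<omega> * indicator A (?S \<omega>)) \<partial>P x)"
    by (intro nn_integral_cong) (auto split: split_indicator)
  also have "\<dots> = ennreal (\<integral>\<omega>. exit_weight \<kappa> D \<omega> * indicator A (?S \<omega>) \<partial>P x)"
  proof (rule nn_integral_eq_integral)
    show "integrable (P x) (\<lambda>\<omega>. exit_weight \<kappa> D \<omega> * indicator A (?S \<omega>))"
      by (rule BM.integrable_const_bound[where B = 1])
        (use exit_weight_nonneg exit_weight_le[OF \<kappa>] in \<open>auto simp: abs_mult split: split_indicator\<close>)
  qed (auto simp: exit_weight_nonneg)
  finally show ?thesis .
qed

end

lemma dirichlet_solution: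
  assumes reg: "regular_domain P W D" and f: "continuous_on UNIV f" and f_le: "\<And>v. \<bar>f v\<bar> \<le> m"
  shows "panharmonic_on \<mu> D (exit_mean (\<mu>\<^sup>2 / 2) D f)"
    and "\<And>z. \<bar>exit_mean (\<mu>\<^sup>2 / 2) D f z\<bar> \<le> m"
    and "\<And>y. y \<in> frontier D \<Longrightarrow> exit_mean (\<mu>\<^sup>2 / 2) D f y = f y"
    and "continuous_on (closure D) (exit_mean (\<mu>\<^sup>2 / 2) D f)"
proof -
  let ?u = "exit_mean (\<mu>\<^sup>2 / 2) D f"
  have D: "open D" using reg by (simp add: regular_domain_def)
  have fm: "f \<in> borel_measurable borel" by (rule borel_measurable_continuous_onI[OF f])
  have \<kappa>: "0 \<le> \<mu>\<^sup>2 / 2" by simp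
  note eq = exit_mean_eq[OF fm, of "\<mu>\<^sup>2 / 2" D]
  show pan: "panharmonic_on \<mu> D ?u"
    unfolding eq[of undefined] by (rule BM.mean_exit_value_panharmonic[OF D fm f_le])
  show "\<bar>?u z\<bar> \<le> m" for z
    unfolding eq[of undefined] by (rule BM.abs_mean_from_le[OF measurable_exit_value[OF fm] abs_exit_value_le[OF \<kappa> f_le]])
  have lim: "(?u \<longlongrightarrow> f y) (nhds y)" if y: "y \<in> frontier D" for y
    unfolding eq[of y]
  proof (rule BM.mean_exit_value_tendsto[OF D f f_le \<kappa>])
    have "AE \<omega> in P y. exit_time W D \<omega> = 0" using reg y by (simp add: regular_domain_def)
    then show "AE \<omega> in P y. path_exit D (sample (\<lambda>s. y + (W s \<omega> - W 0 \<omega>))) = 0"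
      using BM.start[of y] AE_space
    proof eventually_elim
      case (elim \<omega>)
      then show ?case using path_exit_sample_eq[of W \<omega> D, OF BM.continuous_paths[OF elim(3)] D] by simp
    qed
  qed
  show bdry: "?u y = f y" if y: "y \<in> frontier D" for y
  proof -
    \<comment> \<open>A property that holds eventually in \<open>nhds y\<close> holds at
      \<open>y\<close>, so the value at \<open>y\<close> is within every \<open>e\<close> of
      \<open>f y\<close>.\<close>
    have "((\<lambda>_. ?u y) \<longlongrightarrow> f y) (at y)"
    proof (rule tendstoI)
      fix e :: real assume "0 < e"
      from eventually_nhds_x_imp_x[OF tendstoD[OF lim[OF y] this]]
      show "\<forall>\<^sub>F x in at y. dist (?u y) (f y) < e" by simp
    qed
    then show ?thesis by (simp add: tendsto_const_iff)
  qed
  show "continuous_on (closure D) ?u"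
  proof (rule continuous_at_imp_continuous_on, rule ballI)
    fix z assume z: "z \<in> closure D"
    show "isCont ?u z"
    proof (cases "z \<in> D")
      case True
      then have "?u differentiable (at z)" using pan by (simp add: panharmonic_on_def C2_on_def)
      then show ?thesis by (rule differentiable_imp_continuous_within)
    next
      case False
      then have "z \<in> frontier D" using z D by (simp add: frontier_def interior_open)
      then show ?thesis using lim bdry tendsto_at_iff_tendsto_nhds[of ?u z] by (simp add: isCont_def)
    qed
  qed
qed

end

text \<open>Tietze extension: boundary data live on the frontier, whereas the results on
  \<open>exit_mean\<close> ask for a bounded continuous function on the whole space.\<close>

lemma bounded_continuous_extension:
  fixes f :: "'a::euclidean_space \<Rightarrow> real"
  assumes "closed S" "continuous_on S f" "bounded (f ` S)"
  obtains g m where "continuous_on UNIV g" "\<And>v. \<bar>g v\<bar> \<le> m" "\<And>y. y \<in> S \<Longrightarrow> g y = f y"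
proof -
  obtain B where B: "\<And>y. y \<in> S \<Longrightarrow> \<bar>f y\<bar> \<le> B" using assms(3) by (auto simp: bounded_iff)
  define B' where "B' = max B 0"
  have B': "\<And>y. y \<in> S \<Longrightarrow> norm (f y) \<le> B'" using B by (auto simp: B'_def le_max_iff_disj)
  obtain g where "continuous_on UNIV g" "\<And>y. y \<in> S \<Longrightarrow> g y = f y" "\<And>v. v \<in> UNIV \<Longrightarrow> norm (g v) \<le> B'"
    using Tietze[of S f UNIV B'] assms B' by (auto simp: B'_def)
  then show thesis using that[of g B'] by auto
qed

text \<open>Bounded continuous functions of the distance to a closed set decrease to its indicator,
  and closed sets form an intersection-stable generator. The detour through \<open>distr\<close>
  moves the measures from the subspace \<open>F\<close> to the whole space.\<close>

lemma finite_measure_eqI_closed: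
  fixes H H' :: "'a::euclidean_space measure"
  assumes F: "closed F" and H: "sets H = sets (restrict_space borel F)" "finite_measure H"
    and H': "sets H' = sets (restrict_space borel F)" "finite_measure H'"
    and eq: "\<And>f :: 'a \<Rightarrow> real. continuous_on UNIV f \<Longrightarrow> (\<And>v. \<bar>f v\<bar> \<le> 1) \<Longrightarrow> (\<integral>y. f y \<partial>H) = (\<integral>y. f y \<partial>H')"
  shows "H = H'"
proof -
  interpret H: finite_measure H by fact
  interpret H': finite_measure H' by fact
  have sp: "space H = F" "space H' = F"
    using sets_eq_imp_space_eq[OF H(1)] sets_eq_imp_space_eq[OF H'(1)] by (auto simp: space_restrict_space)
  have FM: "F \<in> sets borel" using F by (rule borel_closed)
  have id: "(\<lambda>x. x) \<in> measurable H borel" "(\<lambda>x. x) \<in> measurable H' borel"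
    using measurable_restrict_space1[OF measurable_ident, of borel F] 
    by (auto simp: measurable_cong_sets[OF H(1) refl] measurable_cong_sets[OF H'(1) refl] id_def)
  have closed_eq: "emeasure (distr H borel (\<lambda>x. x)) S = emeasure (distr H' borel (\<lambda>x. x)) S" if S: "closed S" for S
  proof (cases "S = {}")
    case False
    have Sm: "S \<in> sets borel" using S by (rule borel_closed)
    define f where "f k y = max 0 (1 - real k * infdist y S)" for k y
    have f_cont: "continuous_on UNIV (f k)" for k unfolding f_def by (intro continuous_intros)
    have f1: "\<bar>f k y\<bar> \<le> 1" for k y using infdist_nonneg[of y S] by (auto simp: f_def)
    have f_lim: "(\<lambda>k. f k y) \<longlonglongrightarrow> indicator S y" for y
    proof (cases "y \<in> S")
      case True
      then show ?thesis by (simp add: f_def)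
    next
      case n: False
      then have pos: "0 < infdist y S" using S False by (simp add: infdist_pos_not_in_closed)
      obtain K where "1 < real K * infdist y S" using pos by (metis reals_Archimedean3)
      then have "f k y = 0" if "K \<le> k" for k
      proof -
        have "real K * infdist y S \<le> real k * infdist y S" using that pos by (intro mult_right_mono) auto
        then show ?thesis using \<open>1 < real K * infdist y S\<close> by (simp add: f_def)
      qed
      then have "\<forall>\<^sub>F k in sequentially. f k y = 0" by (auto simp: eventually_sequentially)
      then show ?thesis using n by (simp add: tendsto_eventually)
    qed
    have lims: "(\<lambda>k. \<integral>y. f k y \<partial>N) \<longlonglongrightarrow> measure N (S \<inter> F)"
      if N: "finite_measure N" "(\<lambda>x. x) \<in> measurable N borel" "space N = F" for N :: "'a measure"
    proof -
      interpret N: finite_measure N by fact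
      have "(\<lambda>k. \<integral>y. f k y \<partial>N) \<longlonglongrightarrow> (\<integral>y. indicator S y \<partial>N)"
      proof (rule integral_dominated_convergence[where w = "\<lambda>_. 1"])
        show "f k \<in> borel_measurable N" for k
          using measurable_compose[OF N(2) borel_measurable_continuous_onI[OF f_cont[of k]]] .
        show "(indicator S :: 'a \<Rightarrow> real) \<in> borel_measurable N"
          using measurable_compose[OF N(2) borel_measurable_indicator[OF Sm]] .
      qed (auto simp: f_lim f1)
      also have "(\<integral>y. indicator S y \<partial>N) = measure N (S \<inter> F)"
        using N(3) by simp
      finally show ?thesis .
    qed
    have "measure H (S \<inter> F) = measure H' (S \<inter> F)"
      using lims[OF H(2) id(1) sp(1)] lims[OF H'(2) id(2) sp(2)] eq[OF f_cont f1] by (simp add: LIMSEQ_unique)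
    then show ?thesis
      using id Sm sp by (simp add: emeasure_distr H.emeasure_eq_measure H'.emeasure_eq_measure)
  qed simp
  have d: "distr H borel (\<lambda>x. x) = distr H' borel (\<lambda>x. x)"
  proof (rule measure_eqI_generator_eq[where E = "{S. closed S}" and \<Omega> = UNIV and A = "\<lambda>_. UNIV"])
    show "Int_stable {S. closed (S :: 'a set)}" by (auto simp: Int_stable_def)
    show "sets (distr H borel (\<lambda>x. x)) = sigma_sets UNIV {S. closed S}" "sets (distr H' borel (\<lambda>x. x)) = sigma_sets UNIV {S. closed S}"
      by (simp_all add: borel_eq_closed)
    show "emeasure (distr H borel (\<lambda>x. x)) UNIV \<noteq> \<infinity>"
      using id(1) by (subst emeasure_distr) (auto simp: H.emeasure_eq_measure)
  qed (auto simp: closed_eq)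
  show ?thesis
  proof (rule measure_eqI)
    show "sets H = sets H'" using H H' by simp
    fix A assume A: "A \<in> sets H"
    then have "A \<in> sets borel" "A \<subseteq> F" using H(1) FM by (auto simp: sets_restrict_space_iff)
    moreover have "emeasure (distr H borel (\<lambda>x. x)) A = emeasure (distr H' borel (\<lambda>x. x)) A" unfolding d ..
    ultimately show "emeasure H A = emeasure H' A"
      using id sp by (simp add: emeasure_distr Int_absorb2)
  qed
qed

section \<open>Existence and uniqueness of the panharmonic measure\<close>

context brownian_family
begin

context
  fixes D :: "'a set" and \<mu> :: real and x :: 'a
  assumes reg: "regular_domain P W D" and \<mu>: "0 < \<mu>" and x: "x \<in> D"
begin

lemma open_D: "open D"
  using reg by (simp add: regular_domain_def)

lemma exit_mean_eq_solution:
  assumes u: "continuous_on (closure D) u" "bounded (u ` closure D)" "panharmonic_on \<mu> D u"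
    and f: "continuous_on UNIV f" "\<And>v. \<bar>f v\<bar> \<le> m" and eq: "\<And>y. y \<in> frontier D \<Longrightarrow> f y = u y"
  shows "exit_mean (\<mu>\<^sup>2 / 2) D f x = u x"
proof -
  note s = dirichlet_solution[OF reg f]
  have "bounded (exit_mean (\<mu>\<^sup>2 / 2) D f ` closure D)" using s(2) by (auto simp: bounded_iff)
  moreover have "x \<in> closure D" using x closure_subset by blast
  ultimately show ?thesis
    using panharmonic_unique[OF \<mu> open_D s(4) _ s(1) u, of x] s(3) eq by simp
qed

text \<open>A test function \<open>u\<close> agrees on the frontier with a continuous extension
  \<open>g\<close>, and the measure sees only the frontier. The exit mean of \<open>g\<close> is a
  bounded solution with the same boundary values, so it equals \<open>u\<close>.\<close>

theorem exit_measure_is_panharmonic: "is_panharmonic_measure \<mu> D x (exit_measure (\<mu>\<^sup>2 / 2) D x)"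
  unfolding is_panharmonic_measure_def
proof (intro conjI allI impI sets_exit_measure[OF open_D])
  fix u assume u: "continuous_on (closure D) u \<and> bounded (u ` closure D) \<and> panharmonic_on \<mu> D u"
  have sub: "frontier D \<subseteq> closure D" by (simp add: frontier_def)
  obtain g m where g: "continuous_on UNIV g" "\<And>v. \<bar>g v\<bar> \<le> m" "\<And>y. y \<in> frontier D \<Longrightarrow> g y = u y"
    by (rule bounded_continuous_extension[of "frontier D" u])
      (use u sub in \<open>auto intro: continuous_on_subset bounded_subset[OF _ image_mono]\<close>)
  have "has_bochner_integral (exit_measure (\<mu>\<^sup>2 / 2) D x) g (exit_mean (\<mu>\<^sup>2 / 2) D g x)"
    by (rule has_integral_exit_measure[OF open_D x _ borel_measurable_continuous_onI[OF g(1)] g(2)]) simp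
  then have "has_bochner_integral (exit_measure (\<mu>\<^sup>2 / 2) D x) g (u x)"
    using exit_mean_eq_solution[of u g m] u g by simp
  then show "has_bochner_integral (exit_measure (\<mu>\<^sup>2 / 2) D x) u (u x)"
    by (subst (asm) has_bochner_integral_cong[where g = u]) (auto simp: space_exit_measure[OF open_D] g(3))
qed

text \<open>Every bounded continuous \<open>f\<close> is the boundary value of the bounded
  panharmonic function \<open>exit_mean\<close>, so the defining property prescribes the integral of
  \<open>f\<close>. The case \<open>f = 1\<close> shows that the measure is finite.\<close>

theorem panharmonic_measure_unique:
  assumes H: "is_panharmonic_measure \<mu> D x H"
  shows "H = exit_measure (\<mu>\<^sup>2 / 2) D x"
proof -
  let ?E = "exit_measure (\<mu>\<^sup>2 / 2) D x"
  have bnd: "bounded (exit_mean (\<mu>\<^sup>2 / 2) D f ` closure D)" if "continuous_on UNIV f" "\<And>v. \<bar>f v\<bar> \<le> 1" for f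
    using dirichlet_solution(2)[OF reg that] by (auto simp: bounded_iff)
  have int: "has_bochner_integral N f (exit_mean (\<mu>\<^sup>2 / 2) D f x)"
    if N: "is_panharmonic_measure \<mu> D x N" and f: "continuous_on UNIV f" "\<And>v. \<bar>f v\<bar> \<le> 1" for N f
  proof -
    note s = dirichlet_solution[where f = f and \<mu> = \<mu>, OF reg f]
    have sp: "space N = frontier D"
      using N sets_eq_imp_space_eq[of N "restrict_space borel (frontier D)"] by (simp add: is_panharmonic_measure_def space_restrict_space)
    have "has_bochner_integral N (exit_mean (\<mu>\<^sup>2 / 2) D f) (exit_mean (\<mu>\<^sup>2 / 2) D f x)"
      using N s bnd[OF f] by (simp add: is_panharmonic_measure_def)
    then show ?thesis
      by (subst (asm) has_bochner_integral_cong[where g = f]) (auto simp: sp s(3))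
  qed
  have fin: "finite_measure N" if N: "is_panharmonic_measure \<mu> D x N" for N
  proof
    have "integrable N (\<lambda>_. 1 :: real)" using int[OF N, of "\<lambda>_. 1"] by (auto intro: integrable.intros)
    then show "emeasure N (space N) \<noteq> \<infinity>" by (auto simp: integrable_iff_bounded)
  qed
  show ?thesis
  proof (rule finite_measure_eqI_closed[OF frontier_closed[of D]])
    show "(\<integral>y. f y \<partial>H) = (\<integral>y. f y \<partial>?E)" if "continuous_on UNIV f" "\<And>v. \<bar>f v\<bar> \<le> 1" for f :: "'a \<Rightarrow> real"
      using int[OF H that] int[OF exit_measure_is_panharmonic that] by (simp add: has_bochner_integral_iff)
  qed (use H fin[OF H] fin[OF exit_measure_is_panharmonic] exit_measure_is_panharmonic in \<open>auto simp: is_panharmonic_measure_def\<close>)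
qed

end

end

section \<open>Independent processes\<close>

text \<open>On the measurable space \<open>?M\<close>, whose events are those generated by
  \<open>Z\<close>, all \<open>Z t\<close> with nonnegative \<open>t\<close> and hence the sampled
  path are measurable.\<close>

lemma (in prob_space) generated_events_functional:
  fixes Z :: "real \<Rightarrow> 'a \<Rightarrow> 'b::topological_space"
  assumes F: "F \<in> measurable path_space N" and B: "B \<in> sets N"
  shows "(\<lambda>\<omega>. F (sample (\<lambda>t. Z t \<omega>))) -` B \<inter> space M \<in> generated_events M Z"
proof -
  let ?G = "\<Union>t\<in>{0..}. {Z t -` A \<inter> space M | A. A \<in> sets borel}"
  let ?M = "sigma (space M) ?G"
  have sets: "sets ?M = generated_events M Z" and sp: "space ?M = space M"
    by (subst sets_measure_of space_measure_of; auto simp: generated_events_def)+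
  have "Z t \<in> borel_measurable ?M" if "0 \<le> t" for t
  proof (rule measurableI)
    fix A :: "'b set" assume "A \<in> sets borel"
    then show "Z t -` A \<inter> space ?M \<in> sets ?M"
      unfolding sets sp generated_events_def using that by (intro sigma_sets.Basic) auto
  qed simp
  then have "(\<lambda>\<omega>. F (sample (\<lambda>t. Z t \<omega>))) \<in> measurable ?M N"
    by (intro measurable_compose[OF measurable_sample F])
  from measurable_sets[OF this B] show ?thesis unfolding sets sp .
qed

lemma sigma_sets_subset_generated_events:
  assumes "S \<subseteq> generated_events M Z"
  shows "sigma_sets (space M) S \<subseteq> generated_events M Z"
  using assms unfolding generated_events_def by (rule sigma_sets_mono)

lemma (in prob_space) independent_functionals:
  fixes Z :: "real \<Rightarrow> 'a \<Rightarrow> 'b::topological_space" and Z' :: "real \<Rightarrow> 'a \<Rightarrow> 'c::topological_space"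
  assumes ind: "independent_processes M Z Z'"
    and Z: "\<And>t. 0 \<le> t \<Longrightarrow> random_variable borel (Z t)" and Z': "\<And>t. 0 \<le> t \<Longrightarrow> random_variable borel (Z' t)"
    and F: "F \<in> measurable path_space N" and F': "F' \<in> measurable path_space N'"
  shows "indep_var N (\<lambda>\<omega>. F (sample (\<lambda>t. Z t \<omega>))) N' (\<lambda>\<omega>. F' (sample (\<lambda>t. Z' t \<omega>)))"
  unfolding indep_var_eq
proof (intro conjI)
  let ?X = "\<lambda>\<omega>. F (sample (\<lambda>t. Z t \<omega>))" and ?X' = "\<lambda>\<omega>. F' (sample (\<lambda>t. Z' t \<omega>))"
  show "random_variable N ?X" by (rule measurable_compose[OF measurable_sample[OF Z] F])
  show "random_variable N' ?X'" by (rule measurable_compose[OF measurable_sample[OF Z'] F'])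
  have "indep_sets (case_bool (generated_events M Z) (generated_events M Z')) UNIV"
    using ind by (simp add: independent_processes_def indep_set_def)
  moreover have "sigma_sets (space M) {?X -` A \<inter> space M | A. A \<in> sets N} \<subseteq> generated_events M Z"
    by (rule sigma_sets_subset_generated_events) (use generated_events_functional[OF F] in blast)
  moreover have "sigma_sets (space M) {?X' -` A \<inter> space M | A. A \<in> sets N'} \<subseteq> generated_events M Z'"
    by (rule sigma_sets_subset_generated_events) (use generated_events_functional[OF F'] in blast)
  ultimately show "indep_set (sigma_sets (space M) {?X -` A \<inter> space M | A. A \<in> sets N}) (sigma_sets (space M) {?X' -` A \<inter> space M | A. A \<in> sets N'})"
    unfolding indep_set_def by (elim indep_sets_mono_sets) (auto split: bool.split)
qed

text \<open>Freezing: by Fubini for the product law, \<open>X\<close> may be held fixed while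
  \<open>Y\<close> is averaged over an independent sample \<omega>'.\<close>

lemma (in prob_space) independent_expectation:
  fixes X Y :: "'a \<Rightarrow> 'b" and h :: "'b \<Rightarrow> 'b \<Rightarrow> real"
  assumes ind: "indep_var N X N' Y" and h [measurable]: "case_prod h \<in> borel_measurable (N \<Otimes>\<^sub>M N')"
    and h_le: "\<And>x y. \<bar>h x y\<bar> \<le> c"
  shows "expectation (\<lambda>\<omega>. h (X \<omega>) (Y \<omega>)) = expectation (\<lambda>\<omega>. \<integral>\<omega>'. h (X \<omega>) (Y \<omega>') \<partial>M)"
proof -
  have X [measurable]: "random_variable N X" and Y [measurable]: "random_variable N' Y"
    using ind by (auto dest: indep_var_rv1 indep_var_rv2)
  interpret X: prob_space "distr M N X" by (rule prob_space_distr) measurable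
  interpret Y: prob_space "distr M N' Y" by (rule prob_space_distr) measurable
  interpret P: pair_prob_space "distr M N X" "distr M N' Y" ..
  have "expectation (\<lambda>\<omega>. h (X \<omega>) (Y \<omega>)) = (\<integral>z. case_prod h z \<partial>distr M (N \<Otimes>\<^sub>M N') (\<lambda>\<omega>. (X \<omega>, Y \<omega>)))"
    by (subst integral_distr) auto
  also have "distr M (N \<Otimes>\<^sub>M N') (\<lambda>\<omega>. (X \<omega>, Y \<omega>)) = distr M N X \<Otimes>\<^sub>M distr M N' Y"
    using ind by (simp add: indep_var_distribution_eq)
  also have "(\<integral>z. case_prod h z \<partial>(distr M N X \<Otimes>\<^sub>M distr M N' Y)) = (\<integral>x. \<integral>y. case_prod h (x, y) \<partial>distr M N' Y \<partial>distr M N X)"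
    by (rule P.integral_fst'[symmetric], rule P.integrable_const_bound[where B = c]) (auto simp: h_le)
  also have "\<dots> = (\<integral>x. (\<integral>\<omega>'. h x (Y \<omega>') \<partial>M) \<partial>distr M N X)"
  proof (intro Bochner_Integration.integral_cong refl)
    fix x assume "x \<in> space (distr M N X)"
    then have "x \<in> space N" by simp
    then have "h x \<in> borel_measurable N'"
      using measurable_Pair2[OF h] by simp
    then show "(\<integral>y. case_prod h (x, y) \<partial>distr M N' Y) = (\<integral>\<omega>'. h x (Y \<omega>') \<partial>M)"
      by (simp add: integral_distr)
  qed
  also have "\<dots> = expectation (\<lambda>\<omega>. \<integral>\<omega>'. h (X \<omega>) (Y \<omega>') \<partial>M)"
  proof (rule integral_distr[OF X])
    have "(\<lambda>z. case_prod h (fst z, Y (snd z))) \<in> borel_measurable (N \<Otimes>\<^sub>M M)"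
      by measurable
    then show "(\<lambda>x. \<integral>\<omega>'. h x (Y \<omega>') \<partial>M) \<in> borel_measurable N"
      by (intro borel_measurable_lebesgue_integral) (simp add: case_prod_beta')
  qed
  finally show ?thesis .
qed

section \<open>The two representations\<close>

text \<open>A strict bound at each time passes to the supremum because a continuous path attains its
  maximum on the compact interval.\<close>

lemma SUP_abs_less_iff:
  fixes p :: "real \<Rightarrow> real"
  assumes p: "continuous_on {0..} p" and \<tau>: "0 \<le> \<tau>"
  shows "(SUP t\<in>{t. 0 \<le> t \<and> ereal t \<le> ereal \<tau>}. ereal \<bar>p t\<bar>) < ereal a \<longleftrightarrow> (\<forall>t\<in>{0..\<tau>}. p t \<in> {-a<..<a})"
proof -
  have S: "{t. 0 \<le> t \<and> ereal t \<le> ereal \<tau>} = {0..\<tau>}" by auto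
  have "continuous_on {0..\<tau>} (\<lambda>t. \<bar>p t\<bar>)"
    by (intro continuous_intros continuous_on_subset[OF p]) auto
  then obtain s where s: "s \<in> {0..\<tau>}" "\<And>t. t \<in> {0..\<tau>} \<Longrightarrow> \<bar>p t\<bar> \<le> \<bar>p s\<bar>"
    using continuous_attains_sup[of "{0..\<tau>}" "\<lambda>t. \<bar>p t\<bar>"] \<tau> by auto
  have "(SUP t\<in>{0..\<tau>}. ereal \<bar>p t\<bar>) = ereal \<bar>p s\<bar>"
    using s by (intro antisym SUP_least SUP_upper) auto
  then have "(SUP t\<in>{0..\<tau>}. ereal \<bar>p t\<bar>) < ereal a \<longleftrightarrow> \<bar>p s\<bar> < a" by simp
  also have "\<dots> \<longleftrightarrow> (\<forall>t\<in>{0..\<tau>}. p t \<in> {-a<..<a})"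
  proof
    assume l: "\<bar>p s\<bar> < a"
    show "\<forall>t\<in>{0..\<tau>}. p t \<in> {-a<..<a}"
    proof
      fix t assume "t \<in> {0..\<tau>}"
      then have "\<bar>p t\<bar> < a" using s(2)[of t] l by simp
      then show "p t \<in> {-a<..<a}" by auto
    qed
  next
    assume "\<forall>t\<in>{0..\<tau>}. p t \<in> {-a<..<a}"
    then have "p s \<in> {-a<..<a}" using s(1) by blast
    then show "\<bar>p s\<bar> < a" by auto
  qed
  finally show ?thesis unfolding S .
qed

locale brownian_cylinder = brownian_family P W
  for P :: "'a::euclidean_space \<Rightarrow> 'w measure" and W :: "real \<Rightarrow> 'w \<Rightarrow> 'a" +
  fixes Wt :: "real \<Rightarrow> 'w \<Rightarrow> real" and D :: "'a set" and \<mu> :: real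
  assumes brownian_t: "\<And>z. brownian_motion (P z) Wt 0" and independent: "\<And>z. independent_processes (P z) W Wt"
    and D: "open D" and \<mu>: "0 < \<mu>"
begin

sublocale BT: brownian_motion "P z" Wt 0 for z
  by (rule brownian_t)

definition a :: real where "a = pi / (2 * \<mu>)"

lemma a: "0 < a" "cos (\<mu> * a) = 0"
proof -
  have e: "\<mu> * a = pi / 2" using \<mu> by (simp add: a_def)
  show "cos (\<mu> * a) = 0" unfolding e by simp
  show "0 < a" using \<mu> by (simp add: a_def)
qed

text \<open>The common integrand to which both representations and the discount are reduced;
  \<open>path_exit\<close> states the survival of \<open>Wt\<close> in a form that is
  measurable.\<close>

definition killed :: "'a set \<Rightarrow> 'w \<Rightarrow> real" where
  "killed A \<omega> = of_bool (exit_time W D \<omega> < \<infinity> \<and> stopped W (exit_time W D) \<omega> \<in> A \<and>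
     exit_time W D \<omega> < path_exit {-a<..<a} (sample (\<lambda>t. Wt t \<omega>))) * cos (\<mu> * stopped Wt (exit_time W D) \<omega>)"

lemma measurable_lateral_exit [measurable]: "(\<lambda>\<omega>. path_exit {-a<..<a} (sample (\<lambda>t. Wt t \<omega>))) \<in> borel_measurable (P x)"
  by (rule measurable_compose[OF measurable_sample[OF BT.measurable] measurable_path_exit])

lemma measurable_exit_W [measurable]: "exit_time W D \<in> borel_measurable (P x)"
  by (rule measurable_exit_time_W[OF D])

lemma measurable_stop_W [measurable]: "stopped W (exit_time W D) \<in> borel_measurable (P x)"
  by (rule measurable_stopped_W[OF D])

lemma measurable_stop_Wt [measurable]: "stopped Wt (exit_time W D) \<in> borel_measurable (P x)"
  by (rule measurable_stopped[OF BT.measurable BT.continuous_paths measurable_exit_W exit_time_nonneg])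

lemma measurable_killed:
  assumes [measurable]: "A \<in> sets borel"
  shows "killed A \<in> borel_measurable (P x)"
  unfolding killed_def[abs_def] by measurable

text \<open>Given \<open>W\<close>, the time \<open>\<tau>\<close> is a constant for \<open>Wt\<close>, so the killed cosine integrates to \<open>exp (- \<mu>\<^sup>2 \<tau> / 2)\<close>.\<close>

lemma expectation_killed:
  assumes A [measurable]: "A \<in> sets borel"
  shows "(\<integral>\<omega>. killed A \<omega> \<partial>P x) = (\<integral>\<omega>. exit_weight (\<mu>\<^sup>2 / 2) D \<omega> * indicator A (stopped W (exit_time W D) \<omega>) \<partial>P x)"
proof -
  \<comment> \<open>The value -1 marks paths that never exit or exit outside \<open>A\<close>; it
    cannot be confused with an exit time, which is nonnegative.\<close>
  define X where "X y = (if path_exit D y < \<infinity> \<and> path_at y (real_of_ereal (path_exit D y)) \<in> A then real_of_ereal (path_exit D y) else - 1)" for y :: "nat \<times> nat \<Rightarrow> 'a"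
  have mp [measurable]: "(\<lambda>y. path_at y (real_of_ereal (path_exit D y))) \<in> borel_measurable (path_space :: (nat \<times> nat \<Rightarrow> 'a) measure)"
    by (intro measurable_path_at) measurable
  have [measurable]: "X \<in> borel_measurable path_space" unfolding X_def[abs_def] by measurable
  \<comment> \<open>\<open>indep_var\<close> wants both variables in one type: the real variable is turned into a constant path.\<close>
  have Xp: "(\<lambda>y q. X y) \<in> measurable path_space (path_space :: (nat \<times> nat \<Rightarrow> real) measure)"
    by (rule measurable_PiM_single') auto
  \<comment> \<open>The coordinate \<open>(0, 0)\<close> recovers the real number from the constant
    path.\<close>
  define h where "h u v = (if 0 \<le> u (0, 0) then cos (\<mu> * path_at v (u (0, 0))) * of_bool (ereal (u (0, 0)) < path_exit {-a<..<a} v) else 0)"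
    for u v :: "nat \<times> nat \<Rightarrow> real"
  have h_meas: "case_prod h \<in> borel_measurable (path_space \<Otimes>\<^sub>M path_space)"
  proof -
    have [measurable]: "(\<lambda>z. fst z (0, 0) :: real) \<in> borel_measurable (path_space \<Otimes>\<^sub>M (path_space :: (nat \<times> nat \<Rightarrow> real) measure))"
      by (rule measurable_compose[OF measurable_fst measurable_component_singleton]) simp
    have [measurable]: "(\<lambda>z. path_at (snd z) (fst z (0, 0))) \<in> borel_measurable (path_space \<Otimes>\<^sub>M (path_space :: (nat \<times> nat \<Rightarrow> real) measure))"
      by (intro measurable_path_at) measurable
    show ?thesis unfolding h_def case_prod_beta' by measurable
  qed
  have h1: "\<bar>h u v\<bar> \<le> 1" for u v by (simp add: h_def abs_mult)
  let ?X = "\<lambda>\<omega> q :: nat \<times> nat. X (sample (\<lambda>t. W t \<omega>))" and ?Y = "\<lambda>\<omega>. sample (\<lambda>t. Wt t \<omega>)"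
  have ind: "BM.indep_var x path_space ?X path_space ?Y"
    using BM.independent_functionals[OF independent BM.measurable BT.measurable Xp measurable_ident_sets[OF refl], of x] by simp
  have X_eq: "X (sample (\<lambda>t. W t \<omega>)) = (if exit_time W D \<omega> < \<infinity> \<and> stopped W (exit_time W D) \<omega> \<in> A then real_of_ereal (exit_time W D \<omega>) else - 1)"
    if \<omega>: "\<omega> \<in> space (P x)" for \<omega>
  proof -
    have c: "continuous_on {0..} (\<lambda>s. W s \<omega>)" using \<omega> by (rule BM.continuous_paths)
    show ?thesis
      unfolding X_def path_exit_sample_eq[of W \<omega> D, OF c D] path_at_sample[OF c real_of_ereal_pos[OF exit_time_nonneg]]
      by (simp add: stopped_def)
  qed
  have "(\<integral>\<omega>. killed A \<omega> \<partial>P x) = (\<integral>\<omega>. h (?X \<omega>) (?Y \<omega>) \<partial>P x)"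
  proof (intro Bochner_Integration.integral_cong refl)
    fix \<omega> assume \<omega>: "\<omega> \<in> space (P x)"
    have c: "continuous_on {0..} (\<lambda>s. Wt s \<omega>)" using \<omega> by (rule BT.continuous_paths)
    note nn = exit_time_nonneg[of W D \<omega>]
    show "killed A \<omega> = h (?X \<omega>) (?Y \<omega>)"
    proof (cases "exit_time W D \<omega> < \<infinity> \<and> stopped W (exit_time W D) \<omega> \<in> A")
      case True
      then obtain \<tau> where "exit_time W D \<omega> = ereal \<tau>" "0 \<le> \<tau>" using nn by (cases "exit_time W D \<omega>") auto
      then show ?thesis using True path_at_sample[OF c] unfolding h_def X_eq[OF \<omega>] by (simp add: killed_def stopped_def)
    next
      case False
      then show ?thesis unfolding h_def X_eq[OF \<omega>] by (auto simp: killed_def)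
    qed
  qed
  also have "\<dots> = (\<integral>\<omega>. \<integral>\<omega>'. h (?X \<omega>) (?Y \<omega>') \<partial>P x \<partial>P x)"
    by (rule BM.independent_expectation[OF ind h_meas h1])
  also have "\<dots> = (\<integral>\<omega>. exit_weight (\<mu>\<^sup>2 / 2) D \<omega> * indicator A (stopped W (exit_time W D) \<omega>) \<partial>P x)"
  proof (intro Bochner_Integration.integral_cong refl)
    fix \<omega> assume \<omega>: "\<omega> \<in> space (P x)"
    note nn = exit_time_nonneg[of W D \<omega>]
    show "(\<integral>\<omega>'. h (?X \<omega>) (?Y \<omega>') \<partial>P x) = exit_weight (\<mu>\<^sup>2 / 2) D \<omega> * indicator A (stopped W (exit_time W D) \<omega>)"
    proof (cases "exit_time W D \<omega> < \<infinity> \<and> stopped W (exit_time W D) \<omega> \<in> A")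
      case True
      then obtain \<tau> where \<tau>: "exit_time W D \<omega> = ereal \<tau>" "0 \<le> \<tau>" using nn by (cases "exit_time W D \<omega>") auto
      have "(\<integral>\<omega>'. h (?X \<omega>) (?Y \<omega>') \<partial>P x) = (\<integral>\<omega>'. cos (\<mu> * Wt \<tau> \<omega>') * of_bool (ereal \<tau> < path_exit {-a<..<a} (?Y \<omega>')) \<partial>P x)"
        using \<tau> True path_at_sample[OF BT.continuous_paths \<tau>(2)]
        by (intro Bochner_Integration.integral_cong refl) (simp add: h_def X_eq[OF \<omega>])
      also have "\<dots> = exp (- (\<mu>\<^sup>2 / 2) * \<tau>)" by (rule killed_cosine[OF brownian_t a \<tau>(2)])
      finally show ?thesis using \<tau> True by (simp add: exit_weight_def)
    next
      case False
      then show ?thesis unfolding h_def X_eq[OF \<omega>] by (auto simp: exit_weight_def)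
    qed
  qed
  finally show ?thesis .
qed

text \<open>The supremum includes time 0, which \<open>path_exit\<close> disregards. The two events
  differ only in the position of \<open>Wt\<close> at time 0, which is almost surely the
  origin.\<close>

lemma exit_representation:
  assumes A [measurable]: "A \<in> sets borel"
  shows "(LINT \<omega>:{\<omega> \<in> space (P x). exit_time W D \<omega> < \<infinity> \<and> stopped W (exit_time W D) \<omega> \<in> A \<and>
      (SUP t\<in>{t. 0 \<le> t \<and> ereal t \<le> exit_time W D \<omega>}. ereal \<bar>Wt t \<omega>\<bar>) < ereal (pi / (2 * \<mu>))} | P x.
      cos (\<mu> * stopped Wt (exit_time W D) \<omega>)) = (\<integral>\<omega>. killed A \<omega> \<partial>P x)"
proof -
  let ?c = "\<lambda>\<omega>. cos (\<mu> * stopped Wt (exit_time W D) \<omega>)"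
  define S where "S = {\<omega> \<in> space (P x). exit_time W D \<omega> < \<infinity> \<and> stopped W (exit_time W D) \<omega> \<in> A \<and>
      (SUP t\<in>{t. 0 \<le> t \<and> ereal t \<le> exit_time W D \<omega>}. ereal \<bar>Wt t \<omega>\<bar>) < ereal a}"
  have S_iff: "\<omega> \<in> S \<longleftrightarrow> exit_time W D \<omega> < \<infinity> \<and> stopped W (exit_time W D) \<omega> \<in> A \<and>
      exit_time W D \<omega> < path_exit {-a<..<a} (sample (\<lambda>t. Wt t \<omega>)) \<and> Wt 0 \<omega> \<in> {-a<..<a}" if \<omega>: "\<omega> \<in> space (P x)" for \<omega>
  proof (cases "exit_time W D \<omega> < \<infinity>")
    case True
    then obtain \<tau> where \<tau>: "exit_time W D \<omega> = ereal \<tau>" "0 \<le> \<tau>"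
      using exit_time_nonneg[of W D \<omega>] by (cases "exit_time W D \<omega>") auto
    note sup = SUP_abs_less_iff[OF BT.continuous_paths[OF \<omega>] \<tau>(2), of a]
    show ?thesis
    proof (cases "Wt 0 \<omega> \<in> {-a<..<a}")
      case True
      then show ?thesis
        using sup less_path_exit_iff[OF BT.continuous_paths[OF \<omega>] _ True \<tau>(2)] \<tau> \<omega> by (simp add: S_def)
    next
      case False
      then show ?thesis using sup \<tau> by (auto simp: S_def)
    qed
  qed (simp add: S_def)
  have "set_lebesgue_integral (P x) S ?c = (\<integral>\<omega>. indicator S \<omega> * ?c \<omega> \<partial>P x)"
    by (simp add: set_lebesgue_integral_def)
  also have "\<dots> = (\<integral>\<omega>. killed A \<omega> \<partial>P x)"
  proof (rule integral_cong_AE)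
    have S_eq: "S = {\<omega> \<in> space (P x). exit_time W D \<omega> < \<infinity> \<and> stopped W (exit_time W D) \<omega> \<in> A \<and>
        exit_time W D \<omega> < path_exit {-a<..<a} (sample (\<lambda>t. Wt t \<omega>)) \<and> Wt 0 \<omega> \<in> {-a<..<a}}"
      using S_iff by (auto simp: S_def)
    have [measurable]: "Wt 0 \<in> borel_measurable (P x)" by (rule BT.measurable) simp
    have "S \<in> sets (P x)" unfolding S_eq by measurable
    then show "(\<lambda>\<omega>. indicator S \<omega> * ?c \<omega>) \<in> borel_measurable (P x)" by measurable
    show "killed A \<in> borel_measurable (P x)" by (rule measurable_killed[OF A])
    show "AE \<omega> in P x. indicator S \<omega> * ?c \<omega> = killed A \<omega>"
      using BT.start[of x] AE_space
    proof eventually_elim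
      case (elim \<omega>)
      then show ?case using S_iff[OF elim(2)] a(1) by (simp add: killed_def indicator_def)
    qed
  qed
  finally show ?thesis by (simp add: S_def a_def)
qed

section \<open>Exit from the cylinder\<close>

abbreviation Z :: "real \<Rightarrow> 'w \<Rightarrow> 'a \<times> real" where "Z \<equiv> \<lambda>t \<omega>. (W t \<omega>, Wt t \<omega>)"

abbreviation cylinder :: "('a \<times> real) set" where "cylinder \<equiv> D \<times> {-a<..<a}"

lemma exit_time_cylinder:
  "exit_time Z cylinder \<omega> = min (exit_time W D \<omega>) (exit_time Wt {-a<..<a} \<omega>)"
proof -
  have "{t. 0 < t \<and> Z t \<omega> \<notin> cylinder} = {t. 0 < t \<and> W t \<omega> \<notin> D} \<union> {t. 0 < t \<and> Wt t \<omega> \<notin> {-a<..<a}}" by auto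
  then show ?thesis unfolding exit_time_def by (simp only: INF_union inf_min)
qed

text \<open>If \<open>W\<close> leaves \<open>D\<close> strictly first, the cylinder is left through
  its lateral boundary at that time. Otherwise, a tie included, \<open>Wt\<close> sits at an end of
  the interval at the exit, and both sides are 0.\<close>

lemma lateral_exit_iff:
  assumes \<omega>: "\<omega> \<in> space (P x)" and W0: "W 0 \<omega> \<in> D" and Wt0: "Wt 0 \<omega> = 0" and A: "A \<subseteq> frontier D"
  shows "(if exit_time Z cylinder \<omega> < \<infinity> \<and> stopped Z (exit_time Z cylinder) \<omega> \<in> A \<times> {-a<..<a}
      then cos (\<mu> * snd (stopped Z (exit_time Z cylinder) \<omega>)) else 0) = killed A \<omega>"
proof -
  have c: "continuous_on {0..} (\<lambda>s. W s \<omega>)" and ct: "continuous_on {0..} (\<lambda>s. Wt s \<omega>)"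
    using BM.continuous_paths[OF \<omega>] BT.continuous_paths[OF \<omega>] by auto
  have Wt0I: "Wt 0 \<omega> \<in> {-a<..<a}" using Wt0 a by simp
  define \<sigma> where "\<sigma> = exit_time Wt {-a<..<a} \<omega>"
  have pe: "path_exit D (sample (\<lambda>t. W t \<omega>)) = exit_time W D \<omega>" "path_exit {-a<..<a} (sample (\<lambda>t. Wt t \<omega>)) = \<sigma>"
    unfolding \<sigma>_def by (rule path_exit_sample_eq[of W \<omega>, OF c D]) (rule path_exit_sample_eq[of Wt \<omega>, OF ct open_greaterThanLessThan])
  note ez = exit_time_cylinder[of \<omega>, folded \<sigma>_def]
  show ?thesis
  proof (cases "exit_time W D \<omega> < \<sigma>")
    case True
    then have fin: "exit_time W D \<omega> < \<infinity>" by auto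
    then obtain \<tau> where \<tau>: "exit_time W D \<omega> = ereal \<tau>" "0 \<le> \<tau>"
      using exit_time_nonneg[of W D \<omega>] by (cases "exit_time W D \<omega>") auto
    have e: "exit_time Z cylinder \<omega> = ereal \<tau>" unfolding ez using True \<tau> by simp
    have "Wt \<tau> \<omega> \<in> {-a<..<a}"
      using less_path_exit_iff[OF ct open_greaterThanLessThan Wt0I \<tau>(2)] True \<tau> pe(2) by simp
    then show ?thesis using True \<tau> e pe(2) by (simp add: killed_def stopped_def)
  next
    case False
    have nx: "\<not> (exit_time Z cylinder \<omega> < \<infinity> \<and> stopped Z (exit_time Z cylinder) \<omega> \<in> A \<times> {-a<..<a})"
    proof
      assume h: "exit_time Z cylinder \<omega> < \<infinity> \<and> stopped Z (exit_time Z cylinder) \<omega> \<in> A \<times> {-a<..<a}"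
      have e: "exit_time Z cylinder \<omega> = \<sigma>" unfolding ez using False by simp
      then obtain s where s: "\<sigma> = ereal s"
        using h exit_time_nonneg[of Wt "{-a<..<a}" \<omega>] by (cases \<sigma>) (auto simp: \<sigma>_def)
      from exit_position(2)[OF ct open_greaterThanLessThan Wt0I pe(2)[unfolded s]]
      have "Wt s \<omega> \<notin> {-a<..<a}" by (simp add: frontier_def interior_open del: greaterThanLessThan_iff)
      then show False using h e s by (simp add: stopped_def)
    qed
    show ?thesis unfolding if_not_P[OF nx] using False pe(2) by (simp add: killed_def)
  qed
qed

lemma harmonic_representation:
  assumes x: "x \<in> D" and A [measurable]: "A \<in> sets borel" and AF: "A \<subseteq> frontier D"
  shows "(LINT z:A \<times> {- (pi / (2 * \<mu>))<..<pi / (2 * \<mu>)} |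
      harmonic_measure (P x) (\<lambda>t \<omega>. (W t \<omega>, Wt t \<omega>)) (D \<times> {- (pi / (2 * \<mu>))<..<pi / (2 * \<mu>)}). cos (\<mu> * snd z)) = (\<integral>\<omega>. killed A \<omega> \<partial>P x)"
proof -
  let ?I = "{-a<..<a}" and ?\<theta> = "exit_time Z cylinder"
  let ?E = "{\<omega> \<in> space (P x). ?\<theta> \<omega> < \<infinity>}" and ?F = "frontier cylinder" and ?B = "A \<times> {-a<..<a}"
  have G: "open cylinder" using D by (intro open_Times) auto
  have Zm: "Z t \<in> borel_measurable (P x)" if "0 \<le> t" for t
    using BM.measurable[OF that, of x] BT.measurable[OF that, of x] by simp
  have Zc: "continuous_on {0..} (\<lambda>t. Z t \<omega>)" if "\<omega> \<in> space (P x)" for \<omega>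
    using BM.continuous_paths[OF that] BT.continuous_paths[OF that] by (intro continuous_intros)
  have [measurable]: "?\<theta> \<in> borel_measurable (P x)" by (rule measurable_exit_time[OF Zm Zc G])
  have SZ [measurable]: "stopped Z ?\<theta> \<in> borel_measurable (P x)"
    by (rule measurable_stopped[OF Zm Zc _ exit_time_nonneg]) measurable
  have E [measurable]: "?E \<in> sets (P x)" by measurable
  have F [measurable]: "?F \<in> sets borel" by (intro borel_closed frontier_closed)
  have B [measurable]: "?B \<in> sets borel"
    unfolding borel_prod[symmetric] by (intro pair_measureI) auto
  \<comment> \<open>The set lies in the lateral boundary, so restricting the harmonic measure to the
    frontier of the cylinder does not affect the integral.\<close>
  have BF: "?B \<subseteq> ?F"
    using AF a(1) D G by (auto simp: frontier_def closure_Times interior_open interior_Times)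
  have SZ': "stopped Z ?\<theta> \<in> borel_measurable (restrict_space (P x) ?E)"
    by (rule measurable_restrict_space1[OF SZ])
  define g where "g z = indicator ?F z * (indicator ?B z * cos (\<mu> * snd z))" for z :: "'a \<times> real"
  have g: "g \<in> borel_measurable borel"
    unfolding g_def[abs_def]
    by (intro borel_measurable_times borel_measurable_indicator F B borel_measurable_continuous_onI continuous_intros)
  have "(LINT z:?B | harmonic_measure (P x) Z cylinder. cos (\<mu> * snd z))
      = (\<integral>z. g z \<partial>distr (restrict_space (P x) ?E) borel (stopped Z ?\<theta>))"
    unfolding set_lebesgue_integral_def harmonic_measure_def g_def using F by (subst integral_restrict_space) auto
  also have "\<dots> = (\<integral>\<omega>. g (stopped Z ?\<theta> \<omega>) \<partial>restrict_space (P x) ?E)"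
    by (rule integral_distr[OF SZ' g])
  also have "\<dots> = (\<integral>\<omega>. indicator ?E \<omega> *\<^sub>R g (stopped Z ?\<theta> \<omega>) \<partial>P x)"
    using E by (intro integral_restrict_space) auto
  also have "\<dots> = (\<integral>\<omega>. killed A \<omega> \<partial>P x)"
  proof (rule integral_cong_AE)
    show "killed A \<in> borel_measurable (P x)" by (rule measurable_killed[OF A])
    show "(\<lambda>\<omega>. indicator ?E \<omega> *\<^sub>R g (stopped Z ?\<theta> \<omega>)) \<in> borel_measurable (P x)"
      by (intro borel_measurable_scaleR borel_measurable_indicator E measurable_compose[OF SZ g])
    show "AE \<omega> in P x. indicator ?E \<omega> *\<^sub>R g (stopped Z ?\<theta> \<omega>) = killed A \<omega>"
      using BM.start[of x] BT.start[of x] AE_space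
    proof eventually_elim
      case (elim \<omega>)
      have "W 0 \<omega> \<in> D" using elim(1) x by simp
      note k = lateral_exit_iff[OF elim(3) this elim(2) AF]
      show ?case
      proof (cases "?\<theta> \<omega> < \<infinity> \<and> stopped Z ?\<theta> \<omega> \<in> ?B")
        case True
        have "stopped Z ?\<theta> \<omega> \<in> ?F" by (rule subsetD[OF BF conjunct2[OF True]])
        then show ?thesis using True elim(3) unfolding k[symmetric] if_P[OF True] by (simp add: g_def)
      next
        case False
        then have "indicator ?E \<omega> = (0 :: real) \<or> indicator ?B (stopped Z ?\<theta> \<omega>) = (0 :: real)"
          by (simp add: indicator_def)
        then show ?thesis unfolding k[symmetric] if_not_P[OF False] by (auto simp: g_def)
      qed
    qed
  qed
  finally show ?thesis by (simp add: a_def)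
qed

end

theorem corollary2p15:
  fixes P :: "real ^ 'n \<Rightarrow> 'w measure"
    and W :: "real \<Rightarrow> 'w \<Rightarrow> real ^ 'n"
    and Wt :: "real \<Rightarrow> 'w \<Rightarrow> real"
    and D :: "(real ^ 'n) set"
    and \<mu> :: real
  assumes "CARD('n) \<ge> 2"
    and "\<And>z. brownian_motion (P z) W z"
    and "\<And>z. brownian_motion (P z) Wt 0"
    and "\<And>z. independent_processes (P z) W Wt"
    and "regular_domain P W D"
    and "\<mu> > 0"
  shows "(\<forall>x\<in>D.
            (\<exists>!H. is_panharmonic_measure \<mu> D x H) \<and>
            (\<forall>A\<in>sets (restrict_space borel (frontier D)).
               emeasure (panharmonic_measure \<mu> D x) A =
                 ennreal (LINT \<omega>:{\<omega> \<in> space (P x). exit_time W D \<omega> < \<infinity> \<and>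
                                   stopped W (exit_time W D) \<omega> \<in> A \<and>
                                   (SUP t\<in>{t. 0 \<le> t \<and> ereal t \<le> exit_time W D \<omega>}. ereal \<bar>Wt t \<omega>\<bar>)
                                     < ereal (pi / (2 * \<mu>))} | P x.
                            cos (\<mu> * stopped Wt (exit_time W D) \<omega>)) \<and>
               emeasure (panharmonic_measure \<mu> D x) A =
                 ennreal (LINT z:A \<times> {- (pi / (2 * \<mu>))<..<pi / (2 * \<mu>)} |
                            harmonic_measure (P x) (\<lambda>t \<omega>. (W t \<omega>, Wt t \<omega>))
                              (D \<times> {- (pi / (2 * \<mu>))<..<pi / (2 * \<mu>)}).
                            cos (\<mu> * snd z)))) \<and>
         (\<forall>f u. continuous_on (frontier D) f \<and> bounded (f ` frontier D) \<and>
                yukawa_dirichlet_solution \<mu> D f u \<and> bounded (u ` closure D) \<longrightarrow>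
            (\<forall>x\<in>D. has_bochner_integral (panharmonic_measure \<mu> D x) f (u x)))"
proof -
  have D: "open D" using assms(5) by (simp add: regular_domain_def)
  interpret brownian_cylinder P W Wt D \<mu>
    by (intro brownian_cylinder.intro brownian_family.intro brownian_cylinder_axioms.intro assms D)
  have pan: "is_panharmonic_measure \<mu> D x (exit_measure (\<mu>\<^sup>2 / 2) D x)" if "x \<in> D" for x
    by (rule exit_measure_is_panharmonic[OF assms(5,6) that])
  have uniq: "H = exit_measure (\<mu>\<^sup>2 / 2) D x" if "x \<in> D" "is_panharmonic_measure \<mu> D x H" for x H
    by (rule panharmonic_measure_unique[OF assms(5,6) that])
  have pm: "panharmonic_measure \<mu> D x = exit_measure (\<mu>\<^sup>2 / 2) D x" if "x \<in> D" for x
    unfolding panharmonic_measure_def by (rule the_equality, rule pan[OF that], rule uniq[OF that])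
  show ?thesis
  proof (intro conjI ballI allI impI)
    fix x assume x: "x \<in> D"
    show "\<exists>!H. is_panharmonic_measure \<mu> D x H" using pan[OF x] uniq[OF x] by blast
    fix A assume A: "A \<in> sets (restrict_space borel (frontier D))"
    have "frontier D \<in> sets borel" by (intro borel_closed frontier_closed)
    then have A: "A \<in> sets borel" "A \<subseteq> frontier D" using A by (auto simp: sets_restrict_space_iff)
    \<comment> \<open>By \<open>expectation_killed\<close> the integral equals one with a
      nonnegative integrand, so \<open>ennreal\<close> truncates nothing.\<close>
    have e: "emeasure (panharmonic_measure \<mu> D x) A = ennreal (\<integral>\<omega>. killed A \<omega> \<partial>P x)"
      unfolding pm[OF x] expectation_killed[OF A(1)] by (rule emeasure_exit_measure[OF D _ A]) simp
    show "emeasure (panharmonic_measure \<mu> D x) A =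
        ennreal (LINT \<omega>:{\<omega> \<in> space (P x). exit_time W D \<omega> < \<infinity> \<and> stopped W (exit_time W D) \<omega> \<in> A \<and>
          (SUP t\<in>{t. 0 \<le> t \<and> ereal t \<le> exit_time W D \<omega>}. ereal \<bar>Wt t \<omega>\<bar>) < ereal (pi / (2 * \<mu>))} | P x.
          cos (\<mu> * stopped Wt (exit_time W D) \<omega>))"
      unfolding e exit_representation[OF A(1)] ..
    show "emeasure (panharmonic_measure \<mu> D x) A =
        ennreal (LINT z:A \<times> {- (pi / (2 * \<mu>))<..<pi / (2 * \<mu>)} |
          harmonic_measure (P x) (\<lambda>t \<omega>. (W t \<omega>, Wt t \<omega>)) (D \<times> {- (pi / (2 * \<mu>))<..<pi / (2 * \<mu>)}). cos (\<mu> * snd z))"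
      unfolding e harmonic_representation[OF x A] ..
  next
    fix f u x
    assume fu: "continuous_on (frontier D) f \<and> bounded (f ` frontier D) \<and> yukawa_dirichlet_solution \<mu> D f u \<and> bounded (u ` closure D)"
      and x: "x \<in> D"
    then have "has_bochner_integral (panharmonic_measure \<mu> D x) u (u x)"
      using pan[OF x] unfolding pm[OF x] by (simp add: is_panharmonic_measure_def yukawa_dirichlet_solution_def)
    \<comment> \<open>The space of the measure is the frontier, and there \<open>u\<close> equals
      \<open>f\<close>.\<close>
    then show "has_bochner_integral (panharmonic_measure \<mu> D x) f (u x)"
      using fu by (subst (asm) has_bochner_integral_cong[where g = f])
        (auto simp: pm[OF x] space_exit_measure[OF D] yukawa_dirichlet_solution_def)
  qed
qed

end
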